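(* Let $a>0$ and $f\in L^2(\mathbf R^m,\mathbf C^{(m)})$. Then $f$ is the restriction to $\mathbf R^m=\{x_0=0\}$ of a function in $H^2(S_a,\mathbf C^{(m)})$ if and only if there exists a measurable $\mathbf C^{(m)}$-valued function $g$ on $\mathbf R^m$ such that $e^{a|\underline\xi|}g(\underline\xi)\in L^2(\mathbf R^m,\mathbf C^{(m)})$ and the extension of $f$ is given by $$f(x)=\frac{1}{(2\pi)^m}\int_{\mathbf R^m}e(x,\underline\xi)\,g(\underline\xi)\,d\underline\xi,\qquad x\in S_a;$$ in this case $g=\mathcal F(f)$. Moreover, for such $f$ (extended to $S_a$) there exist $f_+\in H^2(\mathbf R^{m+1}_{+,-a},\mathbf C^{(m)})$ and $f_-\in H^2(\mathbf R^{m+1}_{-,a},\mathbf C^{(m)})$ such that $f(x)=f_+(x)+f_-(x)$ for $x\in S_a$, and this decomposition is unique; thus $H^2(S_a,\mathbf C^{(m)})=H^2(\mathbf R^{m+1}_{+,-a},\mathbf C^{(m)})\oplus H^2(\mathbf R^{m+1}_{-,a},\mathbf C^{(m)})$.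
   Context: $\mathbf C^{(m)}$ is the complex Clifford algebra generated by $\mathbf e_1,\dots,\mathbf e_m$ with $\mathbf e_j\mathbf e_k+\mathbf e_k\mathbf e_j=-2\delta_{jk}$ and unit $\mathbf e_0=1$; an element $x=\sum_T x_T\mathbf e_T$ has norm $|x|=(\sum_T|x_T|^2)^{1/2}$. Points of $\mathbf R^{m+1}$ are written $x=x_0+\underline x$, $\underline x=x_1\mathbf e_1+\dots+x_m\mathbf e_m\in\mathbf R^m$. A $\mathbf C^{(m)}$-valued $C^1$ function $F$ on an open set $\Omega\subset\mathbf R^{m+1}$ is left-monogenic if $\sum_{k=0}^m\mathbf e_k\partial F/\partial x_k=0$ in $\Omega$. The Fourier transform is $\mathcal F(f)(\underline\xi)=\int_{\mathbf R^m}e^{-i\langle\underline x,\underline\xi\rangle}f(\underline x)d\underline x$, applied componentwise and extended to $L^2$. For $\underline\xi\in\mathbf R^m\setminus\{0\}$: $\chi_\pm(\underline\xi)=\frac12(1\pm i\underline\xi/|\underline\xi|)$, $e^\pm(x,\underline\xi)=e^{i\langle\underline x,\underline\xi\rangle}e^{\mp x_0|\underline\xi|}\chi_\pm(\underline\xi)$, $e(x,\underline\xi)=e^+(x,\underline\xi)+e^-(x,\underline\xi)$. Domains: $S_a=\{x: |x_0|<a\}$, $\mathbf R^{m+1}_{+,-a}=\{x: x_0>-a\}$, $\mathbf R^{m+1}_{-,a}=\{x:x_0<a\}$. For such a domain $\Omega$ and $1\le p<\infty$, $H^p(\Omega,\mathbf C^{(m)})$ is the space of left-monogenic $F$ on $\Omega$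 with $\sup_{x_0}\int_{\mathbf R^m}|F(x_0+\underline x)|^p d\underline x<\infty$, the supremum over those $x_0$ with $x_0+\underline x\in\Omega$. *)

theory Defs
  imports "HOL-Analysis.Analysis"
begin

text \<open>Complex Clifford algebra C^(m). The generators are indexed by a finite linearly
ordered type 'm (so m = CARD('m)); an element is a family of complex coefficients x_T
indexed by the subsets T of 'm. The norm of the vec type is the l2 norm of the coefficients,
which is exactly |x| of the paper.\<close>

type_synonym 'm clif = "(complex, 'm set) vec"

definition clif_sign :: "'m::linorder set \<Rightarrow> 'm set \<Rightarrow> complex" where
  "clif_sign S T = (-1) ^ (card {(s,t). s \<in> S \<and> t \<in> T \<and> t < s} + card (S \<inter> T))"

text \<open>e_S e_T = sign(S,T) e_(S symmetric-difference T), with e_j e_k + e_k e_j = -2 delta_jk.\<close>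
definition clif_mult :: "'m::{finite,linorder} clif \<Rightarrow> 'm clif \<Rightarrow> 'm clif" where
  "clif_mult x y = (\<chi> U. \<Sum>S\<in>UNIV. \<Sum>T\<in>UNIV.
      if (S - T) \<union> (T - S) = U then clif_sign S T * (x $ S) * (y $ T) else 0)"

definition clif_one :: "'m::finite clif" where
  "clif_one = (\<chi> T. if T = {} then 1 else 0)"

definition clif_gen :: "'m::finite \<Rightarrow> 'm clif" where
  "clif_gen k = (\<chi> T. if T = {k} then 1 else 0)"

definition cscale :: "complex \<Rightarrow> 'm::finite clif \<Rightarrow> 'm clif" where
  "cscale c x = (\<chi> T. c * (x $ T))"

definition clif_vec :: "(real, 'm::finite) vec \<Rightarrow> 'm clif" where
  "clif_vec \<xi> = (\<Sum>k\<in>UNIV. (\<xi> $ k) *\<^sub>R clif_gen k)"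

definition chi_plus :: "(real, 'm::finite) vec \<Rightarrow> 'm clif" where
  "chi_plus \<xi> = cscale (1/2) (clif_one + cscale \<i> (inverse (norm \<xi>) *\<^sub>R clif_vec \<xi>))"

definition chi_minus :: "(real, 'm::finite) vec \<Rightarrow> 'm clif" where
  "chi_minus \<xi> = cscale (1/2) (clif_one - cscale \<i> (inverse (norm \<xi>) *\<^sub>R clif_vec \<xi>))"

text \<open>Points of R^(m+1) are pairs (x0, x) with x in R^m.
  e(x,xi) = e^+(x,xi) + e^-(x,xi).\<close>
definition ekern :: "real \<times> ((real, 'm::finite) vec) \<Rightarrow> (real, 'm) vec \<Rightarrow> 'm clif" where
  "ekern x \<xi> = cscale (exp (\<i> * complex_of_real (snd x \<bullet> \<xi>)))
      (exp (- fst x * norm \<xi>) *\<^sub>R chi_plus \<xi> + exp (fst x * norm \<xi>) *\<^sub>R chi_minus \<xi>)"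

definition cauchy_ext :: "((real, 'm::{finite,linorder}) vec \<Rightarrow> 'm clif) \<Rightarrow> real \<times> ((real, 'm) vec) \<Rightarrow> 'm clif" where
  "cauchy_ext g x = (1 / (2 * pi) ^ CARD('m)) *\<^sub>R (\<integral>\<xi>. clif_mult (ekern x \<xi>) (g \<xi>) \<partial>lborel)"

definition strip :: "real \<Rightarrow> (real \<times> ((real, 'm::finite) vec)) set" where
  "strip a = {x. \<bar>fst x\<bar> < a}"

definition halfplus :: "real \<Rightarrow> (real \<times> ((real, 'm::finite) vec)) set" where
  "halfplus a = {x. fst x > - a}"

definition halfminus :: "real \<Rightarrow> (real \<times> ((real, 'm::finite) vec)) set" where
  "halfminus a = {x. fst x < a}"

definition pd0 :: "(real \<times> ((real, 'm::finite) vec) \<Rightarrow> 'm clif) \<Rightarrow> real \<times> ((real, 'm) vec) \<Rightarrow> 'm clif" where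
  "pd0 F x = frechet_derivative F (at x) (1, 0)"

definition pdk :: "(real \<times> ((real, 'm::finite) vec) \<Rightarrow> 'm clif) \<Rightarrow> 'm \<Rightarrow> real \<times> ((real, 'm) vec) \<Rightarrow> 'm clif" where
  "pdk F k x = frechet_derivative F (at x) (0, axis k 1)"

definition left_monogenic :: "(real \<times> ((real, 'm::{finite,linorder}) vec)) set \<Rightarrow> (real \<times> ((real, 'm) vec) \<Rightarrow> 'm clif) \<Rightarrow> bool" where
  "left_monogenic \<Omega> F \<longleftrightarrow> open \<Omega> \<and>
     (\<forall>x\<in>\<Omega>. F differentiable (at x)) \<and>
     continuous_on \<Omega> (pd0 F) \<and> (\<forall>k. continuous_on \<Omega> (pdk F k)) \<and>
     (\<forall>x\<in>\<Omega>. pd0 F x + (\<Sum>k\<in>UNIV. clif_mult (clif_gen k) (pdk F k x)) = 0)"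

definition H2 :: "(real \<times> ((real, 'm::{finite,linorder}) vec)) set \<Rightarrow> (real \<times> ((real, 'm) vec) \<Rightarrow> 'm clif) \<Rightarrow> bool" where
  "H2 \<Omega> F \<longleftrightarrow> left_monogenic \<Omega> F \<and>
     (SUP x0\<in>fst ` \<Omega>. \<integral>\<^sup>+ y. ennreal ((norm (F (x0, y)))\<^sup>2) \<partial>lborel) < \<infinity>"

definition L2fun :: "((real, 'm::finite) vec \<Rightarrow> 'm clif) \<Rightarrow> bool" where
  "L2fun f \<longleftrightarrow> f \<in> borel_measurable lborel \<and>
     (\<integral>\<^sup>+ x. ennreal ((norm (f x))\<^sup>2) \<partial>lborel) < \<infinity>"

definition fourier_trunc :: "((real, 'm::finite) vec \<Rightarrow> 'm clif) \<Rightarrow> real \<Rightarrow> (real, 'm) vec \<Rightarrow> 'm clif" where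
  "fourier_trunc f R \<xi> = (\<integral>x. indicator (cball 0 R) x *\<^sub>R
      cscale (exp (- \<i> * complex_of_real (x \<bullet> \<xi>))) (f x) \<partial>lborel)"

definition is_fourier_L2 :: "((real, 'm::finite) vec \<Rightarrow> 'm clif) \<Rightarrow> ((real, 'm) vec \<Rightarrow> 'm clif) \<Rightarrow> bool" where
  "is_fourier_L2 f g \<longleftrightarrow> L2fun g \<and>
     ((\<lambda>R. \<integral>\<^sup>+ \<xi>. ennreal ((norm (g \<xi> - fourier_trunc f R \<xi>))\<^sup>2) \<partial>lborel) \<longlongrightarrow> 0) at_top"

end

theory Submission
  imports Defs "HOL-Probability.Characteristic_Functions"
begin

text \<open>
Left multiplication by i xi is self-adjoint with square |xi|^2. For a function F in the Hardy space of
the strip, the monogenic equation says that the Fourier transform g(t) of its slice at height t is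
exp(- t i xi) g(0), where exp(- t i xi) has eigenvalues exp(- t |xi|) on the range of chi_plus and
exp(t |xi|) on that of chi_minus. Letting t tend to a and to -a turns the uniform bound on the slices
into square-integrability of exp(a |xi|) g(0), and Fourier inversion gives the integral formula. The two
spectral parts of g(0) extend to the two half spaces. If a function extends to both half spaces then
exp(b |xi|) g(0) is bounded in L2 for every b, so it vanishes; this is uniqueness.

F is only known to be C1 with L2 slices, so the evolution of g(t) is not obtained by differentiating it.
Since the generators are skew, Green's identity shows that the L2 pairing of the slice of F at height t
with the slice of G at height -t does not depend on t when F and G are monogenic on the strip. Taking
for G the monogenic extensions of functions with compactly supported Fourier transform gives g(t).

Only the inequality in Plancherel's theorem is needed.
\<close>

section \<open>Square-integrable functions\<close>

definition L2 :: "('a::euclidean_space \<Rightarrow> 'b::euclidean_space) \<Rightarrow> bool" where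
  "L2 f \<longleftrightarrow> f \<in> borel_measurable borel \<and> integrable lborel (\<lambda>x. (norm (f x))\<^sup>2)"

definition l2 :: "('a::euclidean_space \<Rightarrow> 'b::euclidean_space) \<Rightarrow> real" where
  "l2 f = sqrt (\<integral>x. (norm (f x))\<^sup>2 \<partial>lborel)"

lemma L2_measurable [measurable_dest]: "L2 f \<Longrightarrow> f \<in> borel_measurable borel"
  by (simp add: L2_def)

lemma L2_integrable: "L2 f \<Longrightarrow> integrable lborel (\<lambda>x. (norm (f x))\<^sup>2)"
  by (simp add: L2_def)

lemma l2_nonneg [simp]: "0 \<le> l2 f"
  by (simp add: l2_def)

lemma l2_power2: "(l2 f)\<^sup>2 = (\<integral>x. (norm (f x))\<^sup>2 \<partial>lborel)"
  by (simp add: l2_def)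

lemma nn_integral_L2: "L2 f \<Longrightarrow> (\<integral>\<^sup>+x. ennreal ((norm (f x))\<^sup>2) \<partial>lborel) = ennreal ((l2 f)\<^sup>2)"
  by (simp add: l2_power2 L2_def nn_integral_eq_integral)

lemma L2_nn_integralI:
  assumes "f \<in> borel_measurable borel" "(\<integral>\<^sup>+x. ennreal ((norm (f x))\<^sup>2) \<partial>lborel) \<le> ennreal (C\<^sup>2)" "0 \<le> C"
  shows "L2 f" "l2 f \<le> C"
proof -
  have [measurable]: "f \<in> borel_measurable borel" by fact
  show L2_f: "L2 f"
    unfolding L2_def integrable_iff_bounded using assms
    by (auto simp: order_le_less_trans)
  from assms have "ennreal ((l2 f)\<^sup>2) \<le> ennreal (C\<^sup>2)" by (simp add: nn_integral_L2[OF L2_f])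
  then show "l2 f \<le> C" using \<open>0 \<le> C\<close> by (simp add: power2_le_iff_abs_le)
qed

lemma L2fun_iff_L2: "L2fun f \<longleftrightarrow> L2 f"
  by (auto simp: L2fun_def L2_def integrable_iff_bounded)

lemma L2_dominated:
  assumes "L2 g" "f \<in> borel_measurable borel" "AE x in lborel. norm (f x) \<le> c * norm (g x)" "0 \<le> c"
  shows "L2 f" "l2 f \<le> c * l2 g"
proof -
  note [measurable] = assms(2) L2_measurable[OF assms(1)]
  have square_le: "AE x in lborel. (norm (f x))\<^sup>2 \<le> c\<^sup>2 * (norm (g x))\<^sup>2"
    using assms(3) by eventually_elim (metis norm_ge_zero power_mono power_mult_distrib)
  show L2_f: "L2 f"
    unfolding L2_def
  proof
    show "integrable lborel (\<lambda>x. (norm (f x))\<^sup>2)"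
      by (rule Bochner_Integration.integrable_bound[where f="\<lambda>x. c\<^sup>2 * (norm (g x))\<^sup>2"])
         (use L2_integrable[OF assms(1)] square_le in auto)
  qed fact
  have "(l2 f)\<^sup>2 \<le> (\<integral>x. c\<^sup>2 * (norm (g x))\<^sup>2 \<partial>lborel)"
    unfolding l2_power2 using square_le L2_integrable[OF L2_f] L2_integrable[OF assms(1)]
    by (intro integral_mono_AE) auto
  also have "\<dots> = (c * l2 g)\<^sup>2" by (simp add: l2_power2 power_mult_distrib)
  finally show "l2 f \<le> c * l2 g" using \<open>0 \<le> c\<close> by (simp add: power2_le_iff_abs_le)
qed

lemma L2_scaleR: "L2 f \<Longrightarrow> L2 (\<lambda>x. c *\<^sub>R f x)"
  by (rule L2_dominated(1)[where g=f and c="\<bar>c\<bar>"]) auto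

lemma l2_cong_AE:
  assumes "AE x in lborel. f x = g x" "f \<in> borel_measurable borel" "g \<in> borel_measurable borel"
  shows "l2 f = l2 g"
  unfolding l2_def using assms by (intro arg_cong[where f=sqrt] integral_cong_AE) auto

lemma L2_cong_AE:
  assumes "AE x in lborel. f x = g x" "L2 g" "f \<in> borel_measurable borel"
  shows "L2 f"
  by (rule L2_dominated(1)[OF assms(2,3), where c=1]) (use assms in auto)

lemma L2_add:
  assumes "L2 f" "L2 g" shows "L2 (\<lambda>x. f x + g x)"
  unfolding L2_def
proof
  note [measurable] = L2_measurable[OF assms(1)] L2_measurable[OF assms(2)]
  show "(\<lambda>x. f x + g x) \<in> borel_measurable borel" by measurable
  have "(norm (u + v))\<^sup>2 \<le> 2 * (norm u)\<^sup>2 + 2 * (norm v)\<^sup>2" for u v :: 'b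
  proof -
    have "(norm (u + v))\<^sup>2 \<le> (norm u + norm v)\<^sup>2" by (simp add: norm_triangle_ineq power_mono)
    also have "\<dots> \<le> 2 * (norm u)\<^sup>2 + 2 * (norm v)\<^sup>2" using sum_squares_bound[of "norm u" "norm v"]
      by (simp add: power2_sum)
    finally show ?thesis .
  qed
  then show "integrable lborel (\<lambda>x. (norm (f x + g x))\<^sup>2)"
    by (intro Bochner_Integration.integrable_bound[where g="\<lambda>x. (norm (f x + g x))\<^sup>2" and
          f="\<lambda>x. 2 * (norm (f x))\<^sup>2 + 2 * (norm (g x))\<^sup>2"])
       (use L2_integrable[OF assms(1)] L2_integrable[OF assms(2)] in auto)
qed

lemma L2_diff: "L2 f \<Longrightarrow> L2 g \<Longrightarrow> L2 (\<lambda>x. f x - g x)"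
  using L2_add[of f "\<lambda>x. (-1) *\<^sub>R g x"] L2_scaleR[of g "-1"] by simp

lemma l2_minus_commute: "l2 (\<lambda>x. f x - g x) = l2 (\<lambda>x. g x - f x)"
  by (simp add: l2_def norm_minus_commute)

lemma L2_Cauchy_Schwarz:
  assumes "L2 f" "L2 g"
  shows "integrable lborel (\<lambda>x. norm (f x) * norm (g x))"
    and "(\<integral>x. norm (f x) * norm (g x) \<partial>lborel) \<le> l2 f * l2 g"
proof -
  note [measurable] = L2_measurable[OF assms(1)] L2_measurable[OF assms(2)]
  have "norm (norm (f x) * norm (g x)) \<le> norm ((norm (f x))\<^sup>2 + (norm (g x))\<^sup>2)" for x
    using sum_squares_bound[of "norm (f x)" "norm (g x)"] mult_nonneg_nonneg[of "norm (f x)" "norm (g x)"]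
    by (auto simp del: mult_nonneg_nonneg)
  then show product_integrable: "integrable lborel (\<lambda>x. norm (f x) * norm (g x))"
    by (intro Bochner_Integration.integrable_bound[where f="\<lambda>x. (norm (f x))\<^sup>2 + (norm (g x))\<^sup>2" and
          g="\<lambda>x. norm (f x) * norm (g x)"])
       (use L2_integrable[OF assms(1)] L2_integrable[OF assms(2)] in auto)
  have "(\<integral>\<^sup>+x. ennreal (norm (f x)) * ennreal (norm (g x)) \<partial>lborel)\<^sup>2
      \<le> (\<integral>\<^sup>+x. (ennreal (norm (f x)))\<^sup>2 \<partial>lborel) * (\<integral>\<^sup>+x. (ennreal (norm (g x)))\<^sup>2 \<partial>lborel)"
    by (rule Cauchy_Schwarz_nn_integral) auto
  then have "(\<integral>\<^sup>+x. ennreal (norm (f x) * norm (g x)) \<partial>lborel)\<^sup>2 \<le> ennreal ((l2 f)\<^sup>2) * ennreal ((l2 g)\<^sup>2)"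
    by (simp add: ennreal_mult' ennreal_power nn_integral_L2[OF assms(1)] nn_integral_L2[OF assms(2)])
  then have "(ennreal (\<integral>x. norm (f x) * norm (g x) \<partial>lborel))\<^sup>2 \<le> ennreal ((l2 f * l2 g)\<^sup>2)"
    using nn_integral_eq_integral[OF product_integrable] by (simp add: ennreal_mult' power_mult_distrib)
  then have "(\<integral>x. norm (f x) * norm (g x) \<partial>lborel)\<^sup>2 \<le> (l2 f * l2 g)\<^sup>2"
    by (simp add: ennreal_power)
  then show "(\<integral>x. norm (f x) * norm (g x) \<partial>lborel) \<le> l2 f * l2 g"
    by (rule power2_le_imp_le) simp
qed

lemma borel_measurable_bounded_bilinear:
  fixes p :: "'b::euclidean_space \<Rightarrow> 'c::euclidean_space \<Rightarrow> 'd::euclidean_space"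
  assumes "bounded_bilinear p" "f \<in> borel_measurable M" "g \<in> borel_measurable M"
  shows "(\<lambda>x. p (f x) (g x)) \<in> borel_measurable M"
  by (rule borel_measurable_continuous_Pair[OF assms(2,3)])
     (auto intro!: bounded_bilinear.continuous_on[OF assms(1)] continuous_intros)

lemma L2_bilinear:
  fixes p :: "'b::euclidean_space \<Rightarrow> 'c::euclidean_space \<Rightarrow> 'd::euclidean_space"
  assumes "bounded_bilinear p" "\<And>a b. norm (p a b) \<le> norm a * norm b * K" "L2 f" "L2 g"
  shows "integrable lborel (\<lambda>x. p (f x) (g x))"
    and "norm (\<integral>x. p (f x) (g x) \<partial>lborel) \<le> l2 f * l2 g * \<bar>K\<bar>"
proof -
  note Cauchy_Schwarz = L2_Cauchy_Schwarz[OF assms(3,4)]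
  have p_le: "norm (p a b) \<le> norm a * norm b * \<bar>K\<bar>" for a b
    by (rule order_trans[OF assms(2) mult_left_mono[OF abs_ge_self]]) simp
  show p_integrable: "integrable lborel (\<lambda>x. p (f x) (g x))"
  proof (rule Bochner_Integration.integrable_bound[OF integrable_mult_left[OF Cauchy_Schwarz(1), of "\<bar>K\<bar>"]])
    show "(\<lambda>x. p (f x) (g x)) \<in> borel_measurable lborel"
      using L2_measurable[OF assms(3)] L2_measurable[OF assms(4)]
      by (simp add: borel_measurable_bounded_bilinear[OF assms(1)])
  qed (auto intro: order_trans[OF p_le] simp: abs_mult)
  have "norm (\<integral>x. p (f x) (g x) \<partial>lborel) \<le> (\<integral>x. norm (f x) * norm (g x) * \<bar>K\<bar> \<partial>lborel)"
    by (rule order_trans[OF integral_norm_bound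
          integral_mono[OF integrable_norm[OF p_integrable] integrable_mult_left[OF Cauchy_Schwarz(1)] p_le]])
  also have "\<dots> \<le> l2 f * l2 g * \<bar>K\<bar>"
    using Cauchy_Schwarz(2) by (simp add: mult_right_mono)
  finally show "norm (\<integral>x. p (f x) (g x) \<partial>lborel) \<le> l2 f * l2 g * \<bar>K\<bar>" .
qed

lemma L2_inner:
  assumes "L2 f" "L2 g"
  shows "integrable lborel (\<lambda>x. f x \<bullet> g x)" "norm (\<integral>x. f x \<bullet> g x \<partial>lborel) \<le> l2 f * l2 g"
  using L2_bilinear[OF bounded_bilinear_inner, where K=1] assms by (auto simp: Cauchy_Schwarz_ineq2)

lemma l2_triangle:
  assumes "L2 f" "L2 g" shows "l2 (\<lambda>x. f x + g x) \<le> l2 f + l2 g"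
proof -
  note Cauchy_Schwarz = L2_Cauchy_Schwarz[OF assms]
  have "(l2 (\<lambda>x. f x + g x))\<^sup>2 \<le> (\<integral>x. (norm (f x))\<^sup>2 + 2 * (norm (f x) * norm (g x)) + (norm (g x))\<^sup>2 \<partial>lborel)"
    unfolding l2_power2
  proof (rule integral_mono)
    show "(norm (f x + g x))\<^sup>2 \<le> (norm (f x))\<^sup>2 + 2 * (norm (f x) * norm (g x)) + (norm (g x))\<^sup>2" for x
      using power_mono[OF norm_triangle_ineq[of "f x" "g x"], of 2] by (simp add: power2_sum)
  qed (use Cauchy_Schwarz(1) L2_integrable[OF L2_add[OF assms]] L2_integrable[OF assms(1)]
      L2_integrable[OF assms(2)] in auto)
  also have "\<dots> = (l2 f)\<^sup>2 + 2 * (\<integral>x. norm (f x) * norm (g x) \<partial>lborel) + (l2 g)\<^sup>2"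
    using Cauchy_Schwarz(1) L2_integrable[OF assms(1)] L2_integrable[OF assms(2)] by (simp add: l2_power2)
  also have "\<dots> \<le> (l2 f + l2 g)\<^sup>2"
    using Cauchy_Schwarz(2) by (simp add: power2_sum)
  finally show ?thesis by (rule power2_le_imp_le) simp
qed

lemma l2_triangle_diff:
  assumes "L2 f" "L2 g" "L2 h" shows "l2 (\<lambda>x. f x - h x) \<le> l2 (\<lambda>x. f x - g x) + l2 (\<lambda>x. g x - h x)"
  using l2_triangle[OF L2_diff[OF assms(1,2)] L2_diff[OF assms(2,3)]] by simp

lemma l2_le_0_imp_AE_eq_0:
  assumes "L2 f" "l2 f \<le> 0" shows "AE x in lborel. f x = 0"
proof -
  have "(\<integral>x. (norm (f x))\<^sup>2 \<partial>lborel) = 0" using assms(2) l2_nonneg[of f] by (simp flip: l2_power2)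
  then show ?thesis using integral_nonneg_eq_0_iff_AE[OF L2_integrable[OF assms(1)]] by auto
qed

lemma L2_bilinear_tendsto:
  fixes p :: "'b::euclidean_space \<Rightarrow> 'c::euclidean_space \<Rightarrow> 'd::euclidean_space"
  assumes p: "bounded_bilinear p" and L2: "\<And>n. L2 (u n)" "L2 w" "L2 v"
    and u_tendsto: "((\<lambda>n. l2 (\<lambda>x. w x - u n x)) \<longlongrightarrow> 0) F"
  shows "((\<lambda>n. \<integral>x. p (u n x) (v x) \<partial>lborel) \<longlongrightarrow> (\<integral>x. p (w x) (v x) \<partial>lborel)) F"
proof -
  obtain K where K: "\<And>a b. norm (p a b) \<le> norm a * norm b * K"
    using bounded_bilinear.bounded[OF p] by blast
  have "norm ((\<integral>x. p (u n x) (v x) \<partial>lborel) - (\<integral>x. p (w x) (v x) \<partial>lborel))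
      \<le> l2 (\<lambda>x. w x - u n x) * l2 v * \<bar>K\<bar>" for n
  proof -
    have "(\<integral>x. p (u n x) (v x) \<partial>lborel) - (\<integral>x. p (w x) (v x) \<partial>lborel) = (\<integral>x. p (u n x - w x) (v x) \<partial>lborel)"
      using L2_bilinear(1)[OF p K L2(1,3)] L2_bilinear(1)[OF p K L2(2,3)]
      by (simp add: bounded_bilinear.diff_left[OF p])
    then show ?thesis using L2_bilinear(2)[OF p K L2_diff[OF L2(1,2)] L2(3)] by (simp add: l2_minus_commute[of w])
  qed
  then have "((\<lambda>n. (\<integral>x. p (u n x) (v x) \<partial>lborel) - (\<integral>x. p (w x) (v x) \<partial>lborel)) \<longlongrightarrow> 0) F"
    by (intro Lim_null_comparison[OF always_eventually
        tendsto_mult_left_zero[OF tendsto_mult_left_zero[OF u_tendsto]]] allI)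
  then show ?thesis by (rule LIM_zero_cancel)
qed

lemma L2_Fatou:
  assumes L2: "\<And>n. L2 (u n)" and l2_le: "\<And>n. l2 (u n) \<le> C"
    and u_tendsto: "AE x in lborel. (\<lambda>n. u n x) \<longlonglongrightarrow> g x" and g: "g \<in> borel_measurable borel"
  shows "L2 g" "l2 g \<le> C"
proof -
  note [measurable] = L2_measurable[OF L2] g
  have "(\<integral>\<^sup>+x. ennreal ((norm (g x))\<^sup>2) \<partial>lborel) = (\<integral>\<^sup>+x. liminf (\<lambda>n. ennreal ((norm (u n x))\<^sup>2)) \<partial>lborel)"
  proof (rule nn_integral_cong_AE, use u_tendsto in eventually_elim)
    fix x assume "(\<lambda>n. u n x) \<longlonglongrightarrow> g x"
    then have "(\<lambda>n. ennreal ((norm (u n x))\<^sup>2)) \<longlonglongrightarrow> ennreal ((norm (g x))\<^sup>2)"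
      by (intro tendsto_ennrealI tendsto_intros)
    then show "ennreal ((norm (g x))\<^sup>2) = liminf (\<lambda>n. ennreal ((norm (u n x))\<^sup>2))"
      by (metis lim_imp_Liminf trivial_limit_sequentially)
  qed
  also have "\<dots> \<le> liminf (\<lambda>n. \<integral>\<^sup>+x. ennreal ((norm (u n x))\<^sup>2) \<partial>lborel)"
    by (rule nn_integral_liminf) simp
  also have "\<dots> \<le> liminf (\<lambda>n. ennreal (C\<^sup>2))"
    using l2_le by (intro Liminf_mono always_eventually allI) (simp add: nn_integral_L2[OF L2] ennreal_leI power_mono)
  also have "\<dots> = ennreal (C\<^sup>2)" by (simp add: Liminf_const)
  finally have nn_le: "(\<integral>\<^sup>+x. ennreal ((norm (g x))\<^sup>2) \<partial>lborel) \<le> ennreal (C\<^sup>2)" .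
  have "0 \<le> C" using l2_le l2_nonneg order_trans by blast
  from L2_nn_integralI[OF g nn_le this] show "L2 g" "l2 g \<le> C" .
qed

lemma L2_summable_AE:
  fixes d :: "nat \<Rightarrow> 'a::euclidean_space \<Rightarrow> 'b::euclidean_space"
  assumes L2: "\<And>k. L2 (d k)" and l2_le: "\<And>k. l2 (d k) \<le> (1/2)^k"
  shows "AE x in lborel. summable (\<lambda>k. d k x)"
proof -
  note [measurable] = L2_measurable[OF L2]
  have "(\<integral>\<^sup>+x. (\<Sum>k. ennreal (2^k * (norm (d k x))\<^sup>2)) \<partial>lborel) = (\<Sum>k. ennreal (2^k * (l2 (d k))\<^sup>2))"
    by (subst nn_integral_suminf) (simp_all add: ennreal_mult' nn_integral_cmult nn_integral_L2[OF L2])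
  also have "\<dots> \<le> (\<Sum>k. ennreal ((1/2)^k))"
  proof (intro suminf_le ennreal_leI)
    fix k
    have "(l2 (d k))\<^sup>2 \<le> ((1/2)^k)\<^sup>2" using l2_le by (intro power_mono) auto
    then have "2^k * (l2 (d k))\<^sup>2 \<le> 2^k * ((1/2)^k)\<^sup>2" by simp
    then show "2^k * (l2 (d k))\<^sup>2 \<le> (1/2)^k" by (simp add: power2_eq_square power_divide)
  qed auto
  also have "\<dots> = ennreal (\<Sum>k. (1/2)^k)"
    by (rule suminf_ennreal2) auto
  also have "\<dots> < \<infinity>" by simp
  finally have "AE x in lborel. (\<Sum>k. ennreal (2^k * (norm (d k x))\<^sup>2)) \<noteq> \<infinity>"
    by (intro nn_integral_noteq_infinite) auto
  then show ?thesis
  proof eventually_elim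
    fix x assume "(\<Sum>k. ennreal (2^k * (norm (d k x))\<^sup>2)) \<noteq> \<infinity>"
    then have summable_squares: "summable (\<lambda>k. 2^k * (norm (d k x))\<^sup>2)"
      by (intro summable_suminf_not_top) auto
    have "norm (d k x) \<le> (1/2)^k + 2^k * (norm (d k x))\<^sup>2" for k
    proof -
      have "c \<le> 1 + c\<^sup>2" if "0 \<le> c" for c :: real
        using sum_squares_bound[of 1 c] that by simp
      from this[of "2^k * norm (d k x)"] have "2^k * norm (d k x) \<le> 2^k * ((1/2)^k + 2^k * (norm (d k x))\<^sup>2)"
        by (simp add: distrib_left power_divide power_mult_distrib power2_eq_square mult_ac)
      then show ?thesis by simp
    qed
    then show "summable (\<lambda>k. d k x)"
      by (intro summable_comparison_test[OF _ summable_add[OF summable_geometric summable_squares]]) auto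
  qed
qed

lemma L2_Cauchy_AE_convergent_subseq:
  fixes u :: "nat \<Rightarrow> 'a::euclidean_space \<Rightarrow> 'b::euclidean_space"
  assumes u: "\<And>n. L2 (u n)"
    and Cauchy: "\<And>e. e > 0 \<Longrightarrow> \<exists>N. \<forall>m\<ge>N. \<forall>n\<ge>N. l2 (\<lambda>x. u m x - u n x) < e"
  obtains g r where "g \<in> borel_measurable borel" "filterlim r at_top sequentially"
    "AE x in lborel. (\<lambda>k. u (r k) x) \<longlonglongrightarrow> g x"
proof -
  note [measurable] = L2_measurable[OF u]
  have "\<exists>N. \<forall>m\<ge>N. \<forall>n\<ge>N. l2 (\<lambda>x. u m x - u n x) < (1/2)^k" for k :: nat
    by (rule Cauchy) simp
  then obtain N where N: "\<And>k m n. m \<ge> N k \<Longrightarrow> n \<ge> N k \<Longrightarrow> l2 (\<lambda>x. u m x - u n x) < (1/2)^k"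
    by metis
  define r where "r k = (\<Sum>j\<le>k. N j) + k" for k
  have N_le_r: "N k \<le> r k" for k
    unfolding r_def by (meson finite_atMost le_add1 le_trans member_le_sum order_refl atMost_iff zero_le)
  have "N k \<le> r (Suc k)" for k using N_le_r[of k] by (simp add: r_def)
  from less_imp_le[OF N[OF this N_le_r]]
  have "l2 (\<lambda>x. u (r (Suc k)) x - u (r k) x) \<le> (1/2)^k" for k .
  then have "AE x in lborel. summable (\<lambda>k. u (r (Suc k)) x - u (r k) x)"
    by (intro L2_summable_AE L2_diff u)
  then have "AE x in lborel. (\<lambda>k. u (r k) x) \<longlonglongrightarrow> lim (\<lambda>k. u (r k) x)"
  proof eventually_elim
    fix x assume "summable (\<lambda>k. u (r (Suc k)) x - u (r k) x)"
    then have "convergent (\<lambda>k. u (r k) x - u (r 0) x)"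
      by (simp add: summable_iff_convergent sum_lessThan_telescope[of "\<lambda>k. u (r k) x"])
    then show "(\<lambda>k. u (r k) x) \<longlonglongrightarrow> lim (\<lambda>k. u (r k) x)"
      by (simp add: convergent_diff_const_right_iff convergent_LIMSEQ_iff)
  qed
  moreover have "(\<lambda>x. lim (\<lambda>k. u (r k) x)) \<in> borel_measurable borel" by measurable
  moreover have "filterlim r at_top sequentially"
    by (rule filterlim_at_top_mono[OF filterlim_ident]) (simp add: r_def)
  ultimately show thesis by (intro that)
qed

lemma L2_complete:
  fixes u :: "nat \<Rightarrow> 'a::euclidean_space \<Rightarrow> 'b::euclidean_space"
  assumes u: "\<And>n. L2 (u n)"
    and Cauchy: "\<And>e. e > 0 \<Longrightarrow> \<exists>N. \<forall>m\<ge>N. \<forall>n\<ge>N. l2 (\<lambda>x. u m x - u n x) < e"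
  obtains g where "L2 g" "(\<lambda>n. l2 (\<lambda>x. g x - u n x)) \<longlonglongrightarrow> 0"
proof -
  obtain g r where g: "g \<in> borel_measurable borel" and r: "filterlim r at_top sequentially"
    and u_tendsto: "AE x in lborel. (\<lambda>k. u (r k) x) \<longlonglongrightarrow> g x"
    using L2_Cauchy_AE_convergent_subseq[OF u Cauchy] .
  have limit_le: "L2 (\<lambda>x. g x - u n x) \<and> l2 (\<lambda>x. g x - u n x) \<le> e"
    if "\<forall>m\<ge>M. l2 (\<lambda>x. u m x - u n x) < e" for n M e
  proof -
    obtain k0 where k0: "\<And>k. k \<ge> k0 \<Longrightarrow> r k \<ge> M"
      using r unfolding filterlim_at_top eventually_sequentially by meson
    have "L2 (\<lambda>x. u (r (k + k0)) x - u n x)" "l2 (\<lambda>x. u (r (k + k0)) x - u n x) \<le> e" for k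
      using that k0[of "k + k0"] by (auto intro: L2_diff u less_imp_le)
    moreover have "AE x in lborel. (\<lambda>k. u (r (k + k0)) x - u n x) \<longlonglongrightarrow> g x - u n x"
      using u_tendsto by eventually_elim (intro tendsto_diff tendsto_const LIMSEQ_ignore_initial_segment)
    moreover have "(\<lambda>x. g x - u n x) \<in> borel_measurable borel"
      using g L2_measurable[OF u] by measurable
    ultimately show ?thesis using L2_Fatou[of "\<lambda>k x. u (r (k + k0)) x - u n x" e "\<lambda>x. g x - u n x"] by blast
  qed
  have eventually_le: "\<exists>N. \<forall>n\<ge>N. L2 (\<lambda>x. g x - u n x) \<and> l2 (\<lambda>x. g x - u n x) \<le> e" if "e > 0" for e
    using Cauchy[OF that] limit_le by meson
  obtain N where "L2 (\<lambda>x. g x - u N x)" using eventually_le[of 1] by auto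
  from L2_add[OF this u[of N]] have "L2 g" by simp
  moreover have "(\<lambda>n. l2 (\<lambda>x. g x - u n x)) \<longlonglongrightarrow> 0"
  proof (rule LIMSEQ_I)
    fix e :: real assume "e > 0"
    with eventually_le[of "e/2"] show "\<exists>N. \<forall>n\<ge>N. norm (l2 (\<lambda>x. g x - u n x) - 0) < e"
      by fastforce
  qed
  ultimately show thesis by (rule that)
qed

lemma L2_complete_at_top:
  fixes u :: "real \<Rightarrow> 'a::euclidean_space \<Rightarrow> 'b::euclidean_space"
  assumes u: "\<And>R. L2 (u R)" and rate: "(rate \<longlongrightarrow> 0) at_top"
    and u_diff: "\<And>R S. l2 (\<lambda>x. u R x - u S x) \<le> rate R + rate S"
  obtains g where "L2 g" "((\<lambda>R. l2 (\<lambda>x. g x - u R x)) \<longlongrightarrow> 0) at_top"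
proof -
  have rate_nat: "(\<lambda>n. rate (real n)) \<longlonglongrightarrow> 0"
    by (rule filterlim_compose[OF rate filterlim_real_sequentially])
  have Cauchy: "\<exists>N. \<forall>m\<ge>N. \<forall>n\<ge>N. l2 (\<lambda>x. u (real m) x - u (real n) x) < e" if "e > 0" for e
  proof -
    obtain N where N: "\<And>n. n \<ge> N \<Longrightarrow> \<bar>rate (real n)\<bar> < e / 2"
      using LIMSEQ_D[OF rate_nat, of "e / 2"] \<open>e > 0\<close> by auto
    have "l2 (\<lambda>x. u (real m) x - u (real n) x) < e" if "m \<ge> N" "n \<ge> N" for m n
      using u_diff[of "real m" "real n"] N[OF that(1)] N[OF that(2)] by linarith
    then show ?thesis by blast
  qed
  obtain g where g: "L2 g" "(\<lambda>n. l2 (\<lambda>x. g x - u (real n) x)) \<longlonglongrightarrow> 0"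
    using L2_complete[OF u Cauchy] by blast
  have g_diff: "l2 (\<lambda>x. g x - u R x) \<le> rate R" for R
  proof (rule LIMSEQ_le_const)
    show "(\<lambda>n. l2 (\<lambda>x. g x - u (real n) x) + (rate (real n) + rate R)) \<longlonglongrightarrow> rate R"
      using tendsto_add[OF g(2) tendsto_add[OF rate_nat tendsto_const]] by simp
    have "l2 (\<lambda>x. g x - u R x) \<le> l2 (\<lambda>x. g x - u (real n) x) + (rate (real n) + rate R)" for n
      using l2_triangle_diff[OF g(1) u u, of R "real n"] u_diff[of "real n" R] by linarith
    then show "\<exists>N. \<forall>n\<ge>N. l2 (\<lambda>x. g x - u R x) \<le> l2 (\<lambda>x. g x - u (real n) x) + (rate (real n) + rate R)"
      by blast
  qed
  have "((\<lambda>R. l2 (\<lambda>x. g x - u R x)) \<longlongrightarrow> 0) at_top"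
    by (rule Lim_null_comparison[OF always_eventually rate]) (simp add: g_diff)
  with g(1) show thesis by (rule that)
qed

definition trunc :: "real \<Rightarrow> ('a::real_normed_vector \<Rightarrow> 'b::real_vector) \<Rightarrow> 'a \<Rightarrow> 'b" where
  "trunc R f x = indicator (cball 0 R) x *\<^sub>R f x"

lemma trunc_inside: "norm x \<le> R \<Longrightarrow> trunc R f x = f x"
  and trunc_outside: "R < norm x \<Longrightarrow> trunc R f x = 0"
  by (simp_all add: trunc_def)

lemma integrable_indicator_cball: "integrable lborel (indicator (cball 0 R) :: 'a::euclidean_space \<Rightarrow> real)"
  using emeasure_lborel_cball_finite[of 0 R] by (intro integrable_real_indicator) auto

lemma L2_bounded_support_integrable:
  fixes f :: "'a::euclidean_space \<Rightarrow> 'b::euclidean_space"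
  assumes "L2 f" "\<And>x. R < norm x \<Longrightarrow> f x = 0"
  shows "integrable lborel f"
proof -
  have "(\<lambda>x::'a. (norm (indicator (cball 0 R) x :: real))\<^sup>2) = indicator (cball 0 R)" by (auto simp: indicator_def)
  then have "L2 (indicator (cball 0 R) :: 'a \<Rightarrow> real)"
    using integrable_indicator_cball[of R, where 'a='a] by (auto simp: L2_def)
  from L2_bilinear(1)[OF bounded_bilinear_scaleR, of 1, OF _ this assms(1)]
  have "integrable lborel (\<lambda>x. indicator (cball 0 R) x *\<^sub>R f x)" by simp
  also have "(\<lambda>x. indicator (cball 0 R) x *\<^sub>R f x) = f"
    using assms(2) by (force simp: indicator_def)
  finally show ?thesis .
qed

lemma trunc_measurable [measurable]:
  fixes f :: "'a::euclidean_space \<Rightarrow> 'b::euclidean_space"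
  assumes "f \<in> borel_measurable borel" shows "trunc R f \<in> borel_measurable borel"
  unfolding trunc_def[abs_def] by (intro borel_measurable_scaleR borel_measurable_indicator assms) simp

lemma L2_trunc: "L2 f \<Longrightarrow> L2 (trunc R f)"
  by (rule L2_dominated(1)[where g=f and c=1]) (auto simp: trunc_def indicator_def)

lemma trunc_integrable: "L2 f \<Longrightarrow> integrable lborel (trunc R f)"
  by (rule L2_bounded_support_integrable[OF L2_trunc, where R=R]) (simp_all add: trunc_outside)

lemma l2_trunc_tendsto:
  fixes f :: "'a::euclidean_space \<Rightarrow> 'b::euclidean_space"
  assumes "L2 f" shows "((\<lambda>R. l2 (\<lambda>x. f x - trunc R f x)) \<longlongrightarrow> 0) at_top"
proof -
  note [measurable] = L2_measurable[OF assms]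
  have "((\<lambda>R. \<integral>x. (norm (f x - trunc R f x))\<^sup>2 \<partial>lborel) \<longlongrightarrow> (\<integral>x. 0 \<partial>(lborel::'a measure))) at_top"
  proof (rule integral_dominated_convergence_at_top[where w="\<lambda>x. (norm (f x))\<^sup>2"])
    have "\<forall>\<^sub>F R in at_top. (norm (f x - trunc R f x))\<^sup>2 = 0" for x
      using eventually_ge_at_top[of "norm x"] by eventually_elim (simp add: trunc_inside)
    then show "AE x in lborel. ((\<lambda>R. (norm (f x - trunc R f x))\<^sup>2) \<longlongrightarrow> 0) at_top"
      by (intro AE_I2 tendsto_eventually)
    show "\<forall>\<^sub>F R in at_top. AE x in lborel. norm ((norm (f x - trunc R f x))\<^sup>2) \<le> (norm (f x))\<^sup>2"
      by (intro always_eventually allI AE_I2) (simp add: trunc_def indicator_def)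
  qed (use L2_integrable[OF assms] in auto)
  then have "((\<lambda>R. sqrt (\<integral>x. (norm (f x - trunc R f x))\<^sup>2 \<partial>lborel)) \<longlongrightarrow> sqrt 0) at_top"
    by (intro tendsto_real_sqrt) simp
  then show ?thesis by (simp add: l2_def)
qed

lemma AE_eq_0_if_trunc_AE_eq_0:
  fixes f :: "'a::euclidean_space \<Rightarrow> 'b::real_vector"
  assumes "\<And>n. AE x in lborel. trunc (real n) f x = 0" shows "AE x in lborel. f x = 0"
proof -
  have "AE x in lborel. \<forall>n. trunc (real n) f x = 0"
    unfolding AE_all_countable using assms by blast
  then show ?thesis
  proof eventually_elim
    fix x assume "\<forall>n. trunc (real n) f x = 0"
    moreover obtain n where "norm x \<le> real n" using real_arch_simple by blast
    ultimately show "f x = 0" by (metis trunc_inside)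
  qed
qed

section \<open>Gaussian means\<close>

lemma lborel_affine_euclid:
  fixes f :: "'a::euclidean_space \<Rightarrow> 'b::{banach, second_countable_topology}"
  assumes "c \<noteq> 0" "f \<in> borel_measurable borel"
  shows "integrable lborel (\<lambda>x. f (t + c *\<^sub>R x)) \<longleftrightarrow> integrable lborel f"
    and "(\<integral>x. f x \<partial>lborel) = \<bar>c\<bar> ^ DIM('a) *\<^sub>R (\<integral>x. f (t + c *\<^sub>R x) \<partial>lborel)"
proof -
  note [measurable] = assms(2)
  have "integrable lborel f \<longleftrightarrow> integrable lborel (\<lambda>x. \<bar>c\<bar> ^ DIM('a) *\<^sub>R f (t + c *\<^sub>R x))"
    by (subst lborel_affine[OF assms(1), of t], subst integrable_density) (simp_all add: integrable_distr_eq)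
  also have "\<dots> \<longleftrightarrow> integrable lborel (\<lambda>x. f (t + c *\<^sub>R x))"
    using assms(1) integrable_scaleR_right[where c="inverse (\<bar>c\<bar> ^ DIM('a))" and M=lborel
        and f="\<lambda>x. \<bar>c\<bar> ^ DIM('a) *\<^sub>R f (t + c *\<^sub>R x)"]
    by auto
  finally show "integrable lborel (\<lambda>x. f (t + c *\<^sub>R x)) \<longleftrightarrow> integrable lborel f" by simp
  show "(\<integral>x. f x \<partial>lborel) = \<bar>c\<bar> ^ DIM('a) *\<^sub>R (\<integral>x. f (t + c *\<^sub>R x) \<partial>lborel)"
    by (subst lborel_affine[OF assms(1), of t], subst integral_density) (auto simp: integral_distr)
qed

lemma lborel_reflect:
  fixes f :: "'a::euclidean_space \<Rightarrow> 'b::{banach, second_countable_topology}"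
  assumes "f \<in> borel_measurable borel"
  shows "integrable lborel (\<lambda>y. f (x - y)) \<longleftrightarrow> integrable lborel f"
    and "(\<integral>y. f (x - y) \<partial>lborel) = (\<integral>y. f y \<partial>lborel)"
  using lborel_affine_euclid[of "-1" f x] assms by simp_all

lemma lborel_translate:
  fixes f :: "'a::euclidean_space \<Rightarrow> 'b::{banach, second_countable_topology}"
  assumes "f \<in> borel_measurable borel"
  shows "integrable lborel (\<lambda>y. f (y - x)) \<longleftrightarrow> integrable lborel f"
    and "(\<integral>y. f (y - x) \<partial>lborel) = (\<integral>y. f y \<partial>lborel)"
  using lborel_affine_euclid[of 1 f "- x"] assms by simp_all

lemma lborel_prod_Basis:
  fixes f :: "'a::euclidean_space \<Rightarrow> real \<Rightarrow> 'b::{real_normed_field, banach, second_countable_topology}"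
  assumes "\<And>b. b \<in> Basis \<Longrightarrow> integrable lborel (f b)"
  shows "integrable lborel (\<lambda>x. \<Prod>b\<in>Basis. f b (x \<bullet> b))"
    and "(\<integral>x. (\<Prod>b\<in>Basis. f b (x \<bullet> b)) \<partial>lborel) = (\<Prod>b\<in>Basis. \<integral>x. f b x \<partial>lborel)"
proof -
  interpret product_sigma_finite "\<lambda>_::'a. lborel :: real measure" by standard
  have [measurable]: "f b \<in> borel_measurable borel" if "b \<in> Basis" for b
    using borel_measurable_integrable[OF assms[OF that]] by simp
  have coordinates: "(\<Prod>b\<in>Basis. f b ((\<Sum>b\<in>Basis. x b *\<^sub>R b) \<bullet> b)) = (\<Prod>b\<in>Basis. f b (x b))" for x :: "'a \<Rightarrow> real"
    by (rule prod.cong) (auto simp: inner_sum_left_Basis)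
  have measurable_prod: "(\<lambda>x. \<Prod>b\<in>Basis. f b (x \<bullet> b)) \<in> borel_measurable borel" by measurable
  show "integrable lborel (\<lambda>x. \<Prod>b\<in>Basis. f b (x \<bullet> b))"
    by (subst lborel_eq, subst integrable_distr_eq[OF _ measurable_prod])
       (auto simp: coordinates intro!: product_integrable_prod assms)
  show "(\<integral>x. (\<Prod>b\<in>Basis. f b (x \<bullet> b)) \<partial>lborel) = (\<Prod>b\<in>Basis. \<integral>x. f b x \<partial>lborel)"
    by (subst lborel_eq, subst integral_distr[OF _ measurable_prod])
       (auto simp: coordinates intro!: product_integral_prod assms)
qed

definition gauss :: "'a::euclidean_space \<Rightarrow> real" where
  "gauss x = exp (- (norm x)\<^sup>2 / 2)"

lemma gauss_measurable [measurable]: "gauss \<in> borel_measurable borel"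
  unfolding gauss_def by measurable

lemma gauss_nonneg [simp]: "0 \<le> gauss x" and gauss_le_1: "gauss x \<le> 1"
  and gauss_minus [simp]: "gauss (- x) = gauss x" and gauss_0 [simp]: "gauss 0 = 1"
  by (simp_all add: gauss_def)

lemma gauss_prod: "gauss x = (\<Prod>b\<in>Basis. exp (- (x \<bullet> b)\<^sup>2 / 2))"
  unfolding gauss_def power2_norm_eq_inner
  by (subst euclidean_inner) (simp add: exp_sum[symmetric] sum_negf sum_divide_distrib power2_eq_square)

lemma gauss_scaled_power2: "(gauss (d *\<^sub>R x))\<^sup>2 = gauss ((sqrt 2 * d) *\<^sub>R x)"
  by (simp add: gauss_def power_mult_distrib flip: exp_double)

lemma gauss_scaled_tendsto:
  fixes x :: "'a::euclidean_space"
  shows "(\<lambda>n. gauss ((1 / real (Suc n)) *\<^sub>R x)) \<longlonglongrightarrow> 1"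
proof -
  have "(\<lambda>n. exp (- (norm ((1 / real (Suc n)) *\<^sub>R x))\<^sup>2 / 2)) \<longlonglongrightarrow> exp (- (norm (0 *\<^sub>R x))\<^sup>2 / 2)"
    using LIMSEQ_Suc[OF lim_inverse_n'] by (intro tendsto_intros) auto
  then show ?thesis by (simp add: gauss_def)
qed

lemma cis_measurable [measurable]: "cis \<in> borel_measurable borel"
  by (intro borel_measurable_continuous_onI continuous_intros)

lemma real_gauss_characteristic:
  fixes t :: real
  shows "integrable lborel (\<lambda>x. cis (x * t) * complex_of_real (exp (- x\<^sup>2 / 2)))"
    and "(\<integral>x. cis (x * t) * complex_of_real (exp (- x\<^sup>2 / 2)) \<partial>lborel) = sqrt (2 * pi) * exp (- t\<^sup>2 / 2)"
proof -
  have density: "cis (x * t) * complex_of_real (exp (- x\<^sup>2 / 2))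
      = sqrt (2 * pi) * (std_normal_density x *\<^sub>R iexp (t * x))" for x
    by (simp add: std_normal_density_def cis_conv_exp scaleR_conv_of_real mult_ac)
  show "integrable lborel (\<lambda>x. cis (x * t) * complex_of_real (exp (- x\<^sup>2 / 2)))"
    unfolding density
    by (intro integrable_mult_right Bochner_Integration.integrable_bound[OF
        integrable_normal_density[where \<mu>=0 and \<sigma>=1]])
       (auto simp: normal_density_nonneg)
  have "(\<integral>x. cis (x * t) * complex_of_real (exp (- x\<^sup>2 / 2)) \<partial>lborel) = sqrt (2 * pi) * char std_normal_distribution t"
    unfolding density char_def by (subst integral_mult_right_zero, subst integral_density)
       (auto simp: normal_density_nonneg)
  then show "(\<integral>x. cis (x * t) * complex_of_real (exp (- x\<^sup>2 / 2)) \<partial>lborel) = sqrt (2 * pi) * exp (- t\<^sup>2 / 2)"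
    by (simp add: char_std_normal_distribution)
qed

lemma gauss_characteristic:
  fixes \<xi> :: "'a::euclidean_space"
  shows "integrable lborel (\<lambda>x. cis (x \<bullet> \<xi>) * complex_of_real (gauss x))"
    and "(\<integral>x. cis (x \<bullet> \<xi>) * complex_of_real (gauss x) \<partial>lborel) = sqrt (2 * pi) ^ DIM('a) * gauss \<xi>"
proof -
  have "cis (x \<bullet> \<xi>) = (\<Prod>b\<in>Basis. cis ((x \<bullet> b) * (\<xi> \<bullet> b)))" for x
    by (subst euclidean_inner) (simp add: cis_conv_exp sum_distrib_left exp_sum)
  then have product: "cis (x \<bullet> \<xi>) * complex_of_real (gauss x)
      = (\<Prod>b\<in>Basis. cis ((x \<bullet> b) * (\<xi> \<bullet> b)) * complex_of_real (exp (- (x \<bullet> b)\<^sup>2 / 2)))" for x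
    by (simp add: gauss_prod prod.distrib)
  note factors = lborel_prod_Basis[of "\<lambda>b x. cis (x * (\<xi> \<bullet> b)) * complex_of_real (exp (- x\<^sup>2 / 2))",
      OF real_gauss_characteristic(1)]
  show "integrable lborel (\<lambda>x. cis (x \<bullet> \<xi>) * complex_of_real (gauss x))"
    unfolding product by (rule factors(1))
  show "(\<integral>x. cis (x \<bullet> \<xi>) * complex_of_real (gauss x) \<partial>lborel) = sqrt (2 * pi) ^ DIM('a) * gauss \<xi>"
    unfolding product factors(2) real_gauss_characteristic(2) by (simp add: gauss_prod prod.distrib)
qed

lemma gauss_integral:
  "integrable lborel (gauss :: 'a::euclidean_space \<Rightarrow> real)"
  "(\<integral>x. gauss (x::'a) \<partial>lborel) = sqrt (2 * pi) ^ DIM('a)"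
proof -
  show "integrable lborel (gauss :: 'a \<Rightarrow> real)"
    using gauss_characteristic(1)[of "0::'a"] by (simp add: complex_of_real_integrable_eq)
  have "complex_of_real (\<integral>x. gauss (x::'a) \<partial>lborel) = complex_of_real (sqrt (2 * pi) ^ DIM('a))"
    using gauss_characteristic(2)[of "0::'a"] by (simp add: integral_complex_of_real)
  then show "(\<integral>x. gauss (x::'a) \<partial>lborel) = sqrt (2 * pi) ^ DIM('a)"
    by (simp only: of_real_eq_iff)
qed

lemma gauss_scaled_integrable:
  assumes "d \<noteq> 0" shows "integrable lborel (\<lambda>x::'a::euclidean_space. gauss (d *\<^sub>R x))"
  using lborel_affine_euclid(1)[of d "gauss::'a\<Rightarrow>real" 0] gauss_integral(1) assms by simp

lemma L2_gauss_scaled: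
  assumes "d \<noteq> 0" shows "L2 (\<lambda>x::'a::euclidean_space. gauss (d *\<^sub>R x))"
  using gauss_scaled_integrable[of "sqrt 2 * d", where 'a='a] assms
  by (simp add: L2_def gauss_scaled_power2)

definition gauss_kernel :: "real \<Rightarrow> 'a::euclidean_space \<Rightarrow> real" where
  "gauss_kernel d z = (1 / (sqrt (2 * pi) * d)) ^ DIM('a) * gauss (z /\<^sub>R d)"

lemma gauss_kernel_measurable [measurable]: "gauss_kernel d \<in> borel_measurable borel"
  unfolding gauss_kernel_def by measurable

lemma gauss_kernel_nonneg: "d > 0 \<Longrightarrow> 0 \<le> gauss_kernel d z"
  by (simp add: gauss_kernel_def)

lemma gauss_kernel_minus [simp]: "gauss_kernel d (- z) = gauss_kernel d z"
  by (simp add: gauss_kernel_def)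

lemma gauss_kernel_minus_commute: "gauss_kernel d (x - y) = gauss_kernel d (y - x)"
  using gauss_kernel_minus[of d "x - y"] by simp

lemma gauss_kernel_integral:
  assumes "d > 0"
  shows "integrable lborel (gauss_kernel d :: 'a::euclidean_space \<Rightarrow> real)" "(\<integral>z. gauss_kernel d (z::'a) \<partial>lborel) = 1"
proof -
  show "integrable lborel (gauss_kernel d :: 'a \<Rightarrow> real)"
    unfolding gauss_kernel_def using gauss_scaled_integrable[of "inverse d"] assms by simp
  have "(\<integral>z. gauss_kernel d (z::'a) \<partial>lborel) = d ^ DIM('a) * (\<integral>z. gauss_kernel d (0 + d *\<^sub>R (z::'a)) \<partial>lborel)"
    using assms by (subst lborel_affine_euclid(2)[of d _ 0]) auto
  also have "\<dots> = 1"
    using assms by (simp add: gauss_kernel_def gauss_integral power_divide power_mult_distrib)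
  finally show "(\<integral>z. gauss_kernel d (z::'a) \<partial>lborel) = 1" .
qed

lemma gauss_scaled_characteristic:
  fixes \<xi> :: "'a::euclidean_space"
  assumes "d > 0"
  shows "(\<integral>x. cis (x \<bullet> \<xi>) * complex_of_real (gauss (d *\<^sub>R x)) \<partial>lborel) = (2 * pi) ^ DIM('a) * gauss_kernel d \<xi>"
proof -
  have "(\<integral>x. cis (x \<bullet> \<xi>) * complex_of_real (gauss (d *\<^sub>R x)) \<partial>lborel)
      = (1/d) ^ DIM('a) *\<^sub>R (\<integral>x. cis ((0 + (1/d) *\<^sub>R x) \<bullet> \<xi>) * complex_of_real (gauss (d *\<^sub>R (0 + (1/d) *\<^sub>R x))) \<partial>lborel)"
    using assms by (subst lborel_affine_euclid(2)[of "1/d" _ 0]) auto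
  also have "\<dots> = (1/d) ^ DIM('a) *\<^sub>R (\<integral>x. cis (x \<bullet> (\<xi> /\<^sub>R d)) * complex_of_real (gauss x) \<partial>lborel)"
    using assms by (simp add: divide_inverse)
  also have "\<dots> = complex_of_real ((sqrt (2 * pi) / d) ^ DIM('a) * gauss (\<xi> /\<^sub>R d))"
    unfolding gauss_characteristic(2) by (simp add: power_divide scaleR_conv_of_real)
  also have "(sqrt (2 * pi) / d) ^ DIM('a) = (2 * pi) ^ DIM('a) * (1 / (sqrt (2 * pi) * d)) ^ DIM('a)"
  proof -
    have "sqrt (2 * pi) / d = (2 * pi) * (1 / (sqrt (2 * pi) * d))"
      by (simp add: real_div_sqrt flip: divide_divide_eq_left)
    then show ?thesis by (simp only: power_mult_distrib)
  qed
  finally show ?thesis by (simp add: gauss_kernel_def)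
qed

lemma norm_integral_le_nn_integral:
  fixes f :: "'a \<Rightarrow> 'b::{banach, second_countable_topology}"
  shows "ennreal (norm (integral\<^sup>L M f)) \<le> (\<integral>\<^sup>+x. ennreal (norm (f x)) \<partial>M)"
  by (cases "integrable M f") (auto intro: integral_norm_bound_ennreal simp: not_integrable_integral_eq)

lemma norm_weighted_integral_power2_le:
  fixes k :: "'a \<Rightarrow> real" and h :: "'a \<Rightarrow> 'b::{banach, second_countable_topology}"
  assumes [measurable]: "k \<in> borel_measurable M" "h \<in> borel_measurable M" and nonneg: "\<And>y. 0 \<le> k y"
  shows "ennreal ((norm (\<integral>y. k y *\<^sub>R h y \<partial>M))\<^sup>2)
    \<le> (\<integral>\<^sup>+y. ennreal (k y) \<partial>M) * (\<integral>\<^sup>+y. ennreal (k y) * ennreal ((norm (h y))\<^sup>2) \<partial>M)"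
proof -
  have "ennreal (norm (\<integral>y. k y *\<^sub>R h y \<partial>M))
      \<le> (\<integral>\<^sup>+y. ennreal (sqrt (k y)) * ennreal (sqrt (k y) * norm (h y)) \<partial>M)"
    using norm_integral_le_nn_integral[of M "\<lambda>y. k y *\<^sub>R h y"]
    by (simp add: nonneg mult.assoc[symmetric] flip: ennreal_mult')
  then have "(ennreal (norm (\<integral>y. k y *\<^sub>R h y \<partial>M)))\<^sup>2
      \<le> (\<integral>\<^sup>+y. ennreal (sqrt (k y)) * ennreal (sqrt (k y) * norm (h y)) \<partial>M)\<^sup>2"
    by (rule power_mono) simp
  also have "\<dots> \<le> (\<integral>\<^sup>+y. (ennreal (sqrt (k y)))\<^sup>2 \<partial>M) * (\<integral>\<^sup>+y. (ennreal (sqrt (k y) * norm (h y)))\<^sup>2 \<partial>M)"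
    by (rule Cauchy_Schwarz_nn_integral) auto
  also have "\<dots> = (\<integral>\<^sup>+y. ennreal (k y) \<partial>M) * (\<integral>\<^sup>+y. ennreal (k y) * ennreal ((norm (h y))\<^sup>2) \<partial>M)"
    by (simp add: ennreal_power power_mult_distrib nonneg ennreal_mult')
  finally show ?thesis by (simp add: ennreal_power)
qed

lemma L2_convolution:
  fixes k :: "'a::euclidean_space \<Rightarrow> real" and h :: "'a \<Rightarrow> 'b::euclidean_space"
  assumes k: "integrable lborel k" "\<And>z. 0 \<le> k z" and h: "L2 h"
  shows "L2 (\<lambda>x. \<integral>y. k (x - y) *\<^sub>R h y \<partial>lborel)"
    and "l2 (\<lambda>x. \<integral>y. k (x - y) *\<^sub>R h y \<partial>lborel) \<le> (\<integral>z. k z \<partial>lborel) * l2 h"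
proof -
  note [measurable] = borel_measurable_integrable[OF k(1)] L2_measurable[OF h]
  define m where "m = (\<integral>z. k z \<partial>lborel)"
  have m_nonneg: "0 \<le> m" unfolding m_def by (simp add: k(2))
  have [measurable]: "k \<in> borel_measurable borel" by simp
  have mass: "(\<integral>\<^sup>+y. ennreal (k (x - y)) \<partial>lborel) = ennreal m" "(\<integral>\<^sup>+x. ennreal (k (x - y)) \<partial>lborel) = ennreal m" for x y
    using k lborel_reflect[of k x] lborel_translate[of k y] by (simp_all add: nn_integral_eq_integral m_def)
  have pointwise: "ennreal ((norm (\<integral>y. k (x - y) *\<^sub>R h y \<partial>lborel))\<^sup>2)
      \<le> ennreal m * (\<integral>\<^sup>+y. ennreal (k (x - y)) * ennreal ((norm (h y))\<^sup>2) \<partial>lborel)" for x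
    using norm_weighted_integral_power2_le[of "\<lambda>y. k (x - y)" lborel h] k(2) by (simp add: mass(1))
  have "(\<integral>\<^sup>+x. ennreal ((norm (\<integral>y. k (x - y) *\<^sub>R h y \<partial>lborel))\<^sup>2) \<partial>lborel)
      \<le> (\<integral>\<^sup>+x. ennreal m * (\<integral>\<^sup>+y. ennreal (k (x - y)) * ennreal ((norm (h y))\<^sup>2) \<partial>lborel) \<partial>lborel)"
    by (intro nn_integral_mono pointwise)
  also have "\<dots> = ennreal m * (\<integral>\<^sup>+y. \<integral>\<^sup>+x. ennreal (k (x - y)) * ennreal ((norm (h y))\<^sup>2) \<partial>lborel \<partial>lborel)"
    by (subst nn_integral_cmult, measurable, subst lborel_pair.Fubini') auto
  also have "\<dots> = ennreal m * (ennreal m * ennreal ((l2 h)\<^sup>2))"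
    by (simp add: nn_integral_multc mass(2) nn_integral_cmult nn_integral_L2[OF h])
  also have "\<dots> = ennreal ((m * l2 h)\<^sup>2)"
    using m_nonneg by (simp add: power_mult_distrib ennreal_mult' power2_eq_square mult_ac)
  finally have nn_le: "(\<integral>\<^sup>+x. ennreal ((norm (\<integral>y. k (x - y) *\<^sub>R h y \<partial>lborel))\<^sup>2) \<partial>lborel) \<le> ennreal ((m * l2 h)\<^sup>2)" .
  show "L2 (\<lambda>x. \<integral>y. k (x - y) *\<^sub>R h y \<partial>lborel)" "l2 (\<lambda>x. \<integral>y. k (x - y) *\<^sub>R h y \<partial>lborel) \<le> (\<integral>z. k z \<partial>lborel) * l2 h"
    using L2_nn_integralI[OF _ nn_le] m_nonneg by (simp_all add: m_def)
qed

definition gauss_mean :: "real \<Rightarrow> ('a::euclidean_space \<Rightarrow> 'b::euclidean_space) \<Rightarrow> 'a \<Rightarrow> 'b" where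
  "gauss_mean d f x = (\<integral>y. gauss_kernel d (x - y) *\<^sub>R f y \<partial>lborel)"

lemma gauss_mean_measurable [measurable]:
  assumes [measurable]: "f \<in> borel_measurable borel" shows "gauss_mean d f \<in> borel_measurable borel"
  unfolding gauss_mean_def[abs_def] by measurable

lemma L2_gauss_mean:
  assumes "d > 0" "L2 f" shows "L2 (gauss_mean d f)" "l2 (gauss_mean d f) \<le> l2 f"
  using L2_convolution[OF gauss_kernel_integral(1) gauss_kernel_nonneg] assms
  by (simp_all add: gauss_mean_def[abs_def] gauss_kernel_integral(2))

lemma gauss_mean_bounded:
  fixes f :: "'a::euclidean_space \<Rightarrow> 'b::euclidean_space"
  assumes d: "d > 0" and f: "f \<in> borel_measurable borel" "\<And>x. norm (f x) \<le> B"
  shows "integrable lborel (\<lambda>y. gauss_kernel d (x - y) *\<^sub>R f y)" "norm (gauss_mean d f x) \<le> B"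
proof -
  note [measurable] = f(1)
  have mass: "integrable lborel (\<lambda>y. gauss_kernel d (x - y))" "(\<integral>y. gauss_kernel d (x - y) \<partial>lborel) = 1"
    using lborel_reflect[of "gauss_kernel d" x] gauss_kernel_integral[OF d, where 'a='a] by simp_all
  have dominated: "norm (gauss_kernel d (x - y) *\<^sub>R f y) \<le> gauss_kernel d (x - y) * B" for y
    using f(2) gauss_kernel_nonneg[OF d, of "x - y"] by (simp add: mult_left_mono)
  show integrable: "integrable lborel (\<lambda>y. gauss_kernel d (x - y) *\<^sub>R f y)"
  proof (rule Bochner_Integration.integrable_bound[OF integrable_mult_left[OF mass(1), of B]])
    show "AE y in lborel. norm (gauss_kernel d (x - y) *\<^sub>R f y) \<le> norm (gauss_kernel d (x - y) * B)"
      by (intro AE_I2 order_trans[OF dominated]) simp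
  qed measurable
  have "norm (gauss_mean d f x) \<le> (\<integral>y. gauss_kernel d (x - y) * B \<partial>lborel)"
    unfolding gauss_mean_def
    by (rule order_trans[OF integral_norm_bound
          integral_mono[OF integrable_norm[OF integrable] integrable_mult_left[OF mass(1)] dominated]])
  then show "norm (gauss_mean d f x) \<le> B" by (simp add: mass(2))
qed

lemma gauss_mean_rescale:
  fixes f :: "'a::euclidean_space \<Rightarrow> 'b::euclidean_space"
  assumes "d > 0" "f \<in> borel_measurable borel"
  shows "gauss_mean d f x = (1 / sqrt (2 * pi) ^ DIM('a)) *\<^sub>R (\<integral>u. gauss u *\<^sub>R f (x + d *\<^sub>R u) \<partial>lborel)"
proof -
  note [measurable] = assms(2)
  have "gauss_mean d f x = d ^ DIM('a) *\<^sub>R (\<integral>u. gauss_kernel d (x - (x + d *\<^sub>R u)) *\<^sub>R f (x + d *\<^sub>R u) \<partial>lborel)"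
    unfolding gauss_mean_def using assms(1) by (subst lborel_affine_euclid(2)[of d _ x]) auto
  also have "(\<integral>u. gauss_kernel d (x - (x + d *\<^sub>R u)) *\<^sub>R f (x + d *\<^sub>R u) \<partial>lborel)
      = (1 / (sqrt (2 * pi) * d)) ^ DIM('a) *\<^sub>R (\<integral>u. gauss u *\<^sub>R f (x + d *\<^sub>R u) \<partial>lborel)"
    using assms(1) by (simp add: gauss_kernel_def flip: integral_scaleR_right)
  finally show ?thesis using assms(1) by (simp add: power_divide power_mult_distrib)
qed

lemma gauss_mean_tendsto_bounded:
  fixes f :: "'a::euclidean_space \<Rightarrow> 'b::euclidean_space"
  assumes f: "f \<in> borel_measurable borel" "\<And>x. norm (f x) \<le> B" "isCont f y"
  shows "(\<lambda>n. gauss_mean (1 / real (Suc n)) f y) \<longlonglongrightarrow> f y"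
proof -
  note [measurable] = f(1)
  have "(\<lambda>n. \<integral>u. gauss u *\<^sub>R f (y + (1 / real (Suc n)) *\<^sub>R u) \<partial>lborel) \<longlonglongrightarrow> (\<integral>u. gauss (u::'a) *\<^sub>R f y \<partial>lborel)"
  proof (rule integral_dominated_convergence)
    show "integrable lborel (\<lambda>u::'a. gauss u * B)" by (intro integrable_mult_left gauss_integral)
    show "AE u::'a in lborel. norm (gauss u *\<^sub>R f (y + (1 / real (Suc n)) *\<^sub>R u)) \<le> gauss u * B" for n
      using f(2) by (auto intro!: mult_left_mono)
    show "AE u in lborel. (\<lambda>n. gauss u *\<^sub>R f (y + (1 / real (Suc n)) *\<^sub>R u)) \<longlonglongrightarrow> gauss u *\<^sub>R f y"
    proof (rule AE_I2)
      fix u :: 'a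
      have "(\<lambda>n. y + (1 / real (Suc n)) *\<^sub>R u) \<longlonglongrightarrow> y + 0 *\<^sub>R u"
        using LIMSEQ_Suc[OF lim_inverse_n'] by (intro tendsto_intros) auto
      then show "(\<lambda>n. gauss u *\<^sub>R f (y + (1 / real (Suc n)) *\<^sub>R u)) \<longlonglongrightarrow> gauss u *\<^sub>R f y"
        by (intro tendsto_scaleR tendsto_const isCont_tendsto_compose[OF f(3)]) simp
    qed
  qed auto
  from tendsto_scaleR[OF tendsto_const this, of "1 / sqrt (2 * pi) ^ DIM('a)"]
  show ?thesis by (subst gauss_mean_rescale[OF _ f(1)]) (simp_all add: gauss_integral)
qed

lemma gauss_kernel_far_le:
  fixes z :: "'a::euclidean_space"
  assumes "r > 0" "r \<le> norm z"
  shows "gauss_kernel (1 / real (Suc n)) z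
    \<le> (1 / sqrt (2 * pi) * real (Suc n)) ^ DIM('a) * exp (- (r\<^sup>2 / 4) * real (Suc n)) * gauss ((1/2) *\<^sub>R z)"
proof -
  define N where "N = real (Suc n)"
  have N_ge_1: "1 \<le> N" by (simp add: N_def)
  have "r\<^sup>2 \<le> (norm z)\<^sup>2" using assms by (intro power_mono) auto
  then have "r\<^sup>2 * N \<le> (norm z)\<^sup>2 * N\<^sup>2" using N_ge_1 by (intro mult_mono) (auto simp: power2_eq_square)
  moreover have "(norm z)\<^sup>2 * 1 \<le> (norm z)\<^sup>2 * N\<^sup>2" using N_ge_1 by (intro mult_mono) (auto intro: one_le_power)
  moreover have "(norm (N *\<^sub>R z))\<^sup>2 = (norm z)\<^sup>2 * N\<^sup>2" "(norm ((1/2) *\<^sub>R z))\<^sup>2 = (norm z)\<^sup>2 / 4"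
    by (simp_all add: power_mult_distrib power_divide)
  ultimately have "- (norm (N *\<^sub>R z))\<^sup>2 / 2 \<le> - (r\<^sup>2 / 4) * N + - (norm ((1/2) *\<^sub>R z))\<^sup>2 / 2"
    using zero_le_power2[of "norm z"] by linarith
  then have "gauss (N *\<^sub>R z) \<le> exp (- (r\<^sup>2 / 4) * N) * gauss ((1/2) *\<^sub>R z)"
    unfolding gauss_def mult_exp_exp by (subst exp_le_cancel_iff)
  then have "(1 / sqrt (2 * pi) * N) ^ DIM('a) * gauss (N *\<^sub>R z)
      \<le> (1 / sqrt (2 * pi) * N) ^ DIM('a) * (exp (- (r\<^sup>2 / 4) * N) * gauss ((1/2) *\<^sub>R z))"
    using N_ge_1 by (intro mult_left_mono) auto
  then show ?thesis by (simp add: gauss_kernel_def mult.assoc N_def)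
qed

lemma power_times_exp_neg_tendsto_0:
  fixes b c :: real
  assumes "c > 0"
  shows "(\<lambda>n. (b * real (Suc n)) ^ k * exp (- c * real (Suc n))) \<longlonglongrightarrow> 0"
proof -
  have "filterlim (\<lambda>n. c * real (Suc n)) at_top sequentially"
    by (rule filterlim_tendsto_pos_mult_at_top[OF tendsto_const assms
        filterlim_compose[OF filterlim_real_sequentially filterlim_Suc]])
  then have "(\<lambda>n. (b / c) ^ k * ((c * real (Suc n)) ^ k / exp (c * real (Suc n)))) \<longlonglongrightarrow> (b / c) ^ k * 0"
    by (intro tendsto_mult tendsto_const filterlim_compose[OF tendsto_power_div_exp_0])
  moreover have "(b / c) ^ k * ((c * x) ^ k / exp (c * x)) = (b * x) ^ k * exp (- c * x)" for x
  proof -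
    have "(b / c) ^ k * (c * x) ^ k = (b * x) ^ k"
      unfolding power_mult_distrib[symmetric] using assms by simp
    then show ?thesis by (simp only: times_divide_eq_right) (simp add: exp_minus divide_inverse)
  qed
  ultimately show ?thesis by simp
qed

lemma L2_gauss_kernel:
  assumes "d > 0" shows "L2 (\<lambda>y::'a::euclidean_space. gauss_kernel d (x - y))"
proof -
  have "L2 (gauss_kernel d :: 'a \<Rightarrow> real)"
    unfolding gauss_kernel_def[abs_def]
    using L2_scaleR[OF L2_gauss_scaled[of "inverse d"]] assms by simp
  then show ?thesis
    using lborel_reflect(1)[of "\<lambda>z. (norm (gauss_kernel d z))\<^sup>2" x] by (simp add: L2_def)
qed

lemma gauss_kernel_integrable_L2:
  fixes f :: "'a::euclidean_space \<Rightarrow> 'b::euclidean_space"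
  assumes "d > 0" "L2 f" shows "integrable lborel (\<lambda>y. gauss_kernel d (x - y) *\<^sub>R f y)"
  using L2_bilinear(1)[OF bounded_bilinear_scaleR, of 1, OF _ L2_gauss_kernel[OF assms(1)] assms(2)] by simp

lemma gauss_mean_far_tendsto_0:
  fixes f :: "'a::euclidean_space \<Rightarrow> 'b::euclidean_space"
  assumes f: "L2 f" and r: "r > 0" "\<And>x. dist y x < r \<Longrightarrow> f x = 0"
  shows "(\<lambda>n. gauss_mean (1 / real (Suc n)) f y) \<longlonglongrightarrow> 0"
proof -
  have "L2 (\<lambda>x. gauss ((1/2) *\<^sub>R (y - x)))"
    using L2_gauss_scaled[of "1/2", where 'a='a] lborel_reflect(1)[of "\<lambda>x. (gauss ((1/2) *\<^sub>R x))\<^sup>2" y]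
    by (simp add: L2_def)
  note weight_integrable = L2_Cauchy_Schwarz(1)[OF this f]
  define mass where "mass = (\<integral>x. norm (gauss ((1/2) *\<^sub>R (y - x))) * norm (f x) \<partial>lborel)"
  define rate where "rate n = (1 / sqrt (2 * pi) * real (Suc n)) ^ DIM('a) * exp (- (r\<^sup>2 / 4) * real (Suc n))" for n
  have rate_nonneg: "0 \<le> rate n" for n by (simp add: rate_def)
  have dominated: "norm (gauss_kernel (1 / real (Suc n)) (y - x) *\<^sub>R f x)
      \<le> rate n * (norm (gauss ((1/2) *\<^sub>R (y - x))) * norm (f x))" for n x
  proof (cases "dist y x < r")
    case False
    then have "gauss_kernel (1 / real (Suc n)) (y - x) \<le> rate n * gauss ((1/2) *\<^sub>R (y - x))"
      unfolding rate_def by (intro gauss_kernel_far_le r) (simp add: dist_norm)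
    from mult_right_mono[OF this, of "norm (f x)"] show ?thesis
      using gauss_kernel_nonneg[of "1 / real (Suc n)" "y - x"] by (simp add: mult.assoc)
  qed (simp add: r(2) rate_nonneg)
  have mean_le: "norm (gauss_mean (1 / real (Suc n)) f y) \<le> rate n * mass" for n
  proof -
    have "norm (gauss_mean (1 / real (Suc n)) f y)
        \<le> (\<integral>x. rate n * (norm (gauss ((1/2) *\<^sub>R (y - x))) * norm (f x)) \<partial>lborel)"
      unfolding gauss_mean_def
      by (intro order_trans[OF integral_norm_bound integral_mono[OF integrable_norm[OF gauss_kernel_integrable_L2]
            integrable_mult_right[OF weight_integrable] dominated]] f) simp
    then show ?thesis by (simp add: mass_def)
  qed
  have "(\<lambda>n. rate n * mass) \<longlonglongrightarrow> 0"
    unfolding rate_def using r(1) by (intro tendsto_mult_left_zero power_times_exp_neg_tendsto_0) simp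
  then show ?thesis by (rule Lim_null_comparison[OF always_eventually[OF allI[OF mean_le]]])
qed

lemma gauss_mean_add:
  assumes "integrable lborel (\<lambda>y. gauss_kernel d (x - y) *\<^sub>R f y)"
    "integrable lborel (\<lambda>y. gauss_kernel d (x - y) *\<^sub>R g y)"
  shows "gauss_mean d (\<lambda>y. f y + g y) x = gauss_mean d f x + gauss_mean d g x"
  using assms by (simp add: gauss_mean_def scaleR_right_distrib)

lemma gauss_mean_tendsto_L2:
  fixes f :: "'a::euclidean_space \<Rightarrow> 'b::euclidean_space"
  assumes f: "L2 f" "isCont f y"
  shows "(\<lambda>n. gauss_mean (1 / real (Suc n)) f y) \<longlonglongrightarrow> f y"
proof -
  note [measurable] = L2_measurable[OF f(1)]
  obtain r where r: "r > 0" "\<And>x. dist x y < r \<Longrightarrow> dist (f x) (f y) < 1"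
    using f(2) unfolding continuous_at_eps_delta by (metis zero_less_one)
  define near where "near x = indicator (ball y r) x *\<^sub>R f x" for x
  define far where "far x = indicator (- ball y r) x *\<^sub>R f x" for x
  have [measurable]: "near \<in> borel_measurable borel" "far \<in> borel_measurable borel"
    unfolding near_def far_def by (intro borel_measurable_scaleR borel_measurable_indicator; simp)+
  have f_eq: "f = (\<lambda>x. near x + far x)" by (auto simp: near_def far_def indicator_def)
  have near_le: "norm (near x) \<le> 1 + norm (f y)" for x
    using r(2)[of x] norm_triangle_ineq2[of "f x" "f y"]
    by (auto simp: near_def indicator_def dist_norm norm_minus_commute[of y x] add_nonneg_nonneg)
  have "eventually (\<lambda>x. near x = f x) (nhds y)"
    using eventually_nhds_ball[OF r(1), of y] by eventually_elim (simp add: near_def)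
  then have "isCont near y" using f(2) by (simp add: isCont_cong)
  from gauss_mean_tendsto_bounded[OF _ near_le this]
  have near_lim: "(\<lambda>n. gauss_mean (1 / real (Suc n)) near y) \<longlonglongrightarrow> f y"
    using r(1) by (simp add: near_def)
  have far_L2: "L2 far"
    by (rule L2_dominated(1)[OF f(1), where c=1]) (auto simp: far_def indicator_def)
  have far_lim: "(\<lambda>n. gauss_mean (1 / real (Suc n)) far y) \<longlonglongrightarrow> 0"
    by (rule gauss_mean_far_tendsto_0[OF far_L2 r(1)]) (simp add: far_def)
  have "gauss_mean (1 / real (Suc n)) f y
      = gauss_mean (1 / real (Suc n)) near y + gauss_mean (1 / real (Suc n)) far y" for n
    by (subst f_eq, intro gauss_mean_add gauss_mean_bounded(1)[OF _ _ near_le] gauss_kernel_integrable_L2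
        far_L2) simp_all
  then show ?thesis using tendsto_add[OF near_lim far_lim] by simp
qed

lemma integrable_pair_convolution:
  fixes k :: "'a::euclidean_space \<Rightarrow> real" and h :: "'a \<Rightarrow> real"
  assumes "integrable lborel k" "integrable lborel h"
  shows "integrable (lborel \<Otimes>\<^sub>M lborel) (\<lambda>(x, y). k (x - y) * h x)"
proof (rule lborel_pair.Fubini_integrable)
  note [measurable] = borel_measurable_integrable[OF assms(1)] borel_measurable_integrable[OF assms(2)]
  have [measurable]: "k \<in> borel_measurable borel" by simp
  show "(\<lambda>(x, y). k (x - y) * h x) \<in> borel_measurable (lborel \<Otimes>\<^sub>M lborel)" by measurable
  have "(\<integral>y. \<bar>k (x - y)\<bar> \<partial>lborel) = (\<integral>y. \<bar>k y\<bar> \<partial>lborel)" for x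
    by (rule lborel_reflect(2)) simp
  then show "integrable lborel (\<lambda>x. \<integral>y. norm (case (x, y) of (x, y) \<Rightarrow> k (x - y) * h x) \<partial>lborel)"
    using assms(2) by (simp add: abs_mult)
  show "AE x in lborel. integrable lborel (\<lambda>y. case (x, y) of (x, y) \<Rightarrow> k (x - y) * h x)"
    using assms(1) lborel_reflect(1)[of k] by simp
qed

lemma gauss_mean_selfadjoint:
  fixes f g :: "'a::euclidean_space \<Rightarrow> 'b::euclidean_space"
  assumes d: "d > 0" and f: "integrable lborel f" and g: "g \<in> borel_measurable borel" "\<And>x. norm (g x) \<le> B"
  shows "(\<integral>x. f x \<bullet> gauss_mean d g x \<partial>lborel) = (\<integral>x. gauss_mean d f x \<bullet> g x \<partial>lborel)"
proof -
  note [measurable] = g(1) borel_measurable_integrable[OF f]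
  have [measurable]: "f \<in> borel_measurable borel" by simp
  have kernel_integrable: "integrable lborel (\<lambda>x. gauss_kernel d (y - x) *\<^sub>R f x)" for y
  proof (rule Bochner_Integration.integrable_bound[OF
      integrable_scaleR_right[OF f, of "(1 / (sqrt (2 * pi) * d)) ^ DIM('a)"]])
    show "AE x in lborel. norm (gauss_kernel d (y - x) *\<^sub>R f x) \<le> norm ((1 / (sqrt (2 * pi) * d)) ^ DIM('a) *\<^sub>R f x)"
      using d by (intro AE_I2) (simp add: gauss_kernel_def abs_mult mult_left_le gauss_le_1 mult_right_mono)
  qed measurable
  have pair_integrable: "integrable (lborel \<Otimes>\<^sub>M lborel) (\<lambda>(x, y). gauss_kernel d (x - y) *\<^sub>R (f x \<bullet> g y))"
  proof (rule Bochner_Integration.integrable_bound[OF integrable_pair_convolution[OF gauss_kernel_integral(1)[OF d]]])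
    show "integrable lborel (\<lambda>x. norm (f x) * B)" using f by simp
    have "\<bar>f x \<bullet> g y\<bar> \<le> norm (f x) * B" for x y
      using Cauchy_Schwarz_ineq2[of "f x" "g y"] mult_left_mono[OF g(2)[of y] norm_ge_zero[of "f x"]] by linarith
    then have "\<bar>gauss_kernel d (x - y) * (f x \<bullet> g y)\<bar> \<le> \<bar>gauss_kernel d (x - y) * (norm (f x) * B)\<bar>" for x y
      unfolding abs_mult[of "gauss_kernel d _"] by (intro mult_left_mono order_trans[OF _ abs_ge_self] abs_ge_zero)
    then show "AE z in lborel \<Otimes>\<^sub>M lborel. norm (case z of (x, y) \<Rightarrow> gauss_kernel d (x - y) *\<^sub>R (f x \<bullet> g y))
        \<le> norm (case z of (x, y) \<Rightarrow> gauss_kernel d (x - y) * (norm (f x) * B))"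
      by (intro AE_I2) (simp only: split_beta' real_norm_def real_scaleR_def)
  qed measurable
  have "(\<integral>x. f x \<bullet> gauss_mean d g x \<partial>lborel) = (\<integral>x. \<integral>y. gauss_kernel d (x - y) *\<^sub>R (f x \<bullet> g y) \<partial>lborel \<partial>lborel)"
    unfolding gauss_mean_def using gauss_mean_bounded(1)[OF d g]
    by (simp flip: integral_inner_right)
  also have "\<dots> = (\<integral>y. \<integral>x. gauss_kernel d (x - y) *\<^sub>R (f x \<bullet> g y) \<partial>lborel \<partial>lborel)"
    by (rule lborel_pair.Fubini_integral[OF pair_integrable, symmetric])
  also have "\<dots> = (\<integral>y. gauss_mean d f y \<bullet> g y \<partial>lborel)"
    unfolding gauss_mean_def using kernel_integrable
    by (simp add: gauss_kernel_minus_commute[of d "_ :: 'a"] flip: integral_inner_left)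
  finally show ?thesis .
qed

lemma bounded_measurable_AE_limit_continuous:
  fixes f :: "'a::euclidean_space \<Rightarrow> 'b::euclidean_space"
  assumes "f \<in> borel_measurable borel" "\<And>x. norm (f x) \<le> B"
  obtains g where "\<And>n. continuous_on UNIV (g n)" "\<And>n x. norm (g n x) \<le> B"
    "AE x in lborel. (\<lambda>n. g n x) \<longlonglongrightarrow> f x"
proof -
  have "f measurable_on UNIV"
    using assms(1) by (intro lebesgue_measurable_imp_measurable_on) (auto simp: measurable_completion)
  then obtain N h where N: "negligible N" and h: "\<And>n. continuous_on UNIV (h n)"
    "\<And>x. x \<notin> N \<Longrightarrow> (\<lambda>n. h n x) \<longlonglongrightarrow> f x"
    unfolding measurable_on_def by auto
  have cball: "convex (cball 0 B :: 'b set)" "closed (cball 0 B :: 'b set)" "cball 0 B \<noteq> ({} :: 'b set)"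
    using order_trans[OF norm_ge_zero assms(2)] by auto
  define g where "g n x = closest_point (cball 0 B) (h n x)" for n x
  show thesis
  proof (rule that[of g])
    show "continuous_on UNIV (g n)" for n
      unfolding g_def by (rule continuous_on_compose2[OF continuous_on_closest_point[OF cball] h(1)]) auto
    show "norm (g n x) \<le> B" for n x
      using closest_point_in_set[OF cball(2,3), of "h n x"] by (simp add: g_def)
    have "AE x in lebesgue. x \<notin> N"
      using N by (intro AE_not_in) (simp add: negligible_iff_null_sets)
    then have "AE x in lebesgue. (\<lambda>n. g n x) \<longlonglongrightarrow> f x"
    proof eventually_elim
      fix x assume "x \<notin> N"
      from isCont_tendsto_compose[OF continuous_at_closest_point[OF cball] h(2)[OF this]]
      have "(\<lambda>n. g n x) \<longlonglongrightarrow> closest_point (cball 0 B) (f x)" by (simp add: g_def)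
      then show "(\<lambda>n. g n x) \<longlonglongrightarrow> f x" using assms(2) by (simp add: closest_point_self)
    qed
    then show "AE x in lborel. (\<lambda>n. g n x) \<longlonglongrightarrow> f x"
      unfolding AE_completion_iff by simp
  qed
qed

lemma integral_inner_eq_0_if_gauss_mean_eq_0:
  fixes f g :: "'a::euclidean_space \<Rightarrow> 'b::euclidean_space"
  assumes f: "integrable lborel f" "\<And>d x. d > 0 \<Longrightarrow> gauss_mean d f x = 0"
    and g: "continuous_on UNIV g" "\<And>x. norm (g x) \<le> B"
  shows "(\<integral>x. f x \<bullet> g x \<partial>lborel) = 0"
proof -
  have [measurable]: "g \<in> borel_measurable borel" using g(1) by (rule borel_measurable_continuous_onI)
  note [measurable] = borel_measurable_integrable[OF f(1)]
  have "(\<lambda>n. \<integral>x. f x \<bullet> gauss_mean (1 / real (Suc n)) g x \<partial>lborel) \<longlonglongrightarrow> (\<integral>x. f x \<bullet> g x \<partial>lborel)"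
  proof (rule integral_dominated_convergence)
    show "integrable lborel (\<lambda>x. norm (f x) * B)" using f(1) by simp
    show "AE x in lborel. (\<lambda>n. f x \<bullet> gauss_mean (1 / real (Suc n)) g x) \<longlonglongrightarrow> f x \<bullet> g x"
      using g by (intro AE_I2 tendsto_inner tendsto_const gauss_mean_tendsto_bounded[where B=B])
        (auto simp: continuous_on_eq_continuous_at)
    have "norm (f x \<bullet> gauss_mean (1 / real (Suc n)) g x)
        \<le> norm (f x) * norm (gauss_mean (1 / real (Suc n)) g x)" for n x
      by (simp add: Cauchy_Schwarz_ineq2)
    also have "\<dots> n x \<le> norm (f x) * B" for n x
      using g(2) by (intro mult_left_mono gauss_mean_bounded(2)) auto
    finally show "AE x in lborel. norm (f x \<bullet> gauss_mean (1 / real (Suc n)) g x) \<le> norm (f x) * B" for n by simp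
  qed measurable
  moreover have "(\<integral>x. f x \<bullet> gauss_mean (1 / real (Suc n)) g x \<partial>lborel) = 0" for n
    by (subst gauss_mean_selfadjoint[OF _ f(1) _ g(2)]) (simp_all add: f(2))
  ultimately show ?thesis by (simp add: LIMSEQ_const_iff)
qed

lemma AE_eq_0_if_gauss_mean_eq_0:
  fixes f :: "'a::euclidean_space \<Rightarrow> 'b::euclidean_space"
  assumes "integrable lborel f" "\<And>d x. d > 0 \<Longrightarrow> gauss_mean d f x = 0"
  shows "AE x in lborel. f x = 0"
proof -
  note [measurable] = borel_measurable_integrable[OF assms(1)]
  have sgn_measurable: "(\<lambda>x. sgn (f x)) \<in> borel_measurable borel"
    unfolding sgn_div_norm using borel_measurable_integrable[OF assms(1)] by simp
  have sgn_le: "norm (sgn (f x)) \<le> 1" for x by (simp add: norm_sgn)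
  obtain g where g: "\<And>n. continuous_on UNIV (g n)" "\<And>n x. norm (g n x) \<le> 1"
    "AE x in lborel. (\<lambda>n. g n x) \<longlonglongrightarrow> sgn (f x)"
    using bounded_measurable_AE_limit_continuous[OF sgn_measurable sgn_le] by blast
  have [measurable]: "g n \<in> borel_measurable borel" for n using g(1) by (rule borel_measurable_continuous_onI)
  have "(\<lambda>n. \<integral>x. f x \<bullet> g n x \<partial>lborel) \<longlonglongrightarrow> (\<integral>x. f x \<bullet> sgn (f x) \<partial>lborel)"
  proof (rule integral_dominated_convergence)
    show "integrable lborel (\<lambda>x. norm (f x))" using assms(1) by simp
    show "AE x in lborel. (\<lambda>n. f x \<bullet> g n x) \<longlonglongrightarrow> f x \<bullet> sgn (f x)"
      using g(3) by eventually_elim (intro tendsto_intros)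
    have "norm (f x \<bullet> g n x) \<le> norm (f x) * 1" for x n
      using Cauchy_Schwarz_ineq2[of "f x" "g n x"] mult_left_mono[OF g(2)[of n x], of "norm (f x)"] by simp
    then show "AE x in lborel. norm (f x \<bullet> g n x) \<le> norm (f x)" for n by simp
  qed (use sgn_measurable in measurable)
  moreover have "(\<integral>x. f x \<bullet> g n x \<partial>lborel) = 0" for n
    by (rule integral_inner_eq_0_if_gauss_mean_eq_0[OF assms g(1,2)])
  moreover have "f x \<bullet> sgn (f x) = norm (f x)" for x
    by (simp add: sgn_div_norm power2_norm_eq_inner[symmetric] power2_eq_square field_simps)
  ultimately have "(\<integral>x. norm (f x) \<partial>lborel) = 0" by (simp add: LIMSEQ_const_iff)
  then show ?thesis
    using integral_nonneg_eq_0_iff_AE[OF integrable_norm[OF assms(1)]] by auto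
qed

section \<open>Left multiplication by vectors in the Clifford algebra\<close>

lemma cscale_nth [simp]: "cscale c x $ T = c * x $ T"
  by (simp add: cscale_def)

lemma cscale_1 [simp]: "cscale 1 x = x" and cscale_cscale [simp]: "cscale a (cscale b x) = cscale (a * b) x"
  by (simp_all add: vec_eq_iff)

lemma cscale_of_real: "cscale (complex_of_real r) x = r *\<^sub>R x"
  by (simp add: vec_eq_iff scaleR_conv_of_real[of r "_::complex"])

lemma norm_clif_power2: "(norm (x :: 'm::finite clif))\<^sup>2 = (\<Sum>T\<in>UNIV. (norm (x $ T))\<^sup>2)"
  by (simp add: norm_vec_def L2_set_def sum_nonneg)

lemma norm_cscale [simp]: "norm (cscale c x) = norm c * norm x"
proof -
  have "(norm (cscale c x))\<^sup>2 = (norm c * norm x)\<^sup>2"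
    by (simp add: norm_clif_power2 norm_mult power_mult_distrib sum_distrib_left)
  then show ?thesis by simp
qed

lemma bounded_bilinear_cscale: "bounded_bilinear cscale"
  by standard (auto simp: vec_eq_iff algebra_simps intro!: exI[of _ 1])

lemmas bounded_linear_cscale_right = bounded_bilinear.bounded_linear_right[OF bounded_bilinear_cscale]
lemmas cscale_zero_right [simp] = bounded_bilinear.zero_right[OF bounded_bilinear_cscale]
lemmas cscale_minus_left = bounded_bilinear.minus_left[OF bounded_bilinear_cscale]
lemmas cscale_add_right = bounded_bilinear.add_right[OF bounded_bilinear_cscale]
lemmas cscale_diff_right = bounded_bilinear.diff_right[OF bounded_bilinear_cscale]
lemmas cscale_scaleR_right = bounded_bilinear.scaleR_right[OF bounded_bilinear_cscale]
lemmas cscale_sum_right = bounded_bilinear.sum_right[OF bounded_bilinear_cscale]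

lemma cscale_measurable [measurable (raw)]:
  "f \<in> borel_measurable M \<Longrightarrow> g \<in> borel_measurable M \<Longrightarrow> (\<lambda>x. cscale (f x) (g x)) \<in> borel_measurable M"
  by (rule borel_measurable_bounded_bilinear[OF bounded_bilinear_cscale])

lemma inner_cscale: "inner (cscale c x) y = inner x (cscale (cnj c) y)"
  by (simp add: inner_vec_def inner_complex_def algebra_simps)

lemma clif_mult_add_left: "clif_mult (x + y) z = clif_mult x z + clif_mult y z"
  unfolding clif_mult_def vec_eq_iff
  by (simp add: sum.distrib[symmetric]) (auto intro!: sum.cong simp: algebra_simps)

lemma clif_mult_add_right: "clif_mult x (y + z) = clif_mult x y + clif_mult x z"
  unfolding clif_mult_def vec_eq_iff
  by (simp add: sum.distrib[symmetric]) (auto intro!: sum.cong simp: algebra_simps)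

lemma clif_mult_cscale_left: "clif_mult (cscale c x) y = cscale c (clif_mult x y)"
  unfolding clif_mult_def vec_eq_iff cscale_def
  by (simp add: sum_distrib_left) (auto intro!: sum.cong simp: algebra_simps)

lemma clif_mult_cscale_right: "clif_mult x (cscale c y) = cscale c (clif_mult x y)"
  unfolding clif_mult_def vec_eq_iff cscale_def
  by (simp add: sum_distrib_left) (auto intro!: sum.cong simp: algebra_simps)

lemma clif_mult_scaleR_left: "clif_mult (r *\<^sub>R x) y = r *\<^sub>R clif_mult x y"
  by (simp add: clif_mult_cscale_left flip: cscale_of_real)

lemma clif_mult_scaleR_right: "clif_mult x (r *\<^sub>R y) = r *\<^sub>R clif_mult x y"
  by (simp add: clif_mult_cscale_right flip: cscale_of_real)

lemma linear_clif_mult_left: "linear (\<lambda>x. clif_mult x y)"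
  by (rule linearI) (simp_all add: clif_mult_add_left clif_mult_scaleR_left)

lemma linear_clif_mult_right: "linear (clif_mult x)"
  by (rule linearI) (simp_all add: clif_mult_add_right clif_mult_scaleR_right)

lemma bounded_linear_clif_mult: "bounded_linear (clif_mult x)"
  by (simp add: linear_clif_mult_right linear_conv_bounded_linear[symmetric])

lemma clif_mult_one: "clif_mult clif_one w = w"
proof -
  have "(\<Sum>T\<in>UNIV. if (S - T) \<union> (T - S) = U then clif_sign S T * (clif_one $ S) * (w $ T) else 0)
      = (if S = {} then w $ U else 0)" for S U
    by (cases "S = {}") (simp_all add: clif_one_def clif_sign_def cong: if_cong)
  then show ?thesis by (simp add: vec_eq_iff clif_mult_def)
qed

definition toggle :: "'m \<Rightarrow> 'm set \<Rightarrow> 'm set" where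
  "toggle k U = ({k} - U) \<union> (U - {k})"

lemma toggle_toggle [simp]: "toggle k (toggle k U) = U"
  and toggle_commute: "toggle k (toggle l U) = toggle l (toggle k U)"
  and mem_toggle_iff: "x \<in> toggle k U \<longleftrightarrow> (if x = k then k \<notin> U else x \<in> U)"
  by (auto simp: toggle_def)

lemma clif_mult_gen_nth:
  "clif_mult (clif_gen k) y $ U = clif_sign {k} (toggle k U) * y $ toggle k U"
proof -
  have toggle_iff: "({k} - T) \<union> (T - {k}) = U \<longleftrightarrow> T = toggle k U" for T
    by (auto simp: toggle_def)
  have "(\<Sum>T\<in>UNIV. if (S - T) \<union> (T - S) = U then clif_sign S T * (clif_gen k $ S) * (y $ T) else 0)
      = (if S = {k} then clif_sign {k} (toggle k U) * y $ toggle k U else 0)" for S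
  proof (cases "S = {k}")
    case True
    show ?thesis unfolding True toggle_iff by (simp add: clif_gen_def)
  qed (simp add: clif_gen_def cong: if_cong)
  then show ?thesis unfolding clif_mult_def by simp
qed

lemma clif_sign_singleton:
  "clif_sign {k} T = (-1) ^ card {t\<in>T. t < k} * (if k \<in> T then -1 else 1)" for T :: "'m::{finite,linorder} set"
proof -
  have "{(s, t). s \<in> {k} \<and> t \<in> T \<and> t < s} = Pair k ` {t\<in>T. t < k}" by auto
  then have "card {(s, t). s \<in> {k} \<and> t \<in> T \<and> t < s} = card {t\<in>T. t < k}"
    by (simp add: card_image inj_on_def)
  moreover have "card ({k} \<inter> T) = (if k \<in> T then 1 else 0)" by auto
  ultimately show ?thesis unfolding clif_sign_def by (simp add: power_add)
qed

lemma clif_sign_toggle_same: "clif_sign {k} (toggle k T) = - clif_sign {k} T" for T :: "'m::{finite,linorder} set"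
proof -
  have "{t \<in> toggle k T. t < k} = {t\<in>T. t < k}" by (auto simp: mem_toggle_iff)
  then show ?thesis by (simp add: clif_sign_singleton mem_toggle_iff)
qed

lemma clif_sign_toggle_other:
  fixes T :: "'m::{finite,linorder} set"
  assumes "l \<noteq> k"
  shows "clif_sign {k} (toggle l T) = (if l < k then - clif_sign {k} T else clif_sign {k} T)"
proof (cases "l < k")
  case True
  have "(-1::complex) ^ card {t \<in> toggle l T. t < k} = - ((-1) ^ card {t\<in>T. t < k})"
  proof (cases "l \<in> T")
    case in_T: True
    then have "{t\<in>T. t < k} = insert l {t \<in> toggle l T. t < k}" "l \<notin> {t \<in> toggle l T. t < k}"
      using True by (auto simp: mem_toggle_iff)
    then show ?thesis by simp
  next
    case False
    then have "{t \<in> toggle l T. t < k} = insert l {t \<in> T. t < k}" "l \<notin> {t \<in> T. t < k}"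
      using True by (auto simp: mem_toggle_iff)
    then show ?thesis by simp
  qed
  then show ?thesis using True assms by (simp add: clif_sign_singleton mem_toggle_iff)
next
  case False
  then have "{t \<in> toggle l T. t < k} = {t\<in>T. t < k}" by (auto simp: mem_toggle_iff)
  then show ?thesis using False assms by (simp add: clif_sign_singleton mem_toggle_iff)
qed

lemma clif_sign_square: "clif_sign S T * clif_sign S T = 1"
  by (simp add: clif_sign_def flip: power_mult_distrib)

lemma clif_gen_square: "clif_mult (clif_gen k) (clif_mult (clif_gen k) w) = - w"
  by (simp add: vec_eq_iff clif_mult_gen_nth clif_sign_toggle_same mult.assoc[symmetric] clif_sign_square)

lemma clif_gen_anticommute:
  assumes "k \<noteq> l"
  shows "clif_mult (clif_gen k) (clif_mult (clif_gen l) w) = - clif_mult (clif_gen l) (clif_mult (clif_gen k) w)"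
  unfolding vec_eq_iff
proof
  fix U
  have "clif_sign {k} (toggle k U) * clif_sign {l} (toggle l (toggle k U))
      = - (clif_sign {l} (toggle l U) * clif_sign {k} (toggle k (toggle l U)))"
    using assms by (auto simp: clif_sign_toggle_same clif_sign_toggle_other)
  then show "clif_mult (clif_gen k) (clif_mult (clif_gen l) w) $ U
      = (- clif_mult (clif_gen l) (clif_mult (clif_gen k) w)) $ U"
    by (simp add: clif_mult_gen_nth mult.assoc[symmetric] toggle_commute[of l k U])
qed

lemma inner_clif_sign: "inner (clif_sign S T * a) b = inner a (clif_sign S T * b)"
  unfolding clif_sign_def by (cases "even (card {(s, t). s \<in> S \<and> t \<in> T \<and> t < s} + card (S \<inter> T))") auto

lemma clif_gen_skew: "inner (clif_mult (clif_gen k) w) z = - inner w (clif_mult (clif_gen k) z)"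
proof -
  have "inner (clif_mult (clif_gen k) w) z = (\<Sum>U\<in>UNIV. inner (clif_sign {k} (toggle k U) * w $ toggle k U) (z $ U))"
    by (simp add: inner_vec_def clif_mult_gen_nth)
  also have "\<dots> = (\<Sum>U\<in>UNIV. inner (clif_sign {k} U * w $ U) (z $ toggle k U))"
    by (rule sum.reindex_bij_witness[of _ "toggle k" "toggle k"]) auto
  also have "\<dots> = - inner w (clif_mult (clif_gen k) z)"
    by (simp add: inner_vec_def clif_mult_gen_nth clif_sign_toggle_same inner_clif_sign sum_negf)
  finally show ?thesis .
qed

lemma norm_clif_mult_gen: "norm (clif_mult (clif_gen k) w) = norm w"
proof -
  have "(norm (clif_mult (clif_gen k) w))\<^sup>2 = (norm w)\<^sup>2"
    by (simp add: power2_norm_eq_inner clif_gen_skew clif_gen_square)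
  then show ?thesis by simp
qed

lemma clif_mult_vec: "clif_mult (clif_vec \<xi>) w = (\<Sum>k\<in>UNIV. (\<xi> $ k) *\<^sub>R clif_mult (clif_gen k) w)"
  unfolding clif_vec_def by (simp add: linear_sum[OF linear_clif_mult_left] clif_mult_scaleR_left)

lemma clif_vec_square: "clif_mult (clif_vec \<xi>) (clif_mult (clif_vec \<xi>) w) = - (norm \<xi>)\<^sup>2 *\<^sub>R w"
proof -
  let ?e = "\<lambda>k. clif_mult (clif_gen k)"
  let ?X = "clif_mult (clif_vec \<xi>) (clif_mult (clif_vec \<xi>) w)"
  have X_expanded: "?X = (\<Sum>k\<in>UNIV. \<Sum>l\<in>UNIV. (\<xi> $ k * \<xi> $ l) *\<^sub>R ?e l (?e k w))"
    by (simp add: clif_mult_vec linear_sum[OF linear_clif_mult_right] clif_mult_scaleR_right scaleR_sum_right)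
  also have "\<dots> = (\<Sum>k\<in>UNIV. \<Sum>l\<in>UNIV. (\<xi> $ k * \<xi> $ l) *\<^sub>R ?e k (?e l w))"
    by (subst sum.swap, intro sum.cong refl) (simp only: mult.commute)
  finally have X_swapped: "?X = (\<Sum>k\<in>UNIV. \<Sum>l\<in>UNIV. (\<xi> $ k * \<xi> $ l) *\<^sub>R ?e k (?e l w))" .
  have anticommutator: "(\<xi> $ k * \<xi> $ l) *\<^sub>R (?e k (?e l w) + ?e l (?e k w))
      = (if l = k then (- 2 * (\<xi> $ k)\<^sup>2) *\<^sub>R w else 0)" for k l
  proof (cases "l = k")
    case True
    have "- w - w = (-2) *\<^sub>R w" by (metis scaleR_2 scaleR_minus_left minus_add_distrib diff_conv_add_uminus)
    then show ?thesis using True by (simp add: clif_gen_square power2_eq_square)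
  next
    case False
    then show ?thesis using clif_gen_anticommute[of k l w] by simp
  qed
  have "?X + ?X = (\<Sum>k\<in>UNIV. \<Sum>l\<in>UNIV. (\<xi> $ k * \<xi> $ l) *\<^sub>R (?e k (?e l w) + ?e l (?e k w)))"
    by (subst (1) X_swapped, subst X_expanded) (simp add: sum.distrib scaleR_right_distrib)
  also have "\<dots> = (- 2 * (norm \<xi>)\<^sup>2) *\<^sub>R w"
    unfolding anticommutator
    by (simp add: scaleR_sum_left[symmetric] norm_vec_def L2_set_def sum_nonneg sum_negf sum_distrib_left)
  finally have "2 *\<^sub>R ?X = 2 *\<^sub>R (- (norm \<xi>)\<^sup>2 *\<^sub>R w)" by (simp add: scaleR_2)
  then show ?thesis by (simp only: scaleR_cancel_left) simp
qed

text \<open>\<^term>\<open>spec_proj 1 \<xi>\<close> and \<^term>\<open>spec_proj (-1) \<xi>\<close> are left multiplication by \<^term>\<open>chi_plus \<xi>\<close> and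
  \<^term>\<open>chi_minus \<xi>\<close>; at the origin both are multiplication by 1/2, since \<^term>\<open>inverse 0 = (0::real)\<close>.
  \<^term>\<open>dirac_exp t \<xi>\<close> is the exponential of \<^term>\<open>- t\<close> times \<^term>\<open>dirac_symbol \<xi>\<close>.\<close>

definition dirac_symbol :: "(real, 'm::{finite,linorder}) vec \<Rightarrow> 'm clif \<Rightarrow> 'm clif" where
  "dirac_symbol \<xi> w = cscale \<i> (clif_mult (clif_vec \<xi>) w)"

definition spec_proj :: "real \<Rightarrow> (real, 'm::{finite,linorder}) vec \<Rightarrow> 'm clif \<Rightarrow> 'm clif" where
  "spec_proj \<sigma> \<xi> w = (1/2) *\<^sub>R (w + (\<sigma> * inverse (norm \<xi>)) *\<^sub>R dirac_symbol \<xi> w)"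

definition dirac_exp :: "real \<Rightarrow> (real, 'm::{finite,linorder}) vec \<Rightarrow> 'm clif \<Rightarrow> 'm clif" where
  "dirac_exp t \<xi> w = exp (- t * norm \<xi>) *\<^sub>R spec_proj 1 \<xi> w + exp (t * norm \<xi>) *\<^sub>R spec_proj (-1) \<xi> w"

lemma dirac_symbol_square: "dirac_symbol \<xi> (dirac_symbol \<xi> w) = (norm \<xi>)\<^sup>2 *\<^sub>R w"
proof -
  have "dirac_symbol \<xi> (dirac_symbol \<xi> w) = cscale (- 1) (- ((norm \<xi>)\<^sup>2 *\<^sub>R w))"
    by (simp add: dirac_symbol_def clif_mult_cscale_right clif_vec_square)
  then show ?thesis by (simp add: vec_eq_iff)
qed

lemma dirac_symbol_sum:
  "dirac_symbol \<xi> w = (\<Sum>k\<in>UNIV. cscale (\<i> * complex_of_real (\<xi> $ k)) (clif_mult (clif_gen k) w))"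
  by (simp add: dirac_symbol_def clif_mult_vec cscale_sum_right cscale_of_real[symmetric])

lemma dirac_symbol_selfadjoint: "inner (dirac_symbol \<xi> w) z = inner w (dirac_symbol \<xi> z)"
proof -
  have "inner (cscale (\<i> * complex_of_real r) (clif_mult (clif_gen k) w)) z
      = inner w (cscale (\<i> * complex_of_real r) (clif_mult (clif_gen k) z))" for r k
    by (simp add: inner_cscale clif_gen_skew clif_mult_cscale_right cscale_minus_left)
  then show ?thesis by (simp add: dirac_symbol_sum inner_sum_left inner_sum_right)
qed

lemma linear_dirac_symbol: "linear (dirac_symbol \<xi>)"
  unfolding dirac_symbol_def
  by (rule linearI) (simp_all add: clif_mult_add_right clif_mult_scaleR_right cscale_add_right cscale_scaleR_right)

lemmas dirac_symbol_simps = linear_add[OF linear_dirac_symbol] linear_diff[OF linear_dirac_symbol]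
  linear_scale[OF linear_dirac_symbol]

lemma norm_dirac_symbol: "norm (dirac_symbol \<xi> w) = norm \<xi> * norm w"
proof -
  have "(norm (dirac_symbol \<xi> w))\<^sup>2 = inner w (dirac_symbol \<xi> (dirac_symbol \<xi> w))"
    by (simp add: power2_norm_eq_inner dirac_symbol_selfadjoint)
  also have "\<dots> = (norm \<xi> * norm w)\<^sup>2"
    by (simp add: dirac_symbol_square power2_norm_eq_inner[symmetric] power_mult_distrib)
  finally show ?thesis by simp
qed

lemma dirac_symbol_zero [simp]: "dirac_symbol 0 w = 0"
  using norm_dirac_symbol[of 0 w] by simp

lemma clif_mult_measurable [measurable (raw)]:
  "f \<in> borel_measurable M \<Longrightarrow> (\<lambda>x. clif_mult y (f x)) \<in> borel_measurable M"
  using borel_measurable_continuous_on[OF linear_continuous_on[OF bounded_linear_clif_mult]] by blast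

lemma spec_proj_measurable [measurable]:
  assumes [measurable]: "g \<in> borel_measurable borel" shows "(\<lambda>\<xi>. spec_proj \<sigma> \<xi> (g \<xi>)) \<in> borel_measurable borel"
  unfolding spec_proj_def dirac_symbol_sum by measurable

lemma dirac_exp_measurable [measurable]:
  assumes [measurable]: "g \<in> borel_measurable borel" shows "(\<lambda>\<xi>. dirac_exp t \<xi> (g \<xi>)) \<in> borel_measurable borel"
  unfolding dirac_exp_def by measurable

lemma clif_mult_chi_plus: "clif_mult (chi_plus \<xi>) w = spec_proj 1 \<xi> w"
  unfolding chi_plus_def spec_proj_def dirac_symbol_def
  by (simp add: clif_mult_cscale_left clif_mult_add_left clif_mult_one clif_mult_scaleR_left cscale_scaleR_right)
     (simp add: cscale_of_real[of "1/2", simplified])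

lemma clif_mult_chi_minus: "clif_mult (chi_minus \<xi>) w = spec_proj (-1) \<xi> w"
  unfolding chi_minus_def spec_proj_def dirac_symbol_def
  by (simp add: clif_mult_cscale_left linear_diff[OF linear_clif_mult_left] clif_mult_one clif_mult_scaleR_left
      cscale_scaleR_right)
     (simp add: cscale_of_real[of "1/2", simplified])

lemma clif_mult_ekern: "clif_mult (ekern x \<xi>) w = cscale (cis (snd x \<bullet> \<xi>)) (dirac_exp (fst x) \<xi> w)"
  by (simp add: ekern_def clif_mult_cscale_left clif_mult_add_left clif_mult_scaleR_left clif_mult_chi_plus
      clif_mult_chi_minus dirac_exp_def cis_conv_exp)

lemma dirac_symbol_spec_proj:
  assumes "\<bar>\<sigma>\<bar> = 1" shows "dirac_symbol \<xi> (spec_proj \<sigma> \<xi> w) = (\<sigma> * norm \<xi>) *\<^sub>R spec_proj \<sigma> \<xi> w"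
proof (cases "\<xi> = 0")
  case False
  have "\<sigma> * \<sigma> = 1" using assms by (metis abs_mult_self_eq mult_1)
  then have "(\<sigma> * norm \<xi>) * (\<sigma> * inverse (norm \<xi>)) = 1" "(\<sigma> * inverse (norm \<xi>)) * (norm \<xi>)\<^sup>2 = \<sigma> * norm \<xi>"
    using False by (simp_all add: power2_eq_square field_simps)
  then show ?thesis
    by (simp add: spec_proj_def dirac_symbol_simps dirac_symbol_square scaleR_right_distrib add.commute)
qed simp

lemma norm_spec_proj_le:
  assumes "\<bar>\<sigma>\<bar> = 1" shows "norm (spec_proj \<sigma> \<xi> w) \<le> norm w"
proof -
  have "norm ((\<sigma> * inverse (norm \<xi>)) *\<^sub>R dirac_symbol \<xi> w) \<le> norm w"
    using assms by (cases "\<xi> = 0") (simp_all add: norm_dirac_symbol abs_mult field_simps)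
  then show ?thesis
    using norm_triangle_ineq[of w "(\<sigma> * inverse (norm \<xi>)) *\<^sub>R dirac_symbol \<xi> w"]
    by (simp add: spec_proj_def del: norm_scaleR) simp
qed

lemma linear_dirac_exp: "linear (dirac_exp t \<xi>)"
  unfolding dirac_exp_def spec_proj_def
  by (rule linearI) (simp_all add: dirac_symbol_simps algebra_simps)

lemma dirac_exp_cosh_sinh:
  "dirac_exp t \<xi> w = cosh (t * norm \<xi>) *\<^sub>R w - (sinh (t * norm \<xi>) * inverse (norm \<xi>)) *\<^sub>R dirac_symbol \<xi> w"
proof -
  define p where "p = exp (t * norm \<xi>)"
  define q where "q = exp (- (t * norm \<xi>))"
  have hyperbolic: "cosh (t * norm \<xi>) = (1/2) * p + (1/2) * q" "sinh (t * norm \<xi>) = (1/2) * p - (1/2) * q"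
    by (simp_all add: cosh_def sinh_def p_def q_def)
  show ?thesis unfolding dirac_exp_def spec_proj_def hyperbolic mult_minus_left p_def[symmetric] q_def[symmetric]
    by (simp add: algebra_simps)
qed

lemma dirac_exp_0 [simp]: "dirac_exp 0 \<xi> w = w"
  by (simp add: dirac_exp_cosh_sinh)

lemma dirac_exp_selfadjoint: "inner (dirac_exp t \<xi> w) z = inner w (dirac_exp t \<xi> z)"
  by (simp add: dirac_exp_cosh_sinh inner_diff_left inner_diff_right dirac_symbol_selfadjoint)

lemma dirac_exp_spec_proj:
  assumes "\<bar>\<sigma>\<bar> = 1" shows "dirac_exp t \<xi> (spec_proj \<sigma> \<xi> w) = exp (- \<sigma> * t * norm \<xi>) *\<^sub>R spec_proj \<sigma> \<xi> w"
proof (cases "\<xi> = 0")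
  case False
  then have "dirac_exp t \<xi> (spec_proj \<sigma> \<xi> w) = (cosh (t * norm \<xi>) - \<sigma> * sinh (t * norm \<xi>)) *\<^sub>R spec_proj \<sigma> \<xi> w"
    using assms by (simp add: dirac_exp_cosh_sinh dirac_symbol_spec_proj scaleR_left_diff_distrib mult.commute)
  also have "cosh (t * norm \<xi>) - \<sigma> * sinh (t * norm \<xi>) = exp (- \<sigma> * t * norm \<xi>)"
    using assms cosh_minus_sinh[of "t * norm \<xi>"] cosh_plus_sinh[of "t * norm \<xi>"] by (auto simp: abs_if split: if_splits)
  finally show ?thesis .
qed (simp add: dirac_exp_cosh_sinh)

lemma dirac_exp_add: "dirac_exp s \<xi> (dirac_exp t \<xi> w) = dirac_exp (s + t) \<xi> w"
  by (simp add: dirac_exp_def[of t] dirac_exp_def[of "s + t"] linear_add[OF linear_dirac_exp]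
      linear_scale[OF linear_dirac_exp]
      dirac_exp_spec_proj mult_exp_exp algebra_simps)

lemma norm_dirac_exp_le: "norm (dirac_exp t \<xi> w) \<le> 2 * exp (\<bar>t\<bar> * norm \<xi>) * norm w"
proof -
  have "- t * norm \<xi> \<le> \<bar>t\<bar> * norm \<xi>" "t * norm \<xi> \<le> \<bar>t\<bar> * norm \<xi>" by (intro mult_right_mono; simp)+
  then have "exp (- t * norm \<xi>) * norm (spec_proj 1 \<xi> w) \<le> exp (\<bar>t\<bar> * norm \<xi>) * norm w"
    "exp (t * norm \<xi>) * norm (spec_proj (-1) \<xi> w) \<le> exp (\<bar>t\<bar> * norm \<xi>) * norm w"
    by (intro mult_mono norm_spec_proj_le; simp)+
  then show ?thesis unfolding dirac_exp_def
    using norm_triangle_ineq[of "exp (- t * norm \<xi>) *\<^sub>R spec_proj 1 \<xi> w"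
        "exp (t * norm \<xi>) *\<^sub>R spec_proj (-1) \<xi> w"] by simp
qed

lemma dirac_exp_norm_lower:
  "(exp (t * norm \<xi>) * norm w)\<^sup>2 \<le> (norm (dirac_exp t \<xi> w))\<^sup>2 + (norm (dirac_exp (- t) \<xi> w))\<^sup>2"
proof -
  have parallelogram: "(norm (x - y))\<^sup>2 + (norm (x + y))\<^sup>2 = 2 * (norm x)\<^sup>2 + 2 * (norm y)\<^sup>2" for x y :: "'a clif"
    by (simp add: power2_norm_eq_inner algebra_simps inner_commute)
  define z where "z = (sinh (t * norm \<xi>) * inverse (norm \<xi>)) *\<^sub>R dirac_symbol \<xi> w"
  have "(norm (dirac_exp t \<xi> w))\<^sup>2 + (norm (dirac_exp (- t) \<xi> w))\<^sup>2
      = 2 * (norm (cosh (t * norm \<xi>) *\<^sub>R w))\<^sup>2 + 2 * (norm z)\<^sup>2"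
    using parallelogram[of "cosh (t * norm \<xi>) *\<^sub>R w" z] by (simp add: dirac_exp_cosh_sinh z_def)
  moreover have "(norm z)\<^sup>2 = (sinh (t * norm \<xi>))\<^sup>2 * (norm w)\<^sup>2"
    by (cases "\<xi> = 0") (simp_all add: z_def norm_dirac_symbol power_mult_distrib power_divide field_simps)
  ultimately have "(norm (dirac_exp t \<xi> w))\<^sup>2 + (norm (dirac_exp (- t) \<xi> w))\<^sup>2
      = 2 * ((cosh (t * norm \<xi>))\<^sup>2 + (sinh (t * norm \<xi>))\<^sup>2) * (norm w)\<^sup>2"
    by (simp add: power_mult_distrib algebra_simps)
  also have "2 * ((cosh (t * norm \<xi>))\<^sup>2 + (sinh (t * norm \<xi>))\<^sup>2) = (exp (t * norm \<xi>))\<^sup>2 + (exp (- (t * norm \<xi>)))\<^sup>2"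
    by (simp add: cosh_def sinh_def power2_eq_square field_simps)
  finally show ?thesis by (simp add: distrib_right power_mult_distrib)
qed

section \<open>The Fourier transform of Clifford-valued functions\<close>

definition fourier :: "real \<Rightarrow> ('a::euclidean_space \<Rightarrow> 'm::finite clif) \<Rightarrow> 'a \<Rightarrow> 'm clif" where
  "fourier s h \<xi> = (\<integral>x. cscale (cis (s * (x \<bullet> \<xi>))) (h x) \<partial>lborel)"

lemma cscale_cis_integrable:
  assumes "integrable lborel h" "p \<in> borel_measurable borel"
  shows "integrable lborel (\<lambda>x::'a::euclidean_space. cscale (cis (p x)) (h x))"
proof -
  note [measurable] = assms(2) borel_measurable_integrable[OF assms(1)]
  show ?thesis
    by (rule Bochner_Integration.integrable_bound[OF assms(1)]) auto
qed

lemma fourier_measurable [measurable]: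
  assumes [measurable]: "h \<in> borel_measurable borel" shows "fourier s h \<in> borel_measurable borel"
  unfolding fourier_def by measurable

lemma fourier_diff:
  assumes "integrable lborel h" "integrable lborel k"
  shows "fourier s (\<lambda>x. h x - k x) \<xi> = fourier s h \<xi> - fourier s k \<xi>"
  unfolding fourier_def using assms by (simp add: cscale_diff_right cscale_cis_integrable)

lemma fourier_cong_AE:
  assumes "AE x in lborel. h x = k x" "h \<in> borel_measurable borel" "k \<in> borel_measurable borel"
  shows "fourier s h = fourier s k"
proof
  note [measurable] = assms(2,3)
  show "fourier s h \<xi> = fourier s k \<xi>" for \<xi>
    unfolding fourier_def by (rule integral_cong_AE) (use assms(1) in auto)
qed

lemma norm_fourier_le: "norm (fourier s h \<xi>) \<le> (\<integral>x. norm (h x) \<partial>lborel)"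
  unfolding fourier_def by (rule order_trans[OF integral_norm_bound]) simp

lemma integrable_pair_mult:
  fixes h :: "'a::euclidean_space \<Rightarrow> real" and k :: "'b::euclidean_space \<Rightarrow> real"
  assumes "integrable lborel h" "integrable lborel k"
  shows "integrable (lborel \<Otimes>\<^sub>M lborel) (\<lambda>(x, y). h x * k y)"
proof -
  note [measurable] = borel_measurable_integrable[OF assms(1)] borel_measurable_integrable[OF assms(2)]
  show ?thesis
    by (rule lborel_pair.Fubini_integrable) (use assms in \<open>auto simp: abs_mult\<close>)
qed

lemma integral_fourier_bilinear:
  fixes p :: "'m::finite clif \<Rightarrow> 'b::euclidean_space \<Rightarrow> 'c::euclidean_space"
    and h :: "'a::euclidean_space \<Rightarrow> 'm clif"
  assumes p: "bounded_bilinear p" and h: "integrable lborel h" and v: "integrable lborel v"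
  shows "(\<integral>\<xi>. p (fourier s h \<xi>) (v \<xi>) \<partial>lborel) = (\<integral>x. \<integral>\<xi>. p (cscale (cis (s * (x \<bullet> \<xi>))) (h x)) (v \<xi>) \<partial>lborel \<partial>lborel)"
proof -
  note [measurable] = borel_measurable_integrable[OF h] borel_measurable_integrable[OF v]
  obtain K where K: "K > 0" "\<And>a b. norm (p a b) \<le> norm a * norm b * K"
    using bounded_bilinear.pos_bounded[OF p] by blast
  have "integrable (lborel \<Otimes>\<^sub>M lborel) (\<lambda>z. K * (case z of (x, \<xi>) \<Rightarrow> norm (h x) * norm (v \<xi>)))"
    by (intro integrable_mult_right integrable_pair_mult integrable_norm h v)
  then have pair_integrable: "integrable (lborel \<Otimes>\<^sub>M lborel) (\<lambda>(x, \<xi>). p (cscale (cis (s * (x \<bullet> \<xi>))) (h x)) (v \<xi>))"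
  proof (rule Bochner_Integration.integrable_bound)
    show "(\<lambda>(x, \<xi>). p (cscale (cis (s * (x \<bullet> \<xi>))) (h x)) (v \<xi>)) \<in> borel_measurable (lborel \<Otimes>\<^sub>M lborel)"
      unfolding split_beta' by (rule borel_measurable_bounded_bilinear[OF p]) measurable
    have "norm (p (cscale (cis (s * (x \<bullet> \<xi>))) (h x)) (v \<xi>)) \<le> K * (norm (h x) * norm (v \<xi>))" for x \<xi>
      using K(2)[of "cscale (cis (s * (x \<bullet> \<xi>))) (h x)" "v \<xi>"] by (simp add: mult_ac)
    then show "AE z in lborel \<Otimes>\<^sub>M lborel. norm (case z of (x, \<xi>) \<Rightarrow> p (cscale (cis (s * (x \<bullet> \<xi>))) (h x)) (v \<xi>))
        \<le> norm (K * (case z of (x, \<xi>) \<Rightarrow> norm (h x) * norm (v \<xi>)))"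
      using K(1) by (auto simp: abs_mult)
  qed
  have "p (fourier s h \<xi>) (v \<xi>) = (\<integral>x. p (cscale (cis (s * (x \<bullet> \<xi>))) (h x)) (v \<xi>) \<partial>lborel)" for \<xi>
    unfolding fourier_def
    by (rule integral_bounded_linear[OF bounded_bilinear.bounded_linear_left[OF p] cscale_cis_integrable[OF h],
        symmetric]) simp
  then show ?thesis by (simp add: lborel_pair.Fubini_integral[OF pair_integrable])
qed

lemma fourier_adjoint:
  fixes h v :: "'a::euclidean_space \<Rightarrow> 'm::finite clif"
  assumes "integrable lborel h" "integrable lborel v"
  shows "(\<integral>\<xi>. fourier s h \<xi> \<bullet> v \<xi> \<partial>lborel) = (\<integral>x. h x \<bullet> fourier (- s) v x \<partial>lborel)"
proof -
  have "cscale (cis (s * (x \<bullet> \<xi>))) (h x) \<bullet> v \<xi> = h x \<bullet> cscale (cis (- s * (\<xi> \<bullet> x))) (v \<xi>)" for x \<xi>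
    by (simp add: inner_cscale cis_cnj inner_commute[of x])
  then have "(\<integral>\<xi>. cscale (cis (s * (x \<bullet> \<xi>))) (h x) \<bullet> v \<xi> \<partial>lborel) = h x \<bullet> fourier (- s) v x" for x
    unfolding fourier_def by (simp add: cscale_cis_integrable assms)
  then show ?thesis
    using integral_fourier_bilinear[OF bounded_bilinear_inner assms] by simp
qed

lemma fourier_gauss_fourier:
  fixes h :: "'a::euclidean_space \<Rightarrow> 'm::finite clif"
  assumes s: "\<bar>s\<bar> = 1" and h: "integrable lborel h" and d: "d > 0"
  shows "fourier (- s) (\<lambda>\<xi>. gauss (d *\<^sub>R \<xi>) *\<^sub>R fourier s h \<xi>) x = (2 * pi) ^ DIM('a) *\<^sub>R gauss_mean d h x"
proof -
  define v where "v \<xi> = cis (- s * (\<xi> \<bullet> x)) * complex_of_real (gauss (d *\<^sub>R \<xi>))" for \<xi>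
  have [measurable]: "v \<in> borel_measurable borel" unfolding v_def by measurable
  have v_integrable: "integrable lborel v"
    using gauss_scaled_integrable[of d, where 'a='a] d
    by (intro Bochner_Integration.integrable_bound[where f="\<lambda>\<xi>. gauss (d *\<^sub>R \<xi>)" and g=v]) (auto simp: v_def norm_mult)
  have kernel: "(\<integral>\<xi>. cscale (v \<xi>) (cscale (cis (s * (y \<bullet> \<xi>))) (h y)) \<partial>lborel)
      = (2 * pi) ^ DIM('a) *\<^sub>R (gauss_kernel d (x - y) *\<^sub>R h y)" for y
  proof -
    have "v \<xi> * cis (s * (y \<bullet> \<xi>)) = cis (\<xi> \<bullet> (s *\<^sub>R (y - x))) * complex_of_real (gauss (d *\<^sub>R \<xi>))" for \<xi>
      by (simp add: v_def inner_diff_right inner_commute[of y] cis_mult algebra_simps flip: mult.assoc)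
    then have "(\<integral>\<xi>. v \<xi> * cis (s * (y \<bullet> \<xi>)) \<partial>lborel) = (2 * pi) ^ DIM('a) * gauss_kernel d (s *\<^sub>R (y - x))"
      by (simp only: gauss_scaled_characteristic[OF d])
    also have "gauss_kernel d (s *\<^sub>R (y - x)) = gauss_kernel d (x - y)"
      using s gauss_kernel_minus_commute[of d x y] gauss_kernel_minus[of d "y - x"]
      by (auto simp: abs_if split: if_splits)
    finally have scalar: "(\<integral>\<xi>. v \<xi> * cis (s * (y \<bullet> \<xi>)) \<partial>lborel)
        = complex_of_real ((2 * pi) ^ DIM('a) * gauss_kernel d (x - y))"
      by simp
    have "integrable lborel (\<lambda>\<xi>. v \<xi> * cis (s * (y \<bullet> \<xi>)))"
      using borel_measurable_integrable[OF v_integrable]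
      by (intro Bochner_Integration.integrable_bound[OF v_integrable]) (auto simp: norm_mult)
    from integral_bounded_linear[OF bounded_bilinear.bounded_linear_left[OF bounded_bilinear_cscale, of "h y"] this]
    show ?thesis by (simp add: scalar cscale_of_real[of "_ * _"] del: of_real_mult)
  qed
  have "fourier (- s) (\<lambda>\<xi>. gauss (d *\<^sub>R \<xi>) *\<^sub>R fourier s h \<xi>) x = (\<integral>\<xi>. cscale (v \<xi>) (fourier s h \<xi>) \<partial>lborel)"
    unfolding fourier_def[of "- s"] v_def by (simp flip: cscale_of_real)
  also have "\<dots> = (\<integral>y. \<integral>\<xi>. cscale (v \<xi>) (cscale (cis (s * (y \<bullet> \<xi>))) (h y)) \<partial>lborel \<partial>lborel)"
    by (rule integral_fourier_bilinear[OF bounded_bilinear.flip[OF bounded_bilinear_cscale] h v_integrable])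
  also have "\<dots> = (2 * pi) ^ DIM('a) *\<^sub>R gauss_mean d h x"
    by (simp only: kernel gauss_mean_def integral_scaleR_right)
  finally show ?thesis .
qed

lemma fourier_unique:
  fixes h :: "'a::euclidean_space \<Rightarrow> 'm::finite clif"
  assumes "\<bar>s\<bar> = 1" "integrable lborel h" "\<And>\<xi>. fourier s h \<xi> = 0"
  shows "AE x in lborel. h x = 0"
proof (rule AE_eq_0_if_gauss_mean_eq_0[OF assms(2)])
  show "gauss_mean d h x = 0" if "d > 0" for d x
    using fourier_gauss_fourier[OF assms(1,2) that, of x] by (simp add: assms(3) fourier_def[of "- s"])
qed

lemma l2_gauss_fourier_le:
  fixes h :: "'a::euclidean_space \<Rightarrow> 'm::finite clif"
  assumes s: "\<bar>s\<bar> = 1" and h: "integrable lborel h" "L2 h" and d: "d > 0"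
  shows "L2 (\<lambda>\<xi>. gauss (d *\<^sub>R \<xi>) *\<^sub>R fourier s h \<xi>)"
    and "l2 (\<lambda>\<xi>. gauss (d *\<^sub>R \<xi>) *\<^sub>R fourier s h \<xi>) \<le> sqrt ((2 * pi) ^ DIM('a)) * l2 h"
proof -
  note [measurable] = L2_measurable[OF h(2)]
  define B where "B = (\<integral>x. norm (h x) \<partial>lborel)"
  have dominated: "norm (gauss (c *\<^sub>R \<xi>) *\<^sub>R fourier s h \<xi>) \<le> B * norm (gauss (c *\<^sub>R \<xi>))" for c \<xi>
    using norm_fourier_le[of s h \<xi>] by (simp add: B_def mult_left_mono mult.commute)
  show "L2 (\<lambda>\<xi>. gauss (d *\<^sub>R \<xi>) *\<^sub>R fourier s h \<xi>)"
    by (rule L2_dominated(1)[OF L2_gauss_scaled[of d], where c=B]) (use d dominated[of d] in \<open>auto simp: B_def\<close>)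
  define c where "c = sqrt 2 * d"
  have c_pos: "c > 0" using d by (simp add: c_def)
  have weighted_integrable: "integrable lborel (\<lambda>\<xi>. gauss (c *\<^sub>R \<xi>) *\<^sub>R fourier s h \<xi>)"
  proof (rule Bochner_Integration.integrable_bound)
    show "integrable lborel (\<lambda>\<xi>::'a. B * gauss (c *\<^sub>R \<xi>))"
      using c_pos by (intro integrable_mult_right gauss_scaled_integrable) simp
    show "AE \<xi> in lborel. norm (gauss (c *\<^sub>R \<xi>) *\<^sub>R fourier s h \<xi>) \<le> norm (B * gauss (c *\<^sub>R \<xi>))"
      by (intro AE_I2 order_trans[OF dominated]) (simp add: abs_mult mult_right_mono)
  qed measurable
  have "(l2 (\<lambda>\<xi>. gauss (d *\<^sub>R \<xi>) *\<^sub>R fourier s h \<xi>))\<^sup>2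
      = (\<integral>\<xi>. fourier s h \<xi> \<bullet> (gauss (c *\<^sub>R \<xi>) *\<^sub>R fourier s h \<xi>) \<partial>lborel)"
    by (simp add: l2_power2 power_mult_distrib gauss_scaled_power2 power2_norm_eq_inner c_def)
  also have "\<dots> = (\<integral>x. h x \<bullet> fourier (- s) (\<lambda>\<xi>. gauss (c *\<^sub>R \<xi>) *\<^sub>R fourier s h \<xi>) x \<partial>lborel)"
    by (rule fourier_adjoint[OF h(1) weighted_integrable])
  also have "\<dots> = (2 * pi) ^ DIM('a) * (\<integral>x. h x \<bullet> gauss_mean c h x \<partial>lborel)"
    by (simp add: fourier_gauss_fourier[OF s h(1) c_pos])
  also have "\<dots> \<le> (2 * pi) ^ DIM('a) * (l2 h * l2 h)"
    using L2_inner(2)[OF h(2) L2_gauss_mean(1)[OF c_pos h(2)]]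
        mult_left_mono[OF L2_gauss_mean(2)[OF c_pos h(2)], of "l2 h"]
    by (intro mult_left_mono) (auto simp: abs_le_iff)
  also have "\<dots> = (sqrt ((2 * pi) ^ DIM('a)) * l2 h)\<^sup>2"
    by (simp add: power_mult_distrib power2_eq_square[of "l2 h"])
  finally show "l2 (\<lambda>\<xi>. gauss (d *\<^sub>R \<xi>) *\<^sub>R fourier s h \<xi>) \<le> sqrt ((2 * pi) ^ DIM('a)) * l2 h"
    by (rule power2_le_imp_le) simp
qed

lemma fourier_plancherel_le:
  fixes h :: "'a::euclidean_space \<Rightarrow> 'm::finite clif"
  assumes "\<bar>s\<bar> = 1" "integrable lborel h" "L2 h"
  shows "L2 (fourier s h)" "l2 (fourier s h) \<le> sqrt ((2 * pi) ^ DIM('a)) * l2 h"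
proof -
  have "AE \<xi> in lborel. (\<lambda>n. gauss ((1 / real (Suc n)) *\<^sub>R \<xi>) *\<^sub>R fourier s h \<xi>) \<longlonglongrightarrow> 1 *\<^sub>R fourier s h \<xi>"
    by (intro AE_I2 tendsto_scaleR tendsto_const gauss_scaled_tendsto)
  then have gauss_tendsto: "AE \<xi> in lborel. (\<lambda>n. gauss ((1 / real (Suc n)) *\<^sub>R \<xi>) *\<^sub>R fourier s h \<xi>) \<longlonglongrightarrow> fourier s h \<xi>"
    by simp
  show "L2 (fourier s h)" "l2 (fourier s h) \<le> sqrt ((2 * pi) ^ DIM('a)) * l2 h"
    by (rule L2_Fatou[OF l2_gauss_fourier_le[OF assms] gauss_tendsto
        fourier_measurable[OF L2_measurable[OF assms(3)]]]; simp)+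
qed

lemma fourier_trunc_eq: "fourier_trunc f R = fourier (-1) (trunc R f)"
  by (simp add: fun_eq_iff fourier_trunc_def fourier_def trunc_def cscale_scaleR_right cis_conv_exp)

lemma is_fourier_L2_iff:
  assumes "L2 f"
  shows "is_fourier_L2 f g \<longleftrightarrow> L2 g \<and> ((\<lambda>R. l2 (\<lambda>\<xi>. g \<xi> - fourier (-1) (trunc R f) \<xi>)) \<longlongrightarrow> 0) at_top"
proof (cases "L2 g")
  case True
  let ?e = "\<lambda>R. l2 (\<lambda>\<xi>. g \<xi> - fourier (-1) (trunc R f) \<xi>)"
  have "(\<integral>\<^sup>+\<xi>. ennreal ((norm (g \<xi> - fourier_trunc f R \<xi>))\<^sup>2) \<partial>lborel) = ennreal ((?e R)\<^sup>2)" for R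
    using fourier_plancherel_le(1)[OF _ trunc_integrable[OF assms] L2_trunc[OF assms]]
    by (simp add: fourier_trunc_eq nn_integral_L2 L2_diff True)
  moreover have "((\<lambda>R. ennreal ((?e R)\<^sup>2)) \<longlongrightarrow> 0) at_top \<longleftrightarrow> (?e \<longlongrightarrow> 0) at_top"
  proof
    assume "((\<lambda>R. ennreal ((?e R)\<^sup>2)) \<longlongrightarrow> 0) at_top"
    then have "((\<lambda>R. (?e R)\<^sup>2) \<longlongrightarrow> 0) at_top" by (simp add: tendsto_ennreal_iff flip: ennreal_0)
    from tendsto_real_sqrt[OF this] show "(?e \<longlongrightarrow> 0) at_top" by simp
  next
    assume "(?e \<longlongrightarrow> 0) at_top"
    from tendsto_ennrealI[OF tendsto_power[OF this, of 2]]
    show "((\<lambda>R. ennreal ((?e R)\<^sup>2)) \<longlongrightarrow> 0) at_top" by simp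
  qed
  ultimately show ?thesis using True by (simp add: is_fourier_L2_def L2fun_iff_L2)
qed (simp add: is_fourier_L2_def L2fun_iff_L2)

lemma is_fourier_L2_cong_AE:
  assumes "is_fourier_L2 f g" "L2 f" "AE x in lborel. f x = f' x" "f' \<in> borel_measurable borel"
    "AE \<xi> in lborel. g \<xi> = g' \<xi>" "g' \<in> borel_measurable borel"
  shows "is_fourier_L2 f' g'"
proof -
  have L2_g: "L2 g" using assms(1,2) by (simp add: is_fourier_L2_iff)
  have f': "L2 f'" and g': "L2 g'"
    using assms(3,5)
    by (auto intro!: L2_cong_AE[OF _ assms(2) assms(4)] L2_cong_AE[OF _ L2_g assms(6)] elim: eventually_mono)
  have trunc_eq: "fourier (-1) (trunc R f) = fourier (-1) (trunc R f')" for R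
    using assms(2,3,4) by (intro fourier_cong_AE trunc_measurable) (auto simp: trunc_def dest: L2_measurable)
  have "l2 (\<lambda>\<xi>. g \<xi> - fourier (-1) (trunc R f) \<xi>) = l2 (\<lambda>\<xi>. g' \<xi> - fourier (-1) (trunc R f) \<xi>)" for R
  proof (rule l2_cong_AE)
    note [measurable] = L2_measurable[OF assms(2)] L2_measurable[OF L2_g] assms(6)
    show "(\<lambda>\<xi>. g \<xi> - fourier (-1) (trunc R f) \<xi>) \<in> borel_measurable borel"
      "(\<lambda>\<xi>. g' \<xi> - fourier (-1) (trunc R f) \<xi>) \<in> borel_measurable borel" by measurable
  qed (use assms(5) in auto)
  then show ?thesis using assms(1) g' by (simp add: is_fourier_L2_iff[OF assms(2)] is_fourier_L2_iff[OF f'] trunc_eq)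
qed

lemma fourier_L2_contraction:
  fixes h k :: "'a::euclidean_space \<Rightarrow> 'm::finite clif"
  assumes "\<bar>s\<bar> = 1" "integrable lborel h" "L2 h" "integrable lborel k" "L2 k"
  shows "l2 (\<lambda>\<xi>. fourier s h \<xi> - fourier s k \<xi>) \<le> sqrt ((2 * pi) ^ DIM('a)) * l2 (\<lambda>x. h x - k x)"
  using fourier_plancherel_le(2)[of s "\<lambda>x. h x - k x"] assms
  by (simp add: fourier_diff[OF assms(2,4), abs_def] L2_diff)

lemma is_fourier_L2_exists:
  fixes f :: "(real, 'm::finite) vec \<Rightarrow> 'm clif"
  assumes f: "L2 f"
  obtains g where "is_fourier_L2 f g"
proof -
  let ?K = "sqrt ((2 * pi) ^ CARD('m))"
  let ?\<delta> = "\<lambda>R. l2 (\<lambda>x. f x - trunc R f x)"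
  note trunc = trunc_integrable[OF f] L2_trunc[OF f]
  have transform_L2: "L2 (fourier (-1) (trunc R f))" for R
    by (rule fourier_plancherel_le[OF _ trunc]) simp
  have rate: "((\<lambda>R. ?K * ?\<delta> R) \<longlongrightarrow> 0) at_top"
    by (rule tendsto_mult_right_zero[OF l2_trunc_tendsto[OF f]])
  have "l2 (\<lambda>\<xi>. fourier (-1) (trunc R f) \<xi> - fourier (-1) (trunc S f) \<xi>) \<le> ?K * ?\<delta> R + ?K * ?\<delta> S" for R S
  proof -
    have "l2 (\<lambda>\<xi>. fourier (-1) (trunc R f) \<xi> - fourier (-1) (trunc S f) \<xi>) \<le> ?K * l2 (\<lambda>x. trunc R f x - trunc S f x)"
      using fourier_L2_contraction[of "-1" "trunc R f" "trunc S f"] trunc by simp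
    also have "\<dots> \<le> ?K * (?\<delta> R + ?\<delta> S)"
      using l2_triangle_diff[OF trunc(2) f trunc(2), of R S]
      by (intro mult_left_mono) (simp_all add: l2_minus_commute[of "trunc R f"])
    finally show ?thesis by (simp add: distrib_left)
  qed
  from L2_complete_at_top[OF transform_L2 rate this]
  obtain g where "L2 g" "((\<lambda>R. l2 (\<lambda>\<xi>. g \<xi> - fourier (-1) (trunc R f) \<xi>)) \<longlongrightarrow> 0) at_top"
    by blast
  then show thesis by (intro that) (simp add: is_fourier_L2_iff[OF f])
qed

lemma is_fourier_L2_l2_le:
  fixes f :: "(real, 'm::finite) vec \<Rightarrow> 'm clif"
  assumes f: "L2 f" and g: "is_fourier_L2 f g"
  shows "l2 g \<le> sqrt ((2 * pi) ^ CARD('m)) * l2 f"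
proof (rule tendsto_lowerbound[OF _ _ trivial_limit_at_top_linorder])
  let ?u = "\<lambda>R. fourier (-1) (trunc R f)"
  let ?K = "sqrt ((2 * pi) ^ CARD('m))"
  have L2_g: "L2 g" and transform_tendsto: "((\<lambda>R. l2 (\<lambda>\<xi>. g \<xi> - ?u R \<xi>)) \<longlongrightarrow> 0) at_top"
    using g by (simp_all add: is_fourier_L2_iff[OF f])
  show "((\<lambda>R. l2 (\<lambda>\<xi>. g \<xi> - ?u R \<xi>) + ?K * l2 f) \<longlongrightarrow> ?K * l2 f) at_top"
    using tendsto_add[OF transform_tendsto tendsto_const] by simp
  have "l2 g \<le> l2 (\<lambda>\<xi>. g \<xi> - ?u R \<xi>) + ?K * l2 f" for R
  proof -
    note transform = fourier_plancherel_le[of "-1", OF _ trunc_integrable[OF f, of R] L2_trunc[OF f, of R]]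
    have "l2 (trunc R f) \<le> 1 * l2 f"
      by (rule L2_dominated(2)[OF f L2_measurable[OF L2_trunc[OF f]]]) (auto simp: trunc_def indicator_def)
    then have "?K * l2 (trunc R f) \<le> ?K * l2 f" by (intro mult_left_mono) auto
    moreover have "l2 g \<le> l2 (\<lambda>\<xi>. g \<xi> - ?u R \<xi>) + l2 (?u R)"
      using l2_triangle[OF L2_diff[OF L2_g transform(1)] transform(1)] by simp
    moreover have "l2 (?u R) \<le> ?K * l2 (trunc R f)" using transform(2) by simp
    ultimately show ?thesis by linarith
  qed
  then show "\<forall>\<^sub>F R in at_top. l2 g \<le> l2 (\<lambda>\<xi>. g \<xi> - ?u R \<xi>) + ?K * l2 f" by simp
qed

lemma is_fourier_L2_adjoint:
  fixes f :: "(real, 'm::finite) vec \<Rightarrow> 'm clif"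
  assumes f: "L2 f" and g: "is_fourier_L2 f g" and v: "integrable lborel v" "L2 v"
  shows "(\<integral>\<xi>. g \<xi> \<bullet> v \<xi> \<partial>lborel) = (\<integral>x. f x \<bullet> fourier 1 v x \<partial>lborel)"
proof (rule tendsto_unique[OF trivial_limit_at_top_linorder])
  note trunc = trunc_integrable[OF f] L2_trunc[OF f]
  have "L2 g" "((\<lambda>R. l2 (\<lambda>\<xi>. g \<xi> - fourier (-1) (trunc R f) \<xi>)) \<longlongrightarrow> 0) at_top"
    using g by (simp_all add: is_fourier_L2_iff[OF f])
  then show "((\<lambda>R. \<integral>\<xi>. fourier (-1) (trunc R f) \<xi> \<bullet> v \<xi> \<partial>lborel) \<longlongrightarrow> (\<integral>\<xi>. g \<xi> \<bullet> v \<xi> \<partial>lborel)) at_top"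
    by (intro L2_bilinear_tendsto[OF bounded_bilinear_inner] v fourier_plancherel_le trunc) simp_all
  have "L2 (fourier 1 v)" by (rule fourier_plancherel_le[OF _ v]) simp
  from L2_bilinear_tendsto[OF bounded_bilinear_inner trunc(2) f this l2_trunc_tendsto[OF f]]
  show "((\<lambda>R. \<integral>\<xi>. fourier (-1) (trunc R f) \<xi> \<bullet> v \<xi> \<partial>lborel) \<longlongrightarrow> (\<integral>x. f x \<bullet> fourier 1 v x \<partial>lborel)) at_top"
    by (simp add: fourier_adjoint[OF trunc(1) v(1)])
qed

lemma fourier_gauss_fourier_L2:
  fixes f :: "(real, 'm::finite) vec \<Rightarrow> 'm clif"
  assumes f: "L2 f" and g: "is_fourier_L2 f g" and d: "d > 0"
  shows "fourier 1 (\<lambda>\<xi>. gauss (d *\<^sub>R \<xi>) *\<^sub>R g \<xi>) x = (2 * pi) ^ CARD('m) *\<^sub>R gauss_mean d f x"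
proof (rule tendsto_unique[OF trivial_limit_at_top_linorder])
  note trunc = trunc_integrable[OF f] L2_trunc[OF f]
  let ?weight = "\<lambda>\<xi>. cis (\<xi> \<bullet> x) * complex_of_real (gauss (d *\<^sub>R \<xi>))"
  have weighted: "fourier 1 (\<lambda>\<xi>. gauss (d *\<^sub>R \<xi>) *\<^sub>R h \<xi>) x = (\<integral>\<xi>. cscale (?weight \<xi>) (h \<xi>) \<partial>lborel)"
    for h :: "(real, 'm) vec \<Rightarrow> 'm clif"
    by (simp add: fourier_def flip: cscale_of_real)
  have weight: "L2 ?weight"
    by (rule L2_dominated(1)[OF L2_gauss_scaled[of d], where c=1]) (use d in \<open>auto simp: norm_mult\<close>)
  have "L2 g" "((\<lambda>R. l2 (\<lambda>\<xi>. g \<xi> - fourier (-1) (trunc R f) \<xi>)) \<longlongrightarrow> 0) at_top"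
    using g by (simp_all add: is_fourier_L2_iff[OF f])
  then show "((\<lambda>R. fourier 1 (\<lambda>\<xi>. gauss (d *\<^sub>R \<xi>) *\<^sub>R fourier (-1) (trunc R f) \<xi>) x)
      \<longlongrightarrow> fourier 1 (\<lambda>\<xi>. gauss (d *\<^sub>R \<xi>) *\<^sub>R g \<xi>) x) at_top"
    unfolding weighted
    by (intro L2_bilinear_tendsto[OF bounded_bilinear.flip[OF bounded_bilinear_cscale]] weight
        fourier_plancherel_le trunc) simp_all
  have "((\<lambda>R. gauss_mean d (trunc R f) x) \<longlongrightarrow> gauss_mean d f x) at_top"
    unfolding gauss_mean_def
    by (intro L2_bilinear_tendsto[OF bounded_bilinear.flip[OF bounded_bilinear_scaleR]] L2_gauss_kernel d trunc
        f l2_trunc_tendsto)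
  from tendsto_scaleR[OF tendsto_const this, of "(2 * pi) ^ CARD('m)"]
  show "((\<lambda>R. fourier 1 (\<lambda>\<xi>. gauss (d *\<^sub>R \<xi>) *\<^sub>R fourier (-1) (trunc R f) \<xi>) x)
      \<longlongrightarrow> (2 * pi) ^ CARD('m) *\<^sub>R gauss_mean d f x) at_top"
    using fourier_gauss_fourier[OF _ trunc(1) d, of "-1"] by simp
qed

lemma fourier_inversion:
  fixes f :: "(real, 'm::finite) vec \<Rightarrow> 'm clif"
  assumes f: "L2 f" "isCont f y" and g: "is_fourier_L2 f g" "integrable lborel g"
  shows "f y = (1 / (2 * pi) ^ CARD('m)) *\<^sub>R fourier 1 g y"
proof -
  note [measurable] = borel_measurable_integrable[OF g(2)]
  have "(\<lambda>n. fourier 1 (\<lambda>\<xi>. gauss ((1 / real (Suc n)) *\<^sub>R \<xi>) *\<^sub>R g \<xi>) y) \<longlonglongrightarrow> fourier 1 (\<lambda>\<xi>. 1 *\<^sub>R g \<xi>) y"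
    unfolding fourier_def
  proof (rule integral_dominated_convergence[where w="\<lambda>\<xi>. norm (g \<xi>)"])
    show "AE \<xi> in lborel. (\<lambda>n. cscale (cis (1 * (\<xi> \<bullet> y))) (gauss ((1 / real (Suc n)) *\<^sub>R \<xi>) *\<^sub>R g \<xi>))
        \<longlonglongrightarrow> cscale (cis (1 * (\<xi> \<bullet> y))) (1 *\<^sub>R g \<xi>)"
      by (intro AE_I2 bounded_linear.tendsto[OF bounded_linear_cscale_right] tendsto_scaleR tendsto_const
          gauss_scaled_tendsto)
    show "AE \<xi> in lborel. norm (cscale (cis (1 * (\<xi> \<bullet> y))) (gauss ((1 / real (Suc n)) *\<^sub>R \<xi>) *\<^sub>R g \<xi>))
        \<le> norm (g \<xi>)" for n
      by (simp add: mult_left_le_one_le gauss_le_1)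
  qed (use g(2) in auto)
  then have "(\<lambda>n. (2 * pi) ^ CARD('m) *\<^sub>R gauss_mean (1 / real (Suc n)) f y) \<longlonglongrightarrow> fourier 1 g y"
    by (subst (asm) fourier_gauss_fourier_L2[OF f(1) g(1)]) simp_all
  moreover have "(\<lambda>n. (2 * pi) ^ CARD('m) *\<^sub>R gauss_mean (1 / real (Suc n)) f y) \<longlonglongrightarrow> (2 * pi) ^ CARD('m) *\<^sub>R f y"
    by (intro tendsto_scaleR tendsto_const gauss_mean_tendsto_L2 f)
  ultimately have f_scaled: "(2 * pi) ^ CARD('m) *\<^sub>R f y = fourier 1 g y" using LIMSEQ_unique by blast
  then show ?thesis by (simp flip: f_scaled)
qed

section \<open>Monogenic functions on slabs\<close>

definition monogenic_derivative ::
  "(real \<times> (real, 'm::{finite,linorder}) vec) set \<Rightarrow> (real \<times> (real, 'm) vec \<Rightarrow> 'm clif) \<Rightarrow>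
    (real \<times> (real, 'm) vec \<Rightarrow> real \<times> (real, 'm) vec \<Rightarrow> 'm clif) \<Rightarrow> bool" where
  "monogenic_derivative \<Omega> F D \<longleftrightarrow> open \<Omega> \<and> (\<forall>x\<in>\<Omega>. (F has_derivative D x) (at x)) \<and>
    continuous_on \<Omega> (\<lambda>x. D x (1, 0)) \<and> (\<forall>k. continuous_on \<Omega> (\<lambda>x. D x (0, axis k 1))) \<and>
    (\<forall>x\<in>\<Omega>. D x (1, 0) + (\<Sum>k\<in>UNIV. clif_mult (clif_gen k) (D x (0, axis k 1))) = 0)"

lemma left_monogenic_iff: "left_monogenic \<Omega> F \<longleftrightarrow> (\<exists>D. monogenic_derivative \<Omega> F D)"
proof
  assume F: "left_monogenic \<Omega> F"
  then have "(F has_derivative frechet_derivative F (at x)) (at x)" if "x \<in> \<Omega>" for x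
    using that unfolding left_monogenic_def by (simp add: frechet_derivative_works)
  then have "monogenic_derivative \<Omega> F (\<lambda>x. frechet_derivative F (at x))"
    using F unfolding left_monogenic_def monogenic_derivative_def pd0_def[abs_def] pdk_def[abs_def] by auto
  then show "\<exists>D. monogenic_derivative \<Omega> F D" by blast
next
  assume "\<exists>D. monogenic_derivative \<Omega> F D"
  then obtain D where D: "monogenic_derivative \<Omega> F D" ..
  have frechet: "frechet_derivative F (at x) = D x" if "x \<in> \<Omega>" for x
    using D that frechet_derivative_at[of F "D x" x] by (simp add: monogenic_derivative_def)
  have "continuous_on \<Omega> (pd0 F)"
    by (rule continuous_on_eq[of _ "\<lambda>x. D x (1, 0)"]) (use D in \<open>auto simp: monogenic_derivative_def pd0_def frechet\<close>)
  moreover have "continuous_on \<Omega> (pdk F k)" for k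
    by (rule continuous_on_eq[of _ "\<lambda>x. D x (0, axis k 1)"])
       (use D in \<open>auto simp: monogenic_derivative_def pdk_def frechet\<close>)
  ultimately show "left_monogenic \<Omega> F"
    using D unfolding left_monogenic_def monogenic_derivative_def
    by (auto simp: pd0_def pdk_def frechet differentiable_def)
qed

lemma left_monogenic_add:
  assumes "left_monogenic \<Omega> F" "left_monogenic \<Omega> G" shows "left_monogenic \<Omega> (\<lambda>x. F x + G x)"
proof -
  from assms obtain D E where D: "monogenic_derivative \<Omega> F D" and E: "monogenic_derivative \<Omega> G E"
    unfolding left_monogenic_iff by blast
  have "D x (1, 0) + E x (1, 0) + (\<Sum>k\<in>UNIV. clif_mult (clif_gen k) (D x (0, axis k 1) + E x (0, axis k 1))) = 0"
    if "x \<in> \<Omega>" for x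
  proof -
    have "(D x (1, 0) + (\<Sum>k\<in>UNIV. clif_mult (clif_gen k) (D x (0, axis k 1)))) +
        (E x (1, 0) + (\<Sum>k\<in>UNIV. clif_mult (clif_gen k) (E x (0, axis k 1)))) = 0"
      using D E that by (simp add: monogenic_derivative_def)
    then show ?thesis by (simp add: clif_mult_add_right sum.distrib add_ac)
  qed
  then have "monogenic_derivative \<Omega> (\<lambda>x. F x + G x) (\<lambda>x v. D x v + E x v)"
    using D E unfolding monogenic_derivative_def by (auto intro!: has_derivative_add continuous_on_add)
  then show ?thesis unfolding left_monogenic_iff by blast
qed

lemma left_monogenic_scaleR:
  assumes "left_monogenic \<Omega> F" shows "left_monogenic \<Omega> (\<lambda>x. c *\<^sub>R F x)"
proof -
  from assms obtain D where D: "monogenic_derivative \<Omega> F D"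
    unfolding left_monogenic_iff ..
  then have "monogenic_derivative \<Omega> (\<lambda>x. c *\<^sub>R F x) (\<lambda>x v. c *\<^sub>R D x v)"
    unfolding monogenic_derivative_def
    by (auto intro!: has_derivative_scaleR_right continuous_intros
        simp: clif_mult_scaleR_right scaleR_sum_right[symmetric] scaleR_right_distrib[symmetric])
  then show ?thesis unfolding left_monogenic_iff by blast
qed

lemma left_monogenic_subset:
  "left_monogenic \<Omega> F \<Longrightarrow> open \<Omega>' \<Longrightarrow> \<Omega>' \<subseteq> \<Omega> \<Longrightarrow> left_monogenic \<Omega>' F"
  unfolding left_monogenic_def by (blast intro: continuous_on_subset)

lemma left_monogenic_cong:
  assumes "left_monogenic \<Omega> F" "\<And>x. x \<in> \<Omega> \<Longrightarrow> G x = F x" shows "left_monogenic \<Omega> G"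
proof -
  from assms(1) obtain D where D: "monogenic_derivative \<Omega> F D"
    unfolding left_monogenic_iff ..
  have "(G has_derivative D x) (at x)" if "x \<in> \<Omega>" for x
    using D that assms(2) has_derivative_transform_within_open[of F "D x" x UNIV \<Omega> G]
    by (simp add: monogenic_derivative_def)
  then have "monogenic_derivative \<Omega> G D" using D by (simp add: monogenic_derivative_def)
  then show ?thesis unfolding left_monogenic_iff by blast
qed

lemma left_monogenic_Un:
  assumes "left_monogenic \<Omega> F" "left_monogenic \<Omega>' F" shows "left_monogenic (\<Omega> \<union> \<Omega>') F"
  using assms unfolding left_monogenic_def
  by (auto intro!: continuous_on_open_Un open_Un)

lemma left_monogenic_continuous: "left_monogenic \<Omega> F \<Longrightarrow> continuous_on \<Omega> F"
  unfolding left_monogenic_def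
  by (intro continuous_at_imp_continuous_on ballI differentiable_imp_continuous_within) auto

definition slab :: "real set \<Rightarrow> (real \<times> (real, 'm::finite) vec) set" where
  "slab A = A \<times> UNIV"

lemma slab_iff [simp]: "(t, y) \<in> slab A \<longleftrightarrow> t \<in> A"
  by (simp add: slab_def)

lemma fst_slab [simp]: "fst ` slab A = A"
  by (simp add: slab_def)

lemma open_slab: "open A \<Longrightarrow> open (slab A)"
  by (simp add: slab_def open_Times)

lemma strip_slab: "strip a = slab {-a<..<a}"
  and halfplus_slab: "halfplus a = slab {-a<..}"
  and halfminus_slab: "halfminus a = slab {..<a}"
  by (auto simp: strip_def halfplus_def halfminus_def slab_def)

lemma continuous_on_slice:
  assumes "continuous_on (slab A) F" "t \<in> A" shows "continuous_on UNIV (\<lambda>y. F (t, y))"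
  by (rule continuous_on_compose2[OF assms(1)]) (use assms(2) in \<open>auto intro!: continuous_intros\<close>)

definition L2_slices :: "real set \<Rightarrow> (real \<times> 'a::euclidean_space \<Rightarrow> 'b::euclidean_space) \<Rightarrow> real \<Rightarrow> bool" where
  "L2_slices A F M \<longleftrightarrow> (\<forall>t\<in>A. L2 (\<lambda>y. F (t, y)) \<and> l2 (\<lambda>y. F (t, y)) \<le> M)"

lemma L2_slicesD:
  assumes "L2_slices A F M" "t \<in> A" shows "L2 (\<lambda>y. F (t, y))" "l2 (\<lambda>y. F (t, y)) \<le> M"
  using assms by (simp_all add: L2_slices_def)

lemma L2_slices_subset: "L2_slices A F M \<Longrightarrow> B \<subseteq> A \<Longrightarrow> L2_slices B F M"
  by (auto simp: L2_slices_def)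

lemma L2_slices_add:
  assumes "L2_slices A F M" "L2_slices A G N" shows "L2_slices A (\<lambda>x. F x + G x) (M + N)"
  unfolding L2_slices_def
proof (intro ballI conjI)
  fix t assume t: "t \<in> A"
  note slices = L2_slicesD[OF assms(1) t] L2_slicesD[OF assms(2) t]
  show "L2 (\<lambda>y. F (t, y) + G (t, y))" by (intro L2_add slices)
  show "l2 (\<lambda>y. F (t, y) + G (t, y)) \<le> M + N"
    using l2_triangle[OF slices(1,3)] slices(2,4) by linarith
qed

lemma H2_slab_iff: "H2 (slab A) F \<longleftrightarrow> left_monogenic (slab A) F \<and> (\<exists>M. L2_slices A F M)"
proof (cases "left_monogenic (slab A) F")
  case True
  let ?N = "\<lambda>t. \<integral>\<^sup>+ y. ennreal ((norm (F (t, y)))\<^sup>2) \<partial>lborel"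
  have slice_measurable: "(\<lambda>y. F (t, y)) \<in> borel_measurable borel" if "t \<in> A" for t
    by (rule borel_measurable_continuous_onI[OF continuous_on_slice[OF left_monogenic_continuous[OF True] that]])
  have "(SUP t\<in>A. ?N t) < \<infinity> \<longleftrightarrow> (\<exists>M. L2_slices A F M)"
  proof
    assume finite: "(SUP t\<in>A. ?N t) < \<infinity>"
    define M where "M = sqrt (enn2real (SUP t\<in>A. ?N t))"
    have M: "0 \<le> M" "ennreal (M\<^sup>2) = (SUP t\<in>A. ?N t)" using finite by (auto simp: M_def)
    have "?N t \<le> ennreal (M\<^sup>2)" if "t \<in> A" for t
      unfolding M(2) by (rule SUP_upper[OF that])
    then have "L2_slices A F M"
      unfolding L2_slices_def using L2_nn_integralI[OF slice_measurable _ M(1)] by simp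
    then show "\<exists>M. L2_slices A F M" ..
  next
    assume "\<exists>M. L2_slices A F M"
    then obtain M where M: "L2_slices A F M" ..
    have "(SUP t\<in>A. ?N t) \<le> ennreal (M\<^sup>2)"
      using L2_slicesD[OF M] by (intro SUP_least) (simp add: nn_integral_L2 ennreal_leI power_mono)
    then show "(SUP t\<in>A. ?N t) < \<infinity>" by (rule order_le_less_trans) simp
  qed
  then show ?thesis using True by (simp add: H2_def)
qed (simp add: H2_def)

lemma H2_slab_add: "H2 (slab A) F \<Longrightarrow> H2 (slab A) G \<Longrightarrow> H2 (slab A) (\<lambda>x. F x + G x)"
  unfolding H2_slab_iff by (blast intro: left_monogenic_add L2_slices_add)

lemma H2_slab_uminus: "H2 (slab A) F \<Longrightarrow> H2 (slab A) (\<lambda>x. - F x)"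
  using left_monogenic_scaleR[of "slab A" F "-1"] by (simp add: H2_def)

lemma H2_slab_diff: "H2 (slab A) F \<Longrightarrow> H2 (slab A) G \<Longrightarrow> H2 (slab A) (\<lambda>x. F x - G x)"
  using H2_slab_add[of A F "\<lambda>x. - G x"] H2_slab_uminus[of A G] by simp

lemma H2_slab_subset: "H2 (slab A) F \<Longrightarrow> open B \<Longrightarrow> B \<subseteq> A \<Longrightarrow> H2 (slab B) F"
  unfolding H2_slab_iff using left_monogenic_subset[of "slab A" F "slab B"]
  by (auto simp: slab_def open_Times intro: L2_slices_subset)

lemma H2_slab_cong:
  assumes "H2 (slab A) F" "\<And>x. x \<in> slab A \<Longrightarrow> G x = F x" shows "H2 (slab A) G"
proof -
  have "(\<lambda>y. G (t, y)) = (\<lambda>y. F (t, y))" if "t \<in> A" for t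
    using that by (intro ext assms(2)) simp
  then have "L2_slices A G M \<longleftrightarrow> L2_slices A F M" for M by (simp add: L2_slices_def)
  then show ?thesis using assms left_monogenic_cong[of "slab A" F G] by (simp add: H2_slab_iff)
qed

section \<open>Functions with an exponential weight\<close>

definition exp_weight :: "real \<Rightarrow> ('a::real_normed_vector \<Rightarrow> 'b::real_vector) \<Rightarrow> 'a \<Rightarrow> 'b" where
  "exp_weight a g \<xi> = exp (a * norm \<xi>) *\<^sub>R g \<xi>"

lemma exp_weight_0 [simp]: "exp_weight 0 g = g"
  by (simp add: fun_eq_iff exp_weight_def)

lemma exp_weight_exp_weight [simp]: "exp_weight a (exp_weight b g) = exp_weight (a + b) g"
  by (simp add: fun_eq_iff exp_weight_def mult_exp_exp distrib_right)

lemma exp_weight_measurable [measurable]: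
  fixes g :: "'a::euclidean_space \<Rightarrow> 'b::euclidean_space"
  assumes [measurable]: "g \<in> borel_measurable borel" shows "exp_weight a g \<in> borel_measurable borel"
  unfolding exp_weight_def[abs_def] by measurable

lemma L2_exp_weight_measurable:
  fixes g :: "'a::euclidean_space \<Rightarrow> 'b::euclidean_space"
  assumes "L2 (exp_weight a g)" shows "g \<in> borel_measurable borel"
  using exp_weight_measurable[OF L2_measurable[OF assms], of "- a"] by simp

lemma integrable_exp_neg_abs:
  assumes "c > 0" shows "integrable lborel (\<lambda>x::real. exp (- c * \<bar>x\<bar>))"
proof -
  interpret prob_space "density lborel (exponential_density c)"
    by (rule prob_space_exponential_density[OF assms])
  have "(\<integral>\<^sup>+x. ennreal (exponential_density c x) \<partial>lborel) = 1"
    using emeasure_space_1 by (simp add: emeasure_density)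
  then have "integrable lborel (exponential_density c)"
    unfolding integrable_iff_bounded using assms by simp
  then have "integrable lborel (\<lambda>x. (1 / c) *\<^sub>R exponential_density c x)" by simp
  also have "(\<lambda>x. (1 / c) *\<^sub>R exponential_density c x) = (\<lambda>x::real. indicator {0..} x *\<^sub>R exp (- c * \<bar>x\<bar>))"
    using assms by (auto simp: exponential_density_def indicator_def)
  finally show ?thesis
    using has_bochner_integral_even_function[of "\<lambda>x. exp (- c * \<bar>x\<bar>)"]
    by (auto simp: has_bochner_integral_iff)
qed

lemma integrable_exp_neg_norm:
  assumes "c > 0" shows "integrable lborel (\<lambda>x::'a::euclidean_space. exp (- c * norm x))"
proof (rule Bochner_Integration.integrable_bound)
  define d where "d = c / DIM('a)"
  have d: "d > 0" using assms by (simp add: d_def)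
  show "integrable lborel (\<lambda>x::'a. \<Prod>b\<in>Basis. exp (- d * \<bar>x \<bullet> b\<bar>))"
    by (intro lborel_prod_Basis(1) integrable_exp_neg_abs d)
  show "AE x::'a in lborel. norm (exp (- c * norm x)) \<le> norm (\<Prod>b\<in>Basis. exp (- d * \<bar>x \<bullet> b\<bar>))"
  proof (rule AE_I2)
    fix x :: 'a
    have "(\<Sum>b\<in>Basis. \<bar>x \<bullet> b\<bar>) \<le> DIM('a) * norm x"
      using sum_mono[of Basis "\<lambda>b. \<bar>x \<bullet> b\<bar>" "\<lambda>_. norm x"] by (simp add: Basis_le_norm)
    then have "d * (\<Sum>b\<in>Basis. \<bar>x \<bullet> b\<bar>) \<le> d * (DIM('a) * norm x)" using d by simp
    also have "\<dots> = c * norm x" by (simp add: d_def)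
    finally show "norm (exp (- c * norm x)) \<le> norm (\<Prod>b\<in>Basis. exp (- d * \<bar>x \<bullet> b\<bar>))"
      by (simp add: exp_sum[symmetric] sum_distrib_left sum_negf)
  qed
qed simp

lemma L2_exp_neg_norm:
  assumes "c > 0" shows "L2 (\<lambda>x::'a::euclidean_space. exp (- c * norm x))"
proof -
  have "(norm (exp (- c * norm x)))\<^sup>2 = exp (- (2 * c) * norm x)" for x :: 'a
    by (simp add: power2_eq_square mult_exp_exp)
  then show ?thesis using integrable_exp_neg_norm[of "2 * c", where 'a='a] assms by (simp add: L2_def)
qed

lemma exp_weight_integrable:
  fixes g :: "'a::euclidean_space \<Rightarrow> 'b::euclidean_space"
  assumes "L2 (exp_weight a g)" "b < a" shows "integrable lborel (exp_weight b g)"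
proof -
  have "integrable lborel (\<lambda>\<xi>. exp (- (a - b) * norm \<xi>) *\<^sub>R exp_weight a g \<xi>)"
    using assms by (intro L2_bilinear(1)[OF bounded_bilinear_scaleR _ L2_exp_neg_norm, where K=1]) auto
  also have "(\<lambda>\<xi>. exp (- (a - b) * norm \<xi>) *\<^sub>R exp_weight a g \<xi>) = exp_weight (- (a - b)) (exp_weight a g)"
    by (intro ext) (simp only: exp_weight_def)
  finally show ?thesis by simp
qed

lemma L2_exp_weight_mono:
  fixes g :: "'a::euclidean_space \<Rightarrow> 'b::euclidean_space" and h :: "'a \<Rightarrow> 'c::euclidean_space"
  assumes g: "L2 (exp_weight a g)" and "b \<le> a" "h \<in> borel_measurable borel" "\<And>\<xi>. norm (h \<xi>) \<le> norm (g \<xi>)"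
  shows "L2 (exp_weight b h)" "l2 (exp_weight b h) \<le> l2 (exp_weight a g)"
proof -
  have "norm (exp_weight b h \<xi>) \<le> 1 * norm (exp_weight a g \<xi>)" for \<xi>
    unfolding exp_weight_def using assms(2,4) by (auto intro!: mult_mono mult_right_mono)
  then have "AE \<xi> in lborel. norm (exp_weight b h \<xi>) \<le> 1 * norm (exp_weight a g \<xi>)" by simp
  from L2_dominated[OF g exp_weight_measurable[OF assms(3)] this]
  show "L2 (exp_weight b h)" "l2 (exp_weight b h) \<le> l2 (exp_weight a g)" by simp_all
qed

lemma L2_exp_weight_times_norm:
  fixes g :: "'a::euclidean_space \<Rightarrow> 'b::euclidean_space" and h :: "'a \<Rightarrow> 'c::euclidean_space"
  assumes g: "L2 (exp_weight a g)" and "b < a" "h \<in> borel_measurable borel" "\<And>\<xi>. norm (h \<xi>) \<le> norm \<xi> * norm (g \<xi>)"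
  shows "L2 (exp_weight b h)"
proof (rule L2_dominated(1)[OF g exp_weight_measurable[OF assms(3)]])
  show "AE \<xi> in lborel. norm (exp_weight b h \<xi>) \<le> (1 / (a - b)) * norm (exp_weight a g \<xi>)"
  proof (rule AE_I2)
    fix \<xi> :: 'a
    have "(a - b) * norm \<xi> \<le> exp ((a - b) * norm \<xi>)"
      using exp_ge_add_one_self[of "(a - b) * norm \<xi>"] by linarith
    then have "norm \<xi> \<le> exp ((a - b) * norm \<xi>) / (a - b)" using assms(2) by (simp add: field_simps)
    then have "exp (b * norm \<xi>) * norm (h \<xi>) \<le> exp (b * norm \<xi>) * (exp ((a - b) * norm \<xi>) / (a - b) * norm (g \<xi>))"
      by (intro mult_left_mono order_trans[OF assms(4)] mult_right_mono) auto
    also have "\<dots> = (1 / (a - b)) * (exp (a * norm \<xi>) * norm (g \<xi>))"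
      by (simp add: mult_exp_exp left_diff_distrib flip: mult.assoc)
    finally show "norm (exp_weight b h \<xi>) \<le> (1 / (a - b)) * norm (exp_weight a g \<xi>)"
      by (simp add: exp_weight_def)
  qed
  show "0 \<le> 1 / (a - b)" using assms(2) by simp
qed

section \<open>Extensions to half spaces\<close>

lemma integral_dominated_convergence_at:
  fixes f :: "'a::first_countable_topology \<Rightarrow> 'b \<Rightarrow> 'c::{banach, second_countable_topology}"
  assumes f: "\<forall>\<^sub>F y in at x. f y \<in> borel_measurable M" and g: "g \<in> borel_measurable M"
    and w: "integrable M w" "\<forall>\<^sub>F y in at x. AE \<omega> in M. norm (f y \<omega>) \<le> w \<omega>"
    and f_tendsto: "AE \<omega> in M. ((\<lambda>y. f y \<omega>) \<longlongrightarrow> g \<omega>) (at x)"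
  shows "((\<lambda>y. integral\<^sup>L M (f y)) \<longlongrightarrow> integral\<^sup>L M g) (at x)"
  unfolding tendsto_at_iff_sequentially o_def
proof (intro allI impI)
  fix X assume "\<forall>i. X i \<in> UNIV - {x}" "X \<longlonglongrightarrow> x"
  then have X_tendsto: "filterlim X (at x) sequentially" by (simp add: filterlim_at)
  have "\<forall>\<^sub>F i in sequentially. f (X i) \<in> borel_measurable M \<and> (AE \<omega> in M. norm (f (X i) \<omega>) \<le> w \<omega>)"
    using eventually_conj[OF f w(2)] X_tendsto by (rule eventually_compose_filterlim)
  then obtain N where N: "\<And>i. i \<ge> N \<Longrightarrow> f (X i) \<in> borel_measurable M" "\<And>i. i \<ge> N \<Longrightarrow> AE \<omega> in M. norm (f (X i) \<omega>) \<le> w \<omega>"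
    by (auto simp: eventually_sequentially)
  show "(\<lambda>i. integral\<^sup>L M (f (X i))) \<longlonglongrightarrow> integral\<^sup>L M g"
  proof (rule LIMSEQ_offset[of _ N], rule integral_dominated_convergence[OF g _ w(1)])
    show "AE \<omega> in M. (\<lambda>i. f (X (i + N)) \<omega>) \<longlonglongrightarrow> g \<omega>"
      using f_tendsto by eventually_elim (rule LIMSEQ_ignore_initial_segment[OF filterlim_compose[OF _ X_tendsto]])
  qed (use N in auto)
qed

lemma bounded_linear_integral:
  fixes F :: "'b \<Rightarrow> 'x::real_normed_vector \<Rightarrow> 'c::{banach,second_countable_topology}"
  assumes linear: "\<And>\<omega>. bounded_linear (F \<omega>)" and integrable: "\<And>v. integrable M (\<lambda>\<omega>. F \<omega> v)"
    and B: "integrable M B" "\<And>\<omega> v. norm (F \<omega> v) \<le> B \<omega> * norm v"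
  shows "bounded_linear (\<lambda>v. \<integral>\<omega>. F \<omega> v \<partial>M)"
proof (rule bounded_linear_intro[where K="\<integral>\<omega>. B \<omega> \<partial>M"])
  show "(\<integral>\<omega>. F \<omega> (u + v) \<partial>M) = (\<integral>\<omega>. F \<omega> u \<partial>M) + (\<integral>\<omega>. F \<omega> v \<partial>M)" for u v
    using integrable by (simp add: linear_simps(1)[OF linear])
  show "(\<integral>\<omega>. F \<omega> (c *\<^sub>R v) \<partial>M) = c *\<^sub>R (\<integral>\<omega>. F \<omega> v \<partial>M)" for c v
    by (simp add: linear_simps(5)[OF linear])
  have "norm (\<integral>\<omega>. F \<omega> v \<partial>M) \<le> (\<integral>\<omega>. B \<omega> * norm v \<partial>M)" for v
    by (rule order_trans[OF integral_norm_bound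
          integral_mono[OF integrable_norm[OF integrable] integrable_mult_left[OF B(1)] B(2)]])
  then show "norm (\<integral>\<omega>. F \<omega> v \<partial>M) \<le> norm v * (\<integral>\<omega>. B \<omega> \<partial>M)" for v
    by (simp add: mult.commute)
qed

lemma has_derivative_remainder_le:
  fixes f :: "'a::real_normed_vector \<Rightarrow> 'b::real_normed_vector"
  assumes f: "\<And>y. y \<in> ball x r \<Longrightarrow> (f has_derivative f' y) (at y)"
    and f'_onorm: "\<And>y. y \<in> ball x r \<Longrightarrow> onorm (f' y) \<le> B" and h: "x + h \<in> ball x r"
  shows "norm (f (x + h) - f x - f' x h) \<le> 2 * B * norm h"
proof -
  have "0 < r" using le_less_trans[OF zero_le_dist] h unfolding mem_ball by blast
  then have x: "x \<in> ball x r" by simp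
  have "norm (f (x + h) - f x) \<le> B * norm (x + h - x)"
    by (rule differentiable_bound[of "ball x r" f f'])
      (use h x in \<open>auto intro!: f'_onorm has_derivative_at_withinI[OF f] simp del: mem_ball\<close>)
  moreover have "norm (f' x h) \<le> B * norm h"
    by (rule order_trans[OF onorm[OF has_derivative_bounded_linear[OF f[OF x]]]
        mult_right_mono[OF f'_onorm[OF x]]]) simp
  ultimately show ?thesis
    using norm_triangle_ineq4[of "f (x + h) - f x" "f' x h"] by simp
qed

lemma integral_div_norm_tendsto_0:
  fixes R :: "'x::real_normed_vector \<Rightarrow> 'b \<Rightarrow> 'c::{banach,second_countable_topology}"
  assumes R_integrable: "\<forall>\<^sub>F h in at 0. integrable M (R h)"
    and R_le: "\<forall>\<^sub>F h in at 0. \<forall>\<omega>. norm (R h \<omega>) \<le> B \<omega> * norm h" and B: "integrable M B"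
    and R_tendsto: "\<And>\<omega>. ((\<lambda>h. norm (R h \<omega>) / norm h) \<longlongrightarrow> 0) (at 0)"
  shows "((\<lambda>h. norm (\<integral>\<omega>. R h \<omega> \<partial>M) / norm h) \<longlongrightarrow> 0) (at 0)"
proof (rule Lim_null_comparison)
  show "\<forall>\<^sub>F h in at 0. norm (norm (\<integral>\<omega>. R h \<omega> \<partial>M) / norm h) \<le> (\<integral>\<omega>. norm (R h \<omega>) / norm h \<partial>M)"
    by (intro always_eventually allI) (simp add: divide_right_mono integral_norm_bound)
  have "((\<lambda>h. \<integral>\<omega>. norm (R h \<omega>) / norm h \<partial>M) \<longlongrightarrow> (\<integral>\<omega>. 0 \<partial>M)) (at 0)"
  proof (rule integral_dominated_convergence_at[OF _ _ B])
    show "\<forall>\<^sub>F h in at 0. (\<lambda>\<omega>. norm (R h \<omega>) / norm h) \<in> borel_measurable M"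
      using R_integrable by eventually_elim simp
    show "\<forall>\<^sub>F h in at 0. AE \<omega> in M. norm (norm (R h \<omega>) / norm h) \<le> B \<omega>"
      using R_le eventually_neq_at_within[of 0 0] by eventually_elim (simp add: divide_le_eq)
  qed (simp_all add: R_tendsto)
  then show "((\<lambda>h. \<integral>\<omega>. norm (R h \<omega>) / norm h \<partial>M) \<longlongrightarrow> 0) (at 0)" by simp
qed

lemma has_derivative_integral:
  fixes f :: "'x::real_normed_vector \<Rightarrow> 'b \<Rightarrow> 'c::{banach,second_countable_topology}"
  assumes r_pos: "r > 0"
    and f: "\<And>y. y \<in> ball x r \<Longrightarrow> integrable M (f y)"
    and F: "\<And>y \<omega>. y \<in> ball x r \<Longrightarrow> ((\<lambda>y. f y \<omega>) has_derivative F y \<omega>) (at y)"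
    and F_onorm: "\<And>y \<omega>. y \<in> ball x r \<Longrightarrow> onorm (F y \<omega>) \<le> B \<omega>"
    and B: "integrable M B"
    and F_integrable: "\<And>v. integrable M (\<lambda>\<omega>. F x \<omega> v)"
  shows "((\<lambda>y. \<integral>\<omega>. f y \<omega> \<partial>M) has_derivative (\<lambda>v. \<integral>\<omega>. F x \<omega> v \<partial>M)) (at x)"
  unfolding has_derivative_at
proof
  have x_in_ball: "x \<in> ball x r" using r_pos by simp
  have linear_F: "bounded_linear (F x \<omega>)" for \<omega>
    using F[OF x_in_ball] by (rule has_derivative_bounded_linear)
  have F_le: "norm (F x \<omega> v) \<le> B \<omega> * norm v" for v \<omega>
    by (rule order_trans[OF onorm[OF linear_F] mult_right_mono[OF F_onorm[OF x_in_ball]]]) simp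
  show "bounded_linear (\<lambda>v. \<integral>\<omega>. F x \<omega> v \<partial>M)"
    by (rule bounded_linear_integral[OF linear_F F_integrable B F_le])
  define R where "R h \<omega> = f (x + h) \<omega> - f x \<omega> - F x \<omega> h" for h \<omega>
  have eventually_in_ball: "\<forall>\<^sub>F h in at 0. x + h \<in> ball x r"
    using eventually_at_ball[OF r_pos, of 0 UNIV] by eventually_elim (simp add: dist_norm)
  have "((\<lambda>h. norm (\<integral>\<omega>. R h \<omega> \<partial>M) / norm h) \<longlongrightarrow> 0) (at 0)"
  proof (rule integral_div_norm_tendsto_0[OF _ _ integrable_mult_right[OF B, of 2]])
    show "\<forall>\<^sub>F h in at 0. integrable M (R h)"
      using eventually_in_ball unfolding R_def
      by eventually_elim (intro Bochner_Integration.integrable_diff f x_in_ball F_integrable)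
    show "\<forall>\<^sub>F h in at 0. \<forall>\<omega>. norm (R h \<omega>) \<le> 2 * B \<omega> * norm h"
      using eventually_in_ball unfolding R_def
      by eventually_elim (intro allI has_derivative_remainder_le[OF F F_onorm])
    show "((\<lambda>h. norm (R h \<omega>) / norm h) \<longlongrightarrow> 0) (at 0)" for \<omega>
      using F[OF x_in_ball, of \<omega>] unfolding has_derivative_at R_def by simp
  qed
  moreover have "\<forall>\<^sub>F h in at 0. (\<integral>\<omega>. R h \<omega> \<partial>M) = (\<integral>\<omega>. f (x + h) \<omega> \<partial>M) - (\<integral>\<omega>. f x \<omega> \<partial>M) - (\<integral>\<omega>. F x \<omega> h \<partial>M)"
    using eventually_in_ball unfolding R_def by eventually_elim (simp add: f[OF x_in_ball] f F_integrable del: mem_ball)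
  ultimately show "((\<lambda>h. norm ((\<integral>\<omega>. f (x + h) \<omega> \<partial>M) - (\<integral>\<omega>. f x \<omega> \<partial>M) - (\<integral>\<omega>. F x \<omega> h \<partial>M)) / norm h) \<longlongrightarrow> 0) (at 0)"
    by (rule Lim_transform_eventually[OF _ eventually_mono]) simp
qed

text \<open>For \<^term>\<open>\<sigma> = (1::real)\<close> and \<^term>\<open>\<sigma> = (-1::real)\<close> the function \<^term>\<open>\<lambda>x. exp (phase \<sigma> \<xi> x)\<close> is the scalar factor of
  the kernels e^+ and e^-.\<close>

definition phase :: "real \<Rightarrow> (real, 'm::finite) vec \<Rightarrow> real \<times> (real, 'm) vec \<Rightarrow> complex" where
  "phase \<sigma> \<xi> x = complex_of_real (- \<sigma> * fst x * norm \<xi>) + \<i> * complex_of_real (snd x \<bullet> \<xi>)"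

definition half_ext :: "real \<Rightarrow> ((real, 'm::finite) vec \<Rightarrow> 'm clif) \<Rightarrow> real \<times> (real, 'm) vec \<Rightarrow> 'm clif" where
  "half_ext \<sigma> w x = (1 / (2 * pi) ^ CARD('m)) *\<^sub>R (\<integral>\<xi>. cscale (exp (phase \<sigma> \<xi> x)) (w \<xi>) \<partial>lborel)"

lemma bounded_linear_phase: "bounded_linear (phase \<sigma> \<xi>)"
  unfolding linear_conv_bounded_linear[symmetric]
  by (rule linearI) (simp_all add: phase_def algebra_simps scaleR_conv_of_real[of _ "_::complex"])

lemma phase_time: "phase \<sigma> \<xi> (1, 0) = complex_of_real (- \<sigma> * norm \<xi>)"
  and phase_axis: "phase \<sigma> \<xi> (0, axis k 1) = \<i> * complex_of_real (\<xi> $ k)"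
  by (simp_all add: phase_def inner_axis')

lemma phase_measurable [measurable]: "(\<lambda>\<xi>. phase \<sigma> \<xi> x) \<in> borel_measurable borel"
  unfolding phase_def by measurable

lemma cscale_exp_phase: "cscale (exp (phase \<sigma> \<xi> x)) (w \<xi>) = cscale (cis (snd x \<bullet> \<xi>)) (exp_weight (- \<sigma> * fst x) w \<xi>)"
  by (simp add: exp_weight_def phase_def exp_add cis_conv_exp exp_of_real[symmetric] cscale_of_real[symmetric]
      mult.commute
      del: of_real_mult of_real_minus)

lemma norm_exp_phase: "norm (exp (phase \<sigma> \<xi> x)) = exp (- \<sigma> * fst x * norm \<xi>)"
  by (simp add: phase_def norm_exp_eq_Re)

lemma norm_phase_le:
  assumes "\<bar>\<sigma>\<bar> = 1" shows "norm (phase \<sigma> \<xi> v) \<le> 2 * norm \<xi> * norm v"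
proof -
  have "norm (phase \<sigma> \<xi> v) \<le> \<bar>- \<sigma> * fst v * norm \<xi>\<bar> + \<bar>snd v \<bullet> \<xi>\<bar>"
    unfolding phase_def using norm_triangle_ineq[of "complex_of_real (- \<sigma> * fst v * norm \<xi>)"
        "\<i> * complex_of_real (snd v \<bullet> \<xi>)"]
    by (simp only: norm_of_real norm_mult norm_ii mult_1)
  also have "\<dots> \<le> norm (fst v) * norm \<xi> + norm (snd v) * norm \<xi>"
    using assms Cauchy_Schwarz_ineq2[of "snd v" \<xi>] by (simp add: abs_mult)
  also have "\<dots> \<le> norm v * norm \<xi> + norm v * norm \<xi>"
    using norm_fst_le[of "fst v" "snd v"] norm_snd_le[of "snd v" "fst v"] by (intro add_mono mult_right_mono) auto
  finally show ?thesis by (simp add: mult_ac)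
qed

lemma half_ext_integrable:
  fixes w :: "(real, 'm::finite) vec \<Rightarrow> 'm clif"
  assumes "L2 (exp_weight a w)" "- \<sigma> * fst x < a"
  shows "integrable lborel (\<lambda>\<xi>. cscale (exp (phase \<sigma> \<xi> x)) (w \<xi>))"
  unfolding cscale_exp_phase by (intro cscale_cis_integrable exp_weight_integrable[OF assms]) simp

lemma fst_ball_le:
  fixes x y :: "real \<times> 'a::real_normed_vector"
  assumes "\<bar>\<sigma>\<bar> = 1" "y \<in> ball x (b + \<sigma> * fst x)" shows "- \<sigma> * fst y < b"
proof -
  have "\<sigma> * (fst x - fst y) \<le> \<bar>fst x - fst y\<bar>"
    using abs_ge_self[of "\<sigma> * (fst x - fst y)"] assms(1) by (simp add: abs_mult)
  also have "\<dots> \<le> dist x y"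
    using norm_fst_le[of "fst (x - y)" "snd (x - y)"] unfolding prod.collapse by (simp add: dist_norm)
  also have "\<dots> < b + \<sigma> * fst x" using assms(2) by simp
  finally show ?thesis by (simp add: algebra_simps)
qed

lemma cscale_exp_phase_has_derivative:
  "((\<lambda>x. cscale (exp (phase \<sigma> \<xi> x)) z) has_derivative (\<lambda>v. cscale (exp (phase \<sigma> \<xi> x) * phase \<sigma> \<xi> v) z)) (at x)"
proof (rule bounded_linear.has_derivative[OF bounded_bilinear.bounded_linear_left[OF bounded_bilinear_cscale]])
  show "((\<lambda>x. exp (phase \<sigma> \<xi> x)) has_derivative (\<lambda>v. exp (phase \<sigma> \<xi> x) * phase \<sigma> \<xi> v)) (at x)"
    using DERIV_exp[unfolded has_field_derivative_def]
    by (rule has_derivative_compose[OF bounded_linear_imp_has_derivative[OF bounded_linear_phase]])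
qed

lemma norm_cscale_exp_phase_derivative_le:
  assumes "\<bar>\<sigma>\<bar> = 1" "- \<sigma> * fst x \<le> b"
  shows "norm (cscale (exp (phase \<sigma> \<xi> x) * phase \<sigma> \<xi> v) (w \<xi>))
    \<le> 2 * norm (exp_weight b (\<lambda>\<xi>. norm \<xi> *\<^sub>R w \<xi>) \<xi>) * norm v"
proof -
  have "norm (exp (phase \<sigma> \<xi> x)) \<le> exp (b * norm \<xi>)"
    unfolding norm_exp_phase exp_le_cancel_iff using assms(2) by (intro mult_right_mono) auto
  then have "norm (exp (phase \<sigma> \<xi> x)) * norm (phase \<sigma> \<xi> v) * norm (w \<xi>)
      \<le> exp (b * norm \<xi>) * (2 * norm \<xi> * norm v) * norm (w \<xi>)"
    by (intro mult_right_mono mult_mono norm_phase_le assms(1)) auto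
  then show ?thesis by (simp add: exp_weight_def norm_mult mult_ac)
qed

lemma half_ext_has_derivative:
  fixes w :: "(real, 'm::finite) vec \<Rightarrow> 'm clif"
  assumes w: "L2 (exp_weight a w)" and \<sigma>: "\<bar>\<sigma>\<bar> = 1" and fst_less: "- \<sigma> * fst x < a"
  shows "(half_ext \<sigma> w has_derivative (\<lambda>v. half_ext \<sigma> (\<lambda>\<xi>. cscale (phase \<sigma> \<xi> v) (w \<xi>)) x)) (at x)"
proof -
  note [measurable] = L2_exp_weight_measurable[OF w]
  obtain b where b: "- \<sigma> * fst x < b" "b < a" using dense[OF fst_less] by blast
  obtain b' where b': "b < b'" "b' < a" using dense[OF b(2)] by blast
  define B where "B \<xi> = 2 * norm (exp_weight b (\<lambda>\<xi>. norm \<xi> *\<^sub>R w \<xi>) \<xi>)" for \<xi>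
  have "L2 (exp_weight b' (\<lambda>\<xi>. norm \<xi> *\<^sub>R w \<xi>))"
    by (rule L2_exp_weight_times_norm[OF w b'(2)]) auto
  then have B_integrable: "integrable lborel B"
    unfolding B_def using exp_weight_integrable[OF _ b'(1)] by (intro integrable_mult_right integrable_norm)
  have radius_pos: "0 < b + \<sigma> * fst x" using b(1) by simp
  have dominated: "norm (cscale (exp (phase \<sigma> \<xi> y) * phase \<sigma> \<xi> v) (w \<xi>)) \<le> B \<xi> * norm v"
    if "y \<in> ball x (b + \<sigma> * fst x)" for y \<xi> v
    unfolding B_def using fst_ball_le[OF \<sigma> that] by (intro norm_cscale_exp_phase_derivative_le \<sigma>) simp
  have "((\<lambda>y. \<integral>\<xi>. cscale (exp (phase \<sigma> \<xi> y)) (w \<xi>) \<partial>lborel) has_derivative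
      (\<lambda>v. \<integral>\<xi>. cscale (exp (phase \<sigma> \<xi> x) * phase \<sigma> \<xi> v) (w \<xi>) \<partial>lborel)) (at x)"
  proof (rule has_derivative_integral[OF radius_pos _ _ _ B_integrable])
    show "onorm (\<lambda>v. cscale (exp (phase \<sigma> \<xi> y) * phase \<sigma> \<xi> v) (w \<xi>)) \<le> B \<xi>" if "y \<in> ball x (b + \<sigma> * fst x)" for y \<xi>
      by (rule onorm_bound[OF _ dominated[OF that]]) (simp add: B_def)
    show "integrable lborel (\<lambda>\<xi>. cscale (exp (phase \<sigma> \<xi> y)) (w \<xi>))" if "y \<in> ball x (b + \<sigma> * fst x)" for y
      using fst_ball_le[OF \<sigma> that] b(2) by (intro half_ext_integrable[OF w]) simp
    show "((\<lambda>y. cscale (exp (phase \<sigma> \<xi> y)) (w \<xi>)) has_derivative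
        (\<lambda>v. cscale (exp (phase \<sigma> \<xi> y) * phase \<sigma> \<xi> v) (w \<xi>))) (at y)" for y \<xi>
      by (rule cscale_exp_phase_has_derivative)
    show "integrable lborel (\<lambda>\<xi>. cscale (exp (phase \<sigma> \<xi> x) * phase \<sigma> \<xi> v) (w \<xi>))" for v
    proof (rule Bochner_Integration.integrable_bound[OF integrable_mult_left[OF B_integrable, of "norm v"]])
      show "AE \<xi> in lborel. norm (cscale (exp (phase \<sigma> \<xi> x) * phase \<sigma> \<xi> v) (w \<xi>)) \<le> norm (B \<xi> * norm v)"
        using radius_pos by (intro AE_I2 order_trans[OF dominated]) auto
    qed simp
  qed
  then show ?thesis
    unfolding half_ext_def[abs_def] by (intro has_derivative_scaleR_right) simp
qed

lemma half_ext_continuous_on: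
  fixes v w :: "(real, 'm::finite) vec \<Rightarrow> 'm clif"
  assumes w: "L2 (exp_weight a w)" and \<sigma>: "\<bar>\<sigma>\<bar> = 1"
    and v: "v \<in> borel_measurable borel" "\<And>\<xi>. norm (v \<xi>) \<le> norm \<xi> * norm (w \<xi>)"
  shows "continuous_on (slab {t. - a < \<sigma> * t}) (half_ext \<sigma> v)"
proof (rule continuous_at_imp_continuous_on, rule ballI)
  fix x :: "real \<times> (real, 'm) vec" assume "x \<in> slab {t. - a < \<sigma> * t}"
  then have "- \<sigma> * fst x < a" by (cases x) simp
  then obtain b where b: "- \<sigma> * fst x < b" "b < a" using dense by blast
  from half_ext_has_derivative[OF L2_exp_weight_times_norm[OF w b(2) v] \<sigma> b(1)]
  show "isCont (half_ext \<sigma> v) x" by (rule has_derivative_continuous)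
qed

lemma half_ext_add:
  assumes "integrable lborel (\<lambda>\<xi>. cscale (exp (phase \<sigma> \<xi> x)) (v \<xi>))"
    "integrable lborel (\<lambda>\<xi>. cscale (exp (phase \<sigma> \<xi> x)) (w \<xi>))"
  shows "half_ext \<sigma> (\<lambda>\<xi>. v \<xi> + w \<xi>) x = half_ext \<sigma> v x + half_ext \<sigma> w x"
  using assms by (simp add: half_ext_def cscale_add_right scaleR_right_distrib)

lemma half_ext_sum_clif_mult:
  assumes "\<And>i. i \<in> I \<Longrightarrow> integrable lborel (\<lambda>\<xi>. cscale (exp (phase \<sigma> \<xi> x)) (w i \<xi>))"
  shows "integrable lborel (\<lambda>\<xi>. cscale (exp (phase \<sigma> \<xi> x)) (\<Sum>i\<in>I. clif_mult (c i) (w i \<xi>)))"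
    and "half_ext \<sigma> (\<lambda>\<xi>. \<Sum>i\<in>I. clif_mult (c i) (w i \<xi>)) x = (\<Sum>i\<in>I. clif_mult (c i) (half_ext \<sigma> (w i) x))"
proof -
  have factor_out: "cscale (exp (phase \<sigma> \<xi> x)) (\<Sum>i\<in>I. clif_mult (c i) (w i \<xi>))
      = (\<Sum>i\<in>I. clif_mult (c i) (cscale (exp (phase \<sigma> \<xi> x)) (w i \<xi>)))" for \<xi>
    by (simp add: cscale_sum_right clif_mult_cscale_right)
  have summand_integrable: "integrable lborel (\<lambda>\<xi>. clif_mult (c i) (cscale (exp (phase \<sigma> \<xi> x)) (w i \<xi>)))"
    if "i \<in> I" for i
    by (rule integrable_bounded_linear[OF bounded_linear_clif_mult assms[OF that]])
  show "integrable lborel (\<lambda>\<xi>. cscale (exp (phase \<sigma> \<xi> x)) (\<Sum>i\<in>I. clif_mult (c i) (w i \<xi>)))"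
    unfolding factor_out by (rule Bochner_Integration.integrable_sum[OF summand_integrable])
  show "half_ext \<sigma> (\<lambda>\<xi>. \<Sum>i\<in>I. clif_mult (c i) (w i \<xi>)) x = (\<Sum>i\<in>I. clif_mult (c i) (half_ext \<sigma> (w i) x))"
    unfolding half_ext_def factor_out
    by (simp add: Bochner_Integration.integral_sum[OF summand_integrable]
        integral_bounded_linear[OF bounded_linear_clif_mult assms]
        scaleR_sum_right clif_mult_scaleR_right)
qed

lemma half_ext_monogenic:
  fixes w :: "(real, 'm::{finite,linorder}) vec \<Rightarrow> 'm clif"
  assumes w: "L2 (exp_weight a w)" and \<sigma>: "\<bar>\<sigma>\<bar> = 1"
    and eigen: "\<And>\<xi>. dirac_symbol \<xi> (w \<xi>) = (\<sigma> * norm \<xi>) *\<^sub>R w \<xi>"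
  shows "left_monogenic (slab {t. - a < \<sigma> * t}) (half_ext \<sigma> w)"
proof -
  note [measurable] = L2_exp_weight_measurable[OF w]
  let ?\<Omega> = "slab {t. - a < \<sigma> * t} :: (real \<times> (real, 'm) vec) set"
  define D where "D v \<xi> = cscale (phase \<sigma> \<xi> v) (w \<xi>)" for v \<xi>
  have D_measurable: "D v \<in> borel_measurable borel" for v unfolding D_def by measurable
  have D_le: "norm (D (1, 0) \<xi>) \<le> norm \<xi> * norm (w \<xi>)" "norm (D (0, axis k 1) \<xi>) \<le> norm \<xi> * norm (w \<xi>)" for \<xi> k
    using \<sigma> by (simp_all add: D_def phase_time phase_axis abs_mult norm_mult component_le_norm_cart mult_right_mono)
  have fst_less: "- \<sigma> * fst x < a" if "x \<in> ?\<Omega>" for x using that by (cases x) simp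
  have equation: "half_ext \<sigma> (D (1, 0)) x
      + (\<Sum>k\<in>UNIV. clif_mult (clif_gen k) (half_ext \<sigma> (D (0, axis k 1)) x)) = 0" if x: "x \<in> ?\<Omega>" for x
  proof -
    obtain b where b: "- \<sigma> * fst x < b" "b < a" using dense[OF fst_less[OF x]] by blast
    have D_integrable: "integrable lborel (\<lambda>\<xi>. cscale (exp (phase \<sigma> \<xi> x)) (D v \<xi>))"
      if "\<And>\<xi>. norm (D v \<xi>) \<le> norm \<xi> * norm (w \<xi>)" for v
      by (rule half_ext_integrable[OF L2_exp_weight_times_norm[OF w b(2) D_measurable that] b(1)])
    have "D (1, 0) \<xi> + (\<Sum>k\<in>UNIV. clif_mult (clif_gen k) (D (0, axis k 1) \<xi>)) = 0" for \<xi>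
    proof -
      have "(\<Sum>k\<in>UNIV. clif_mult (clif_gen k) (D (0, axis k 1) \<xi>)) = dirac_symbol \<xi> (w \<xi>)"
        by (simp add: D_def phase_axis clif_mult_cscale_right dirac_symbol_sum)
      then show ?thesis unfolding D_def phase_time eigen cscale_of_real by simp
    qed
    then have "half_ext \<sigma> (\<lambda>\<xi>. D (1, 0) \<xi> + (\<Sum>k\<in>UNIV. clif_mult (clif_gen k) (D (0, axis k 1) \<xi>))) x = 0"
      by (simp add: half_ext_def)
    then show ?thesis
      by (simp add: half_ext_add half_ext_sum_clif_mult D_integrable D_le)
  qed
  have "monogenic_derivative ?\<Omega> (half_ext \<sigma> w) (\<lambda>x v. half_ext \<sigma> (D v) x)"
    unfolding monogenic_derivative_def
  proof (intro conjI ballI allI)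
    show "open ?\<Omega>" by (intro open_slab open_Collect_less continuous_intros)
    show "(half_ext \<sigma> w has_derivative (\<lambda>v. half_ext \<sigma> (D v) x)) (at x)" if "x \<in> ?\<Omega>" for x
      using half_ext_has_derivative[OF w \<sigma> fst_less[OF that]] by (simp add: D_def[abs_def])
  qed (intro half_ext_continuous_on[OF w \<sigma> D_measurable] D_le equation; assumption)+
  then show ?thesis unfolding left_monogenic_iff by blast
qed

lemma half_ext_slice: "half_ext \<sigma> w (t, y) = (1 / (2 * pi) ^ CARD('m)) *\<^sub>R fourier 1 (exp_weight (- \<sigma> * t) w) y"
  for w :: "(real, 'm::finite) vec \<Rightarrow> 'm clif"
  unfolding half_ext_def cscale_exp_phase fourier_def by (simp add: inner_commute)

lemma half_ext_H2:
  fixes w :: "(real, 'm::{finite,linorder}) vec \<Rightarrow> 'm clif"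
  assumes w: "L2 (exp_weight a w)" and \<sigma>: "\<bar>\<sigma>\<bar> = 1"
    and eigen: "\<And>\<xi>. dirac_symbol \<xi> (w \<xi>) = (\<sigma> * norm \<xi>) *\<^sub>R w \<xi>"
  shows "H2 (slab {t. - a < \<sigma> * t}) (half_ext \<sigma> w)"
proof -
  define c where "c = 1 / (2 * pi) ^ CARD('m)"
  define K where "K = sqrt ((2 * pi) ^ CARD('m))"
  have "L2 (\<lambda>y. half_ext \<sigma> w (t, y)) \<and> l2 (\<lambda>y. half_ext \<sigma> w (t, y)) \<le> c * (K * l2 (exp_weight a w))"
    if t: "- a < \<sigma> * t" for t
  proof -
    let ?v = "exp_weight (- \<sigma> * t) w"
    have weighted: "L2 ?v" "l2 ?v \<le> l2 (exp_weight a w)" "integrable lborel ?v"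
      using L2_exp_weight_mono[OF w _ L2_exp_weight_measurable[OF w], of "- \<sigma> * t"]
          exp_weight_integrable[OF w, of "- \<sigma> * t"] t
      by simp_all
    have transform: "L2 (fourier 1 ?v)" "l2 (fourier 1 ?v) \<le> K * l2 ?v"
      using fourier_plancherel_le[of 1, OF _ weighted(3,1)] by (simp_all add: K_def)
    have slice: "(\<lambda>y. half_ext \<sigma> w (t, y)) = (\<lambda>y. c *\<^sub>R fourier 1 ?v y)"
      by (simp add: half_ext_slice c_def)
    have "l2 (\<lambda>y. c *\<^sub>R fourier 1 ?v y) \<le> c * l2 (fourier 1 ?v)"
      by (rule L2_dominated(2)[OF transform(1) L2_measurable[OF L2_scaleR[OF transform(1)]]]) (simp_all add: c_def)
    moreover have "c * l2 (fourier 1 ?v) \<le> c * (K * l2 (exp_weight a w))"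
      using weighted(2) by (intro mult_left_mono order_trans[OF transform(2)]) (simp_all add: c_def K_def)
    moreover have "L2 (\<lambda>y. c *\<^sub>R fourier 1 ?v y)" by (rule L2_scaleR[OF transform(1)])
    ultimately show ?thesis unfolding slice by linarith
  qed
  then have "L2_slices {t. - a < \<sigma> * t} (half_ext \<sigma> w) (c * (K * l2 (exp_weight a w)))"
    by (simp add: L2_slices_def)
  then show ?thesis unfolding H2_slab_iff using half_ext_monogenic[OF w \<sigma> eigen] by blast
qed

definition spectral_part :: "real \<Rightarrow> ((real, 'm::{finite,linorder}) vec \<Rightarrow> 'm clif) \<Rightarrow> real \<times> (real, 'm) vec \<Rightarrow> 'm clif" where
  "spectral_part \<sigma> g = half_ext \<sigma> (\<lambda>\<xi>. spec_proj \<sigma> \<xi> (g \<xi>))"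

lemma L2_exp_weight_spec_proj:
  assumes "L2 (exp_weight a g)" "\<bar>\<sigma>\<bar> = 1" shows "L2 (exp_weight a (\<lambda>\<xi>. spec_proj \<sigma> \<xi> (g \<xi>)))"
  using L2_exp_weight_measurable[OF assms(1)] assms(2)
  by (intro L2_exp_weight_mono(1)[OF assms(1)] norm_spec_proj_le) auto

lemma spectral_part_H2:
  assumes "L2 (exp_weight a g)" "\<bar>\<sigma>\<bar> = 1" shows "H2 (slab {t. - a < \<sigma> * t}) (spectral_part \<sigma> g)"
  unfolding spectral_part_def
  by (intro half_ext_H2 L2_exp_weight_spec_proj dirac_symbol_spec_proj assms)

lemma spectral_part_H2_halfplus: "L2 (exp_weight a g) \<Longrightarrow> H2 (halfplus a) (spectral_part 1 g)"
  using spectral_part_H2[of a g 1] by (simp add: halfplus_slab greaterThan_def)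

lemma spectral_part_H2_halfminus: "L2 (exp_weight a g) \<Longrightarrow> H2 (halfminus a) (spectral_part (-1) g)"
  using spectral_part_H2[of a g "-1"] by (simp add: halfminus_slab lessThan_def)

lemma cauchy_ext_eq_spectral_parts:
  assumes g: "L2 (exp_weight a g)" and x: "x \<in> strip a"
  shows "cauchy_ext g x = spectral_part 1 g x + spectral_part (-1) g x"
proof -
  have "\<bar>fst x\<bar> < a" using x by (simp add: strip_def)
  then have integrable: "integrable lborel (\<lambda>\<xi>. cscale (exp (phase 1 \<xi> x)) (spec_proj 1 \<xi> (g \<xi>)))"
    "integrable lborel (\<lambda>\<xi>. cscale (exp (phase (-1) \<xi> x)) (spec_proj (-1) \<xi> (g \<xi>)))"
    by (auto intro!: half_ext_integrable[OF L2_exp_weight_spec_proj[OF g]])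
  have "clif_mult (ekern x \<xi>) (g \<xi>) = cscale (exp (phase 1 \<xi> x)) (spec_proj 1 \<xi> (g \<xi>))
      + cscale (exp (phase (-1) \<xi> x)) (spec_proj (-1) \<xi> (g \<xi>))" for \<xi>
    unfolding clif_mult_ekern dirac_exp_def
      cscale_exp_phase[of _ _ _ "\<lambda>\<xi>. spec_proj 1 \<xi> (g \<xi>)"] cscale_exp_phase[of _ _ _ "\<lambda>\<xi>. spec_proj (-1) \<xi> (g \<xi>)"]
    by (simp add: cscale_add_right exp_weight_def)
  then show ?thesis unfolding cauchy_ext_def spectral_part_def half_ext_def
    by (simp add: Bochner_Integration.integral_add[OF integrable] scaleR_right_distrib)
qed

lemma H2_strip_add:
  assumes "H2 (halfplus a) p" "H2 (halfminus a) q" shows "H2 (strip a) (\<lambda>x. p x + q x)"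
  unfolding strip_slab using assms unfolding halfplus_slab halfminus_slab
  by (intro H2_slab_add) (auto elim!: H2_slab_subset)

lemma cauchy_ext_H2:
  assumes "L2 (exp_weight a g)" shows "H2 (strip a) (cauchy_ext g)"
proof -
  have "H2 (strip a) (\<lambda>x. spectral_part 1 g x + spectral_part (-1) g x)"
    by (intro H2_strip_add spectral_part_H2_halfplus spectral_part_H2_halfminus assms)
  then show ?thesis
    using cauchy_ext_eq_spectral_parts[OF assms] unfolding strip_slab by (rule H2_slab_cong)
qed

lemma cauchy_ext_slice:
  "cauchy_ext g (t, y) = (1 / (2 * pi) ^ CARD('m)) *\<^sub>R fourier 1 (\<lambda>\<xi>. dirac_exp t \<xi> (g \<xi>)) y"
  for g :: "(real, 'm::{finite,linorder}) vec \<Rightarrow> 'm clif"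
  unfolding cauchy_ext_def clif_mult_ekern fourier_def by (simp add: inner_commute)

section \<open>A conservation law for pairs of monogenic functions\<close>

lemma integrable_continuous_bounded_support:
  fixes u :: "'a::euclidean_space \<Rightarrow> 'b::euclidean_space"
  assumes "continuous_on UNIV u" "\<And>x. R < norm x \<Longrightarrow> u x = 0"
  shows "integrable lborel u"
proof -
  have "integrable lborel (\<lambda>x. indicator (cball 0 R) x *\<^sub>R u x)"
    using assms(1) by (intro borel_integrable_compact) (auto intro: continuous_on_subset)
  also have "(\<lambda>x. indicator (cball 0 R) x *\<^sub>R u x) = u"
    using assms(2) by (force simp: indicator_def)
  finally show ?thesis .
qed

lemma integral_lborel_eq_integral_cbox:
  fixes u :: "'a::euclidean_space \<Rightarrow> 'b::euclidean_space"
  assumes "continuous_on (cbox a b) u" "\<And>x. x \<notin> cbox a b \<Longrightarrow> u x = 0"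
  shows "(\<integral>x. u x \<partial>lborel) = integral (cbox a b) u"
proof -
  have "set_integrable lborel (cbox a b) u"
    unfolding set_integrable_def using assms(1) by (intro borel_integrable_compact) auto
  moreover have "indicator (cbox a b) x *\<^sub>R u x = u x" for x
    using assms(2)[of x] by (simp add: indicator_def)
  ultimately show ?thesis
    using set_borel_integral_eq_integral(2)[of "cbox a b" u] by (simp add: set_lebesgue_integral_def)
qed

lemma integral_lborel_eq_integral_cbox_bounded_support:
  obtains c :: "'a::euclidean_space"
  where "\<And>u :: 'a \<Rightarrow> 'b::euclidean_space. continuous_on UNIV u \<Longrightarrow> (\<And>x. R < norm x \<Longrightarrow> u x = 0) \<Longrightarrow>
    (\<integral>x. u x \<partial>lborel) = integral (cbox (- c) c) u"
proof -
  obtain c :: 'a where box: "cball 0 R \<subseteq> cbox (- c) c"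
    using bounded_subset_cbox_symmetric[OF bounded_cball] by blast
  show thesis
  proof (rule that)
    fix u :: "'a \<Rightarrow> 'b" assume u: "continuous_on UNIV u" and support: "\<And>x. R < norm x \<Longrightarrow> u x = 0"
    show "(\<integral>x. u x \<partial>lborel) = integral (cbox (- c) c) u"
    proof (rule integral_lborel_eq_integral_cbox)
      show "continuous_on (cbox (- c) c) u" using u by (rule continuous_on_subset) simp
      show "u x = 0" if "x \<notin> cbox (- c) c" for x
        using that box support by (meson mem_cball_0 not_le subsetD)
    qed
  qed
qed

lemma has_vector_derivative_integral_bounded_support:
  fixes f :: "real \<Rightarrow> 'a::euclidean_space \<Rightarrow> 'b::euclidean_space"
  assumes A: "open A" "t \<in> A"
    and f': "\<And>s x. s \<in> A \<Longrightarrow> ((\<lambda>s. f s x) has_vector_derivative f' s x) (at s)"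
    and f_cont: "\<And>s. s \<in> A \<Longrightarrow> continuous_on UNIV (f s)"
    and f'_cont: "continuous_on (A \<times> UNIV) (\<lambda>(s, x). f' s x)"
    and support: "\<And>s x. s \<in> A \<Longrightarrow> R < norm x \<Longrightarrow> f s x = 0"
  shows "((\<lambda>s. \<integral>x. f s x \<partial>lborel) has_vector_derivative (\<integral>x. f' t x \<partial>lborel)) (at t)"
proof -
  obtain r where r: "r > 0" "ball t r \<subseteq> A" using A open_contains_ball by blast
  obtain c where integral_eq: "\<And>u :: 'a \<Rightarrow> 'b. continuous_on UNIV u \<Longrightarrow> (\<And>x. R < norm x \<Longrightarrow> u x = 0) \<Longrightarrow>
      (\<integral>x. u x \<partial>lborel) = integral (cbox (- c) c) u"
    using integral_lborel_eq_integral_cbox_bounded_support[of R] by blast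
  have f'_support: "f' t x = 0" if "R < norm x" for x
  proof -
    have "((\<lambda>s. f s x) has_vector_derivative 0) (at t)"
      by (rule has_vector_derivative_transform_within_open[OF has_vector_derivative_const A]) (simp add: support that)
    then show ?thesis using f'[OF A(2)] vector_derivative_unique_at by blast
  qed
  have f't_cont: "continuous_on UNIV (f' t)"
    using continuous_on_compose2[OF f'_cont continuous_on_Pair[OF continuous_on_const continuous_on_id],
        of t UNIV] A(2) by auto
  have "((\<lambda>s. integral (cbox (- c) c) (f s))
      has_vector_derivative integral (cbox (- c) c) (f' t)) (at t within ball t r)"
  proof (rule leibniz_rule_vector_derivative)
    show "((\<lambda>s. f s x) has_vector_derivative f' s x) (at s within ball t r)" if "s \<in> ball t r" for s x
      by (rule has_vector_derivative_at_within[OF f'[OF subsetD[OF r(2) that]]])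
    show "f s integrable_on cbox (- c) c" if "s \<in> ball t r" for s
      by (rule integrable_continuous[OF continuous_on_subset[OF f_cont[OF subsetD[OF r(2) that]]]]) simp
    show "continuous_on (ball t r \<times> cbox (- c) c) (\<lambda>(s, x). f' s x)"
      using r(2) by (intro continuous_on_subset[OF f'_cont]) blast
  qed (simp_all add: r(1))
  then have "((\<lambda>s. integral (cbox (- c) c) (f s)) has_vector_derivative (\<integral>x. f' t x \<partial>lborel)) (at t)"
    using r(1) by (simp add: integral_eq[OF f't_cont f'_support] at_within_open[OF centre_in_ball[THEN iffD2]])
  then show ?thesis
    by (rule has_vector_derivative_transform_within_open[OF _ A]) (simp add: integral_eq f_cont support)
qed

text \<open>Integration by parts without boundary terms: differentiate the translation invariance
  of the integral.\<close>
lemma integral_directional_derivative_eq_0: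
  fixes u :: "'a::euclidean_space \<Rightarrow> 'b::euclidean_space"
  assumes u': "\<And>x. (u has_derivative u' x) (at x)" and u'_cont: "continuous_on UNIV (\<lambda>x. u' x e)"
    and support: "\<And>x. R < norm x \<Longrightarrow> u x = 0"
  shows "(\<integral>x. u' x e \<partial>lborel) = 0"
proof -
  have u_cont: "continuous_on UNIV u"
    using u' by (intro continuous_at_imp_continuous_on) (auto intro: has_derivative_continuous)
  have "((\<lambda>s. \<integral>x. u (s *\<^sub>R e + x) \<partial>lborel) has_vector_derivative (\<integral>x. u' (0 *\<^sub>R e + x) e \<partial>lborel)) (at 0)"
  proof (rule has_vector_derivative_integral_bounded_support[where A="{-1<..<1}" and R="R + norm e"])
    show "((\<lambda>s. u (s *\<^sub>R e + x)) has_vector_derivative u' (s *\<^sub>R e + x) e) (at s)" for s x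
    proof -
      have "((\<lambda>s. s *\<^sub>R e + x) has_derivative (\<lambda>h. h *\<^sub>R e)) (at s)" by (auto intro!: derivative_eq_intros)
      from has_derivative_compose[OF this u']
      show ?thesis unfolding has_vector_derivative_def
        by (rule has_derivative_eq_rhs) (auto simp: linear_scale[OF has_derivative_linear[OF u']])
    qed
    show "continuous_on UNIV (\<lambda>x. u (s *\<^sub>R e + x))" for s
      by (intro continuous_on_compose2[OF u_cont] continuous_intros) auto
    show "continuous_on ({-1<..<1} \<times> UNIV) (\<lambda>(s, x). u' (s *\<^sub>R e + x) e)"
      unfolding split_beta' by (intro continuous_on_compose2[OF u'_cont] continuous_intros) auto
    show "u (s *\<^sub>R e + x) = 0" if "s \<in> {-1<..<1}" "R + norm e < norm x" for s x
    proof (rule support)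
      have "norm (s *\<^sub>R e) \<le> norm e" using that(1) by (simp add: mult_left_le_one_le abs_le_iff)
      then show "R < norm (s *\<^sub>R e + x)" using that(2) norm_diff_ineq[of x "s *\<^sub>R e"] by (simp add: add.commute)
    qed
  qed auto
  moreover have "(\<integral>x. u (s *\<^sub>R e + x) \<partial>lborel) = (\<integral>x. u x \<partial>lborel)" for s
    using lborel_affine_euclid(2)[of 1 u "s *\<^sub>R e"] borel_measurable_continuous_onI[OF u_cont] by simp
  ultimately have "((\<lambda>s::real. \<integral>x. u x \<partial>lborel) has_vector_derivative (\<integral>x. u' x e \<partial>lborel)) (at 0)" by simp
  then show ?thesis using vector_derivative_unique_at[OF _ has_vector_derivative_const] by blast
qed

lemma max_0_square_has_derivative: "((\<lambda>s::real. (max 0 s)\<^sup>2) has_real_derivative 2 * max 0 s) (at s)"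
proof -
  consider "s > 0" | "s < 0" | "s = 0" by linarith
  then show ?thesis
  proof cases
    case 1
    have "((\<lambda>s::real. s\<^sup>2) has_real_derivative 2 * s) (at s)" by (auto intro!: derivative_eq_intros)
    then show ?thesis using 1
      by (subst DERIV_cong_ev[OF refl _ refl, where g="\<lambda>s. s\<^sup>2"])
         (auto intro!: eventually_mono[OF eventually_nhds_in_open[of "{0<..}" s]])
  next
    case 2
    then show ?thesis
      by (subst DERIV_cong_ev[OF refl _ refl, where g="\<lambda>s. 0"])
         (auto intro!: eventually_mono[OF eventually_nhds_in_open[of "{..<0}" s]])
  next
    case 3
    have "((\<lambda>h. (max 0 h)\<^sup>2 / h) \<longlongrightarrow> 0) (at (0::real))"
    proof (rule Lim_null_comparison)
      show "\<forall>\<^sub>F h in at (0::real). norm ((max 0 h)\<^sup>2 / h) \<le> \<bar>h\<bar>"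
        by (intro always_eventually allI) (auto simp: max_def power2_eq_square)
      show "((\<lambda>h. \<bar>h\<bar>) \<longlongrightarrow> 0) (at (0::real))" by (auto intro!: tendsto_eq_intros)
    qed
    then show ?thesis using 3 by (simp add: DERIV_def)
  qed
qed

definition cutoff :: "real \<Rightarrow> 'a::euclidean_space \<Rightarrow> real" where
  "cutoff R x = (max 0 (1 - (norm x)\<^sup>2 / R\<^sup>2))\<^sup>2"

definition cutoff' :: "real \<Rightarrow> 'a::euclidean_space \<Rightarrow> 'a \<Rightarrow> real" where
  "cutoff' R x v = - 4 * max 0 (1 - (norm x)\<^sup>2 / R\<^sup>2) * (x \<bullet> v) / R\<^sup>2"

lemma cutoff_has_derivative: "(cutoff R has_derivative cutoff' R x) (at x)"
proof -
  define k where "k = 1 / R\<^sup>2"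
  have "((\<lambda>x::'a. 1 - k * (x \<bullet> x)) has_derivative (\<lambda>v. - (k * (2 * (x \<bullet> v))))) (at x)"
    by (auto intro!: derivative_eq_intros simp: inner_commute)
  from has_derivative_compose[OF this max_0_square_has_derivative[unfolded has_field_derivative_def]]
  have "((\<lambda>x. (max 0 (1 - k * (x \<bullet> x)))\<^sup>2)
      has_derivative (\<lambda>v. 2 * max 0 (1 - k * (x \<bullet> x)) * - (k * (2 * (x \<bullet> v))))) (at x)" .
  moreover have "cutoff R = (\<lambda>x::'a. (max 0 (1 - k * (x \<bullet> x)))\<^sup>2)"
    by (simp add: cutoff_def fun_eq_iff k_def power2_norm_eq_inner)
  moreover have "cutoff' R x = (\<lambda>v. 2 * max 0 (1 - k * (x \<bullet> x)) * - (k * (2 * (x \<bullet> v))))"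
    by (simp add: cutoff'_def fun_eq_iff k_def power2_norm_eq_inner)
  ultimately show ?thesis by simp
qed

lemma cutoff_outside: "R > 0 \<Longrightarrow> norm x \<ge> R \<Longrightarrow> cutoff R x = 0"
  and cutoff'_outside: "R > 0 \<Longrightarrow> norm x \<ge> R \<Longrightarrow> cutoff' R x v = 0"
  by (auto simp: cutoff_def cutoff'_def max_def field_simps not_le dest: power_mono[of R "norm x" 2])

lemma cutoff_nonneg: "0 \<le> cutoff R x" and cutoff_le_1: "cutoff R x \<le> 1"
proof -
  show "0 \<le> cutoff R x" by (simp add: cutoff_def)
  have "(max 0 (1 - (norm x)\<^sup>2 / R\<^sup>2))\<^sup>2 \<le> 1\<^sup>2" by (intro power_mono) auto
  then show "cutoff R x \<le> 1" by (simp add: cutoff_def)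
qed

lemma cutoff'_le:
  assumes "R > 0" "norm v \<le> 1" shows "\<bar>cutoff' R x v\<bar> \<le> 4 / R"
proof (cases "norm x \<ge> R")
  case True then show ?thesis using assms by (simp add: cutoff'_outside)
next
  case False
  have "\<bar>x \<bullet> v\<bar> \<le> norm x * norm v" by (rule Cauchy_Schwarz_ineq2)
  also have "\<dots> \<le> R * 1" using False assms by (intro mult_mono) auto
  finally have "\<bar>max 0 (1 - (norm x)\<^sup>2 / R\<^sup>2)\<bar> * \<bar>x \<bullet> v\<bar> \<le> 1 * R" by (intro mult_mono) auto
  then have "4 * (\<bar>max 0 (1 - (norm x)\<^sup>2 / R\<^sup>2)\<bar> * \<bar>x \<bullet> v\<bar>) / R\<^sup>2 \<le> 4 * (1 * R) / R\<^sup>2"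
    by (intro divide_right_mono mult_left_mono) auto
  also have "4 * (1 * R) / R\<^sup>2 = 4 / R" using assms by (simp add: power2_eq_square)
  finally show ?thesis by (simp add: cutoff'_def abs_mult)
qed

lemma cutoff_continuous: "continuous_on UNIV (cutoff R)"
  using cutoff_has_derivative by (intro continuous_at_imp_continuous_on) (auto intro: has_derivative_continuous)

lemma cutoff'_continuous: "continuous_on UNIV (\<lambda>x. cutoff' R x v)"
  unfolding cutoff'_def by (cases "R = 0") (auto intro!: continuous_intros)

lemma cutoff_tendsto: "((\<lambda>R. cutoff R x) \<longlongrightarrow> 1) at_top"
proof -
  have "((\<lambda>R. (norm x)\<^sup>2 / R\<^sup>2) \<longlongrightarrow> 0) at_top"
    by (rule tendsto_divide_0[OF tendsto_const])
       (intro filterlim_at_top_imp_at_infinity filterlim_pow_at_top filterlim_ident, simp)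
  then have "((\<lambda>R. (max 0 (1 - (norm x)\<^sup>2 / R\<^sup>2))\<^sup>2) \<longlongrightarrow> (max 0 (1 - 0))\<^sup>2) at_top"
    by (intro tendsto_intros)
  then show ?thesis by (simp add: cutoff_def)
qed

lemma integral_cutoff_inner_by_parts:
  fixes u v :: "'a::euclidean_space \<Rightarrow> 'b::euclidean_space"
  assumes R: "R > 0"
    and u: "\<And>x. (u has_derivative u' x) (at x)" "continuous_on UNIV (\<lambda>x. u' x e)"
    and v: "\<And>x. (v has_derivative v' x) (at x)" "continuous_on UNIV (\<lambda>x. v' x e)"
  shows "integrable lborel (\<lambda>x. cutoff R x * (u' x e \<bullet> v x + u x \<bullet> v' x e))"
    and "(\<integral>x. cutoff R x * (u' x e \<bullet> v x + u x \<bullet> v' x e) \<partial>lborel) = - (\<integral>x. cutoff' R x e * (u x \<bullet> v x) \<partial>lborel)"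
proof -
  have uv_cont: "continuous_on UNIV u" "continuous_on UNIV v"
    using u(1) v(1) by (auto intro!: continuous_at_imp_continuous_on intro: has_derivative_continuous)
  have integrand_continuous: "continuous_on UNIV (\<lambda>x. cutoff R x * (u' x e \<bullet> v x + u x \<bullet> v' x e))"
    "continuous_on UNIV (\<lambda>x. cutoff' R x e * (u x \<bullet> v x))"
    by (intro continuous_intros cutoff_continuous cutoff'_continuous u v uv_cont)+
  show integrable: "integrable lborel (\<lambda>x. cutoff R x * (u' x e \<bullet> v x + u x \<bullet> v' x e))"
    by (rule integrable_continuous_bounded_support[OF integrand_continuous(1), of R]) (simp add: cutoff_outside[OF R])
  have "((\<lambda>x. cutoff R x * (u x \<bullet> v x)) has_derivative
      (\<lambda>h. cutoff R x * (u x \<bullet> v' x h + u' x h \<bullet> v x) + cutoff' R x h * (u x \<bullet> v x))) (at x)" for x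
    by (intro has_derivative_mult has_derivative_inner cutoff_has_derivative u v)
  then have "(\<integral>x. cutoff R x * (u x \<bullet> v' x e + u' x e \<bullet> v x) + cutoff' R x e * (u x \<bullet> v x) \<partial>lborel) = 0"
    by (rule integral_directional_derivative_eq_0[where R=R])
       (use integrand_continuous in \<open>auto simp: add.commute cutoff_outside[OF R] intro!: continuous_on_add\<close>)
  moreover have "integrable lborel (\<lambda>x. cutoff' R x e * (u x \<bullet> v x))"
    by (rule integrable_continuous_bounded_support[OF integrand_continuous(2), of R]) (simp add: cutoff'_outside[OF R])
  ultimately show "(\<integral>x. cutoff R x * (u' x e \<bullet> v x + u x \<bullet> v' x e) \<partial>lborel)
      = - (\<integral>x. cutoff' R x e * (u x \<bullet> v x) \<partial>lborel)"
    using integrable by (simp add: add.commute[of "u _ \<bullet> v' _ e"])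
qed

lemma inner_dirac_divergence:
  assumes "d0 + (\<Sum>k\<in>UNIV. clif_mult (clif_gen k) (d k)) = 0" "e0 + (\<Sum>k\<in>UNIV. clif_mult (clif_gen k) (e k)) = 0"
  shows "d0 \<bullet> w - z \<bullet> e0 = (\<Sum>k\<in>UNIV. d k \<bullet> clif_mult (clif_gen k) w + z \<bullet> clif_mult (clif_gen k) (e k))"
proof -
  have "d0 = - (\<Sum>k\<in>UNIV. clif_mult (clif_gen k) (d k))" "e0 = - (\<Sum>k\<in>UNIV. clif_mult (clif_gen k) (e k))"
    using assms by (simp_all add: eq_neg_iff_add_eq_0)
  then show ?thesis by (simp add: inner_sum_left inner_sum_right clif_gen_skew sum.distrib sum_negf)
qed

lemma monogenic_derivative_slices:
  assumes D: "monogenic_derivative (slab A) F D" and t: "t \<in> A"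
  shows "((\<lambda>s. F (s, y)) has_vector_derivative D (t, y) (1, 0)) (at t)"
    and "((\<lambda>y. F (t, y)) has_derivative (\<lambda>v. D (t, y) (0, v))) (at y)"
    and "continuous_on UNIV (\<lambda>y. D (t, y) (0, axis k 1))"
proof -
  show "continuous_on UNIV (\<lambda>y. D (t, y) (0, axis k 1))"
    using D continuous_on_slice[OF _ t, of "\<lambda>x. D x (0, axis k 1)"] by (simp add: monogenic_derivative_def)
  have F: "(F has_derivative D (t, y)) (at (t, y))"
    using D t by (simp add: monogenic_derivative_def)
  have "((\<lambda>s. (s, y)) has_derivative (\<lambda>h. h *\<^sub>R (1, 0))) (at t)"
    by (auto intro!: derivative_eq_intros)
  from has_derivative_compose[OF this F]
  show "((\<lambda>s. F (s, y)) has_vector_derivative D (t, y) (1, 0)) (at t)"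
    unfolding has_vector_derivative_def linear_scale[OF has_derivative_linear[OF F]] .
  have "((\<lambda>y. (t, y)) has_derivative (\<lambda>v. (0, v))) (at y)"
    by (auto intro!: derivative_eq_intros)
  from has_derivative_compose[OF this F]
  show "((\<lambda>y. F (t, y)) has_derivative (\<lambda>v. D (t, y) (0, v))) (at y)" .
qed

definition cutoff_pairing ::
  "real \<Rightarrow> (real \<times> (real, 'm::finite) vec \<Rightarrow> 'm clif) \<Rightarrow> (real \<times> (real, 'm) vec \<Rightarrow> 'm clif) \<Rightarrow> real \<Rightarrow> real" where
  "cutoff_pairing R F G t = (\<integral>x. cutoff R x * (F (t, x) \<bullet> G (- t, x)) \<partial>lborel)"

lemma cutoff_pairing_has_time_derivative:
  fixes F G :: "real \<times> (real, 'm::{finite,linorder}) vec \<Rightarrow> 'm clif"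
  assumes D: "monogenic_derivative (slab {-a<..<a}) F D" and E: "monogenic_derivative (slab {-a<..<a}) G E"
    and R: "R > 0" and t: "\<bar>t\<bar> < a"
  shows "(cutoff_pairing R F G has_vector_derivative
    (\<integral>x. cutoff R x * (D (t, x) (1, 0) \<bullet> G (- t, x) - F (t, x) \<bullet> E (- t, x) (1, 0)) \<partial>lborel)) (at t)"
  unfolding cutoff_pairing_def[abs_def]
proof (rule has_vector_derivative_integral_bounded_support[where A="{-a<..<a}" and R=R])
  let ?A = "{-a<..<a}"
  show "((\<lambda>s. cutoff R x * (F (s, x) \<bullet> G (- s, x))) has_vector_derivative
      cutoff R x * (D (s, x) (1, 0) \<bullet> G (- s, x) - F (s, x) \<bullet> E (- s, x) (1, 0))) (at s)" if "s \<in> ?A" for s x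
  proof -
    have F: "((\<lambda>s. F (s, x)) has_derivative (\<lambda>h. h *\<^sub>R D (s, x) (1, 0))) (at s)"
      using monogenic_derivative_slices(1)[OF D that] by (simp add: has_vector_derivative_def)
    have "((\<lambda>s. G (s, x)) has_derivative (\<lambda>h. h *\<^sub>R E (- s, x) (1, 0))) (at (- s))"
      using monogenic_derivative_slices(1)[OF E, of "- s"] that by (simp add: has_vector_derivative_def)
    from has_derivative_compose[OF has_derivative_minus[OF has_derivative_ident] this]
    have G: "((\<lambda>s. G (- s, x)) has_derivative (\<lambda>h. - h *\<^sub>R E (- s, x) (1, 0))) (at s)" .
    show ?thesis
      unfolding has_vector_derivative_def
      by (rule has_derivative_eq_rhs[OF has_derivative_mult_right[OF has_derivative_inner[OF F G]]])
         (simp add: fun_eq_iff algebra_simps)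
  qed
  have F_cont: "continuous_on (slab ?A) F" and G_cont: "continuous_on (slab ?A) G"
    using D E left_monogenic_continuous left_monogenic_iff by blast+
  have reflect: "continuous_on (slab ?A) (\<lambda>(s, x). H (- s, x))" if "continuous_on (slab ?A) H"
    for H :: "real \<times> (real, 'm) vec \<Rightarrow> 'm clif"
    unfolding split_beta' by (rule continuous_on_compose2[OF that]) (auto intro!: continuous_intros simp: slab_def)
  show "continuous_on UNIV (\<lambda>x. cutoff R x * (F (s, x) \<bullet> G (- s, x)))" if "s \<in> ?A" for s
    using that by (intro continuous_on_mult cutoff_continuous continuous_on_inner continuous_on_slice[OF F_cont]
        continuous_on_slice[OF G_cont]) auto
  have "continuous_on (slab ?A) (\<lambda>x. D x (1, 0))" "continuous_on (slab ?A) (\<lambda>x. E x (1, 0))"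
    using D E by (simp_all add: monogenic_derivative_def)
  then show "continuous_on (?A \<times> UNIV)
      (\<lambda>(s, x). cutoff R x * (D (s, x) (1, 0) \<bullet> G (- s, x) - F (s, x) \<bullet> E (- s, x) (1, 0)))"
    using F_cont reflect[OF G_cont] reflect[of "\<lambda>x. E x (1, 0)"] unfolding slab_def[symmetric] split_beta'
    by (auto intro!: continuous_intros continuous_on_compose2[OF cutoff_continuous])
qed (use t in \<open>auto simp: cutoff_outside[OF R]\<close>)

text \<open>Green's identity. The gradient of the cutoff is of size 1/R, which makes the pairing without
  the cutoff independent of time.\<close>
lemma cutoff_pairing_has_vector_derivative:
  fixes F G :: "real \<times> (real, 'm::{finite,linorder}) vec \<Rightarrow> 'm clif"
  assumes "left_monogenic (slab {-a<..<a}) F" "left_monogenic (slab {-a<..<a}) G" and R: "R > 0" and t: "\<bar>t\<bar> < a"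
  shows "(cutoff_pairing R F G has_vector_derivative
    - (\<Sum>k\<in>UNIV. \<integral>x. cutoff' R x (axis k 1) * (F (t, x) \<bullet> clif_mult (clif_gen k) (G (- t, x))) \<partial>lborel)) (at t)"
proof -
  from assms(1,2) obtain D E where D: "monogenic_derivative (slab {-a<..<a}) F D"
    and E: "monogenic_derivative (slab {-a<..<a}) G E"
    unfolding left_monogenic_iff by blast
  have t_in: "t \<in> {-a<..<a}" "- t \<in> {-a<..<a}" using t by auto
  define flux where "flux k x = cutoff R x * (D (t, x) (0, axis k 1) \<bullet> clif_mult (clif_gen k) (G (- t, x))
      + F (t, x) \<bullet> clif_mult (clif_gen k) (E (- t, x) (0, axis k 1)))" for k x
  have parts: "integrable lborel (flux k)"
    "(\<integral>x. flux k x \<partial>lborel) = - (\<integral>x. cutoff' R x (axis k 1) * (F (t, x) \<bullet> clif_mult (clif_gen k) (G (- t, x))) \<partial>lborel)" for k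
  proof -
    note by_parts = integral_cutoff_inner_by_parts[OF R monogenic_derivative_slices(2,3)[OF D t_in(1)]
        bounded_linear.has_derivative[OF bounded_linear_clif_mult monogenic_derivative_slices(2)[OF E t_in(2)]]
        bounded_linear.continuous_on[OF bounded_linear_clif_mult monogenic_derivative_slices(3)[OF E t_in(2)]]]
    show "integrable lborel (flux k)"
      "(\<integral>x. flux k x \<partial>lborel) = - (\<integral>x. cutoff' R x (axis k 1) * (F (t, x) \<bullet> clif_mult (clif_gen k) (G (- t, x))) \<partial>lborel)"
      unfolding flux_def by (rule by_parts)+
  qed
  have "cutoff R x * (D (t, x) (1, 0) \<bullet> G (- t, x) - F (t, x) \<bullet> E (- t, x) (1, 0)) = (\<Sum>k\<in>UNIV. flux k x)" for x
    using inner_dirac_divergence[of "D (t, x) (1, 0)" "\<lambda>k. D (t, x) (0, axis k 1)" "E (- t, x) (1, 0)"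
        "\<lambda>k. E (- t, x) (0, axis k 1)"]
      D E t_in by (simp add: monogenic_derivative_def flux_def sum_distrib_left)
  then show ?thesis
    using cutoff_pairing_has_time_derivative[OF D E R t]
    by (simp add: Bochner_Integration.integral_sum parts sum_negf)
qed

lemma cutoff'_pairing_le:
  fixes f g :: "(real, 'm::{finite,linorder}) vec \<Rightarrow> 'm clif"
  assumes f: "L2 f" "l2 f \<le> M" and g: "L2 g" "l2 g \<le> N" and R: "R > 0"
  shows "\<bar>\<integral>x. cutoff' R x (axis k 1) * (f x \<bullet> clif_mult (clif_gen k) (g x)) \<partial>lborel\<bar> \<le> 4 / R * (M * N)"
proof -
  have cutoff'_measurable: "(\<lambda>x::(real, 'm) vec. cutoff' R x (axis k 1)) \<in> borel_measurable borel"
    by (rule borel_measurable_continuous_onI[OF cutoff'_continuous])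
  have "norm (cutoff' R x (axis k 1) *\<^sub>R f x) \<le> 4 / R * norm (f x)" for x
    using mult_right_mono[OF cutoff'_le[OF R, of "axis k 1" x] norm_ge_zero[of "f x"]] by simp
  then have "AE x in lborel. norm (cutoff' R x (axis k 1) *\<^sub>R f x) \<le> 4 / R * norm (f x)" by simp
  note gradient_f = L2_dominated[OF f(1) borel_measurable_scaleR[OF cutoff'_measurable L2_measurable[OF f(1)]] this]
  have "AE x in lborel. norm (clif_mult (clif_gen k) (g x)) \<le> 1 * norm (g x)" by (simp add: norm_clif_mult_gen)
  note generator_g = L2_dominated[OF g(1) clif_mult_measurable[OF L2_measurable[OF g(1)]] this]
  have "\<bar>\<integral>x. cutoff' R x (axis k 1) * (f x \<bullet> clif_mult (clif_gen k) (g x)) \<partial>lborel\<bar>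
      \<le> l2 (\<lambda>x. cutoff' R x (axis k 1) *\<^sub>R f x) * l2 (\<lambda>x. clif_mult (clif_gen k) (g x))"
    using L2_inner(2)[OF gradient_f(1) generator_g(1)] R by simp
  also have "\<dots> \<le> (4 / R * M) * N"
    using gradient_f(2) generator_g(2) f(2) g(2) R order_trans[OF l2_nonneg f(2)]
    by (intro mult_mono order_trans[OF gradient_f(2)] order_trans[OF generator_g(2)]) (auto intro!: mult_left_mono)
  finally show ?thesis by (simp add: mult.assoc)
qed

lemma cutoff_pairing_increment_le:
  fixes F G :: "real \<times> (real, 'm::{finite,linorder}) vec \<Rightarrow> 'm clif"
  assumes F: "left_monogenic (slab {-a<..<a}) F" "L2_slices {-a<..<a} F M"
    and G: "left_monogenic (slab {-a<..<a}) G" "L2_slices {-a<..<a} G N" and R: "R > 0" and t: "\<bar>t\<bar> < a"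
  shows "\<bar>cutoff_pairing R F G t - cutoff_pairing R F G 0\<bar> \<le> CARD('m) * (4 / R * (M * N)) * \<bar>t\<bar>"
proof -
  define c where "c = CARD('m) * (4 / R * (M * N))"
  define p' where "p' s = - (\<Sum>k\<in>UNIV. \<integral>x. cutoff' R x (axis k 1) * (F (s, x) \<bullet> clif_mult (clif_gen k) (G (- s, x))) \<partial>lborel)" for s
  have p'_le: "\<bar>p' s\<bar> \<le> c" if "s \<in> {-a<..<a}" for s
  proof -
    have "- s \<in> {-a<..<a}" using that by auto
    then have "\<bar>\<integral>x. cutoff' R x (axis k 1) * (F (s, x) \<bullet> clif_mult (clif_gen k) (G (- s, x))) \<partial>lborel\<bar>
        \<le> 4 / R * (M * N)" for k
      using that by (intro cutoff'_pairing_le L2_slicesD[OF F(2)] L2_slicesD[OF G(2)] R)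
    from sum_mono[of UNIV, OF this] show ?thesis
      unfolding p'_def c_def abs_minus_cancel by (intro order_trans[OF sum_abs]) simp
  qed
  have "norm (cutoff_pairing R F G t - cutoff_pairing R F G 0) \<le> c * norm (t - 0)"
  proof (rule differentiable_bound[of "{-a<..<a}" _ "\<lambda>s h. h *\<^sub>R p' s"])
    fix s assume s: "s \<in> {-a<..<a}"
    then have "(cutoff_pairing R F G has_vector_derivative p' s) (at s)"
      unfolding p'_def by (intro cutoff_pairing_has_vector_derivative[OF F(1) G(1) R]) auto
    then show "(cutoff_pairing R F G has_derivative (\<lambda>h. h *\<^sub>R p' s)) (at s within {-a<..<a})"
      unfolding has_vector_derivative_def by (rule has_derivative_at_withinI)
    show "onorm (\<lambda>h. h *\<^sub>R p' s) \<le> c"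
    proof (rule onorm_bound)
      show "norm (h *\<^sub>R p' s) \<le> c * norm h" for h
        using mult_left_mono[OF p'_le[OF s], of "\<bar>h\<bar>"] by (simp add: abs_mult mult.commute)
    qed (rule order_trans[OF abs_ge_zero p'_le[OF s]])
  qed (use t in auto)
  then show ?thesis by (simp add: c_def)
qed

lemma cutoff_pairing_tendsto:
  fixes F G :: "real \<times> (real, 'm::finite) vec \<Rightarrow> 'm clif"
  assumes "L2 (\<lambda>x. F (t, x))" "L2 (\<lambda>x. G (- t, x))"
  shows "((\<lambda>R. cutoff_pairing R F G t) \<longlongrightarrow> (\<integral>x. F (t, x) \<bullet> G (- t, x) \<partial>lborel)) at_top"
  unfolding cutoff_pairing_def
proof (rule integral_dominated_convergence_at_top[where w="\<lambda>x. \<bar>F (t, x) \<bullet> G (- t, x)\<bar>"])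
  note integrable = L2_inner(1)[OF assms]
  have [measurable]: "cutoff R \<in> borel_measurable borel" for R :: real
    by (rule borel_measurable_continuous_onI[OF cutoff_continuous])
  show "(\<lambda>x. F (t, x) \<bullet> G (- t, x)) \<in> borel_measurable lborel" using integrable by simp
  then show "(\<lambda>x. cutoff R x * (F (t, x) \<bullet> G (- t, x))) \<in> borel_measurable lborel" for R by measurable
  show "integrable lborel (\<lambda>x. \<bar>F (t, x) \<bullet> G (- t, x)\<bar>)" using integrable by simp
  have "((\<lambda>R. cutoff R x * (F (t, x) \<bullet> G (- t, x))) \<longlongrightarrow> 1 * (F (t, x) \<bullet> G (- t, x))) at_top" for x
    by (intro tendsto_mult cutoff_tendsto tendsto_const)
  then show "AE x in lborel. ((\<lambda>R. cutoff R x * (F (t, x) \<bullet> G (- t, x))) \<longlongrightarrow> F (t, x) \<bullet> G (- t, x)) at_top" by simp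
  show "\<forall>\<^sub>F R in at_top. AE x in lborel. norm (cutoff R x * (F (t, x) \<bullet> G (- t, x))) \<le> \<bar>F (t, x) \<bullet> G (- t, x)\<bar>"
    by (simp add: abs_mult cutoff_nonneg cutoff_le_1 mult_left_le_one_le)
qed

theorem monogenic_pairing_conserved:
  fixes F G :: "real \<times> (real, 'm::{finite,linorder}) vec \<Rightarrow> 'm clif"
  assumes F: "left_monogenic (slab {-a<..<a}) F" "L2_slices {-a<..<a} F M"
    and G: "left_monogenic (slab {-a<..<a}) G" "L2_slices {-a<..<a} G N" and t: "\<bar>t\<bar> < a"
  shows "(\<integral>x. F (t, x) \<bullet> G (- t, x) \<partial>lborel) = (\<integral>x. F (0, x) \<bullet> G (0, x) \<partial>lborel)"
proof -
  have pairing_lim: "((\<lambda>R. cutoff_pairing R F G s) \<longlongrightarrow> (\<integral>x. F (s, x) \<bullet> G (- s, x) \<partial>lborel)) at_top" if "\<bar>s\<bar> < a" for s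
    using that by (intro cutoff_pairing_tendsto L2_slicesD(1)[OF F(2)] L2_slicesD(1)[OF G(2)]) auto
  have "((\<lambda>R. CARD('m) * (4 / R * (M * N)) * \<bar>t\<bar>) \<longlongrightarrow> 0) at_top"
    by (intro tendsto_mult_left_zero tendsto_mult_right_zero tendsto_divide_0[OF tendsto_const]
        filterlim_at_top_imp_at_infinity filterlim_ident)
  moreover have "\<forall>\<^sub>F R in at_top. norm (cutoff_pairing R F G t - cutoff_pairing R F G 0)
      \<le> CARD('m) * (4 / R * (M * N)) * \<bar>t\<bar>"
    using eventually_gt_at_top[of 0] by eventually_elim
       (simp only: real_norm_def cutoff_pairing_increment_le[OF F G _ t])
  ultimately have "((\<lambda>R. cutoff_pairing R F G t - cutoff_pairing R F G 0) \<longlongrightarrow> 0) at_top"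
    by (rule Lim_null_comparison[rotated])
  moreover have "((\<lambda>R. cutoff_pairing R F G t - cutoff_pairing R F G 0) \<longlongrightarrow>
      (\<integral>x. F (t, x) \<bullet> G (- t, x) \<partial>lborel) - (\<integral>x. F (0, x) \<bullet> G (- 0, x) \<partial>lborel)) at_top"
    using t by (intro tendsto_diff pairing_lim) auto
  ultimately have "(\<integral>x. F (t, x) \<bullet> G (- t, x) \<partial>lborel) - (\<integral>x. F (0, x) \<bullet> G (- 0, x) \<partial>lborel) = 0"
    using tendsto_unique[OF trivial_limit_at_top_linorder] by blast
  then show ?thesis by simp
qed

section \<open>Representation and uniqueness\<close>

lemma L2_exp_weight_bounded_support:
  fixes g :: "'a::euclidean_space \<Rightarrow> 'b::euclidean_space"
  assumes g: "L2 g" "\<And>\<xi>. R < norm \<xi> \<Longrightarrow> g \<xi> = 0" and a: "0 \<le> a"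
  shows "L2 (exp_weight a g)"
proof (rule L2_dominated(1)[OF g(1) exp_weight_measurable[OF L2_measurable[OF g(1)]]])
  have "norm (exp_weight a g \<xi>) \<le> exp (a * R) * norm (g \<xi>)" for \<xi>
  proof (cases "R < norm \<xi>")
    case False
    then show ?thesis using a by (simp add: exp_weight_def mult_right_mono mult_left_mono)
  qed (simp add: exp_weight_def g(2))
  then show "AE \<xi> in lborel. norm (exp_weight a g \<xi>) \<le> exp (a * R) * norm (g \<xi>)" by simp
qed simp

lemma L2_dirac_exp:
  fixes g :: "(real, 'm::{finite,linorder}) vec \<Rightarrow> 'm clif"
  assumes g: "L2 (exp_weight a g)" and t: "\<bar>t\<bar> < a"
  shows "L2 (\<lambda>\<xi>. dirac_exp t \<xi> (g \<xi>))" "integrable lborel (\<lambda>\<xi>. dirac_exp t \<xi> (g \<xi>))"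
proof -
  note measurable = dirac_exp_measurable[OF L2_exp_weight_measurable[OF g]]
  have dirac_exp_le: "norm (dirac_exp t \<xi> (g \<xi>)) \<le> 2 * norm (exp_weight \<bar>t\<bar> g \<xi>)" for \<xi>
    using norm_dirac_exp_le[of t \<xi> "g \<xi>"] by (simp add: exp_weight_def mult.assoc)
  have "L2 (exp_weight \<bar>t\<bar> g)"
    using t by (intro L2_exp_weight_mono(1)[OF g _ L2_exp_weight_measurable[OF g]]) auto
  then show "L2 (\<lambda>\<xi>. dirac_exp t \<xi> (g \<xi>))"
    by (rule L2_dominated(1)[OF _ measurable, where c=2]) (simp_all add: dirac_exp_le)
  show "integrable lborel (\<lambda>\<xi>. dirac_exp t \<xi> (g \<xi>))"
    using measurable dirac_exp_le
    by (intro Bochner_Integration.integrable_bound[OF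
        integrable_mult_right[OF integrable_norm[OF exp_weight_integrable[OF g t]], of 2]])
       simp_all
qed

lemma fourier_slice_pairing:
  fixes F :: "real \<times> (real, 'm::{finite,linorder}) vec \<Rightarrow> 'm clif"
  assumes F: "left_monogenic (slab {-a<..<a}) F" "L2_slices {-a<..<a} F M" and t: "\<bar>t\<bar> < a"
    and g: "is_fourier_L2 (\<lambda>x. F (0, x)) g" and h: "is_fourier_L2 (\<lambda>x. F (t, x)) h"
    and \<psi>: "L2 (exp_weight a \<psi>)"
  shows "(\<integral>\<xi>. h \<xi> \<bullet> dirac_exp (- t) \<xi> (\<psi> \<xi>) \<partial>lborel) = (\<integral>\<xi>. g \<xi> \<bullet> \<psi> \<xi> \<partial>lborel)"
proof -
  define c where "c = 1 / (2 * pi) ^ CARD('m)"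
  have pairing: "(\<integral>x. F (s, x) \<bullet> cauchy_ext \<psi> (- s, x) \<partial>lborel) = c * (\<integral>\<xi>. k \<xi> \<bullet> dirac_exp (- s) \<xi> (\<psi> \<xi>) \<partial>lborel)"
    if s: "\<bar>s\<bar> < a" and k: "is_fourier_L2 (\<lambda>x. F (s, x)) k" for s k
  proof -
    have "L2 (\<lambda>x. F (s, x))" using s by (intro L2_slicesD(1)[OF F(2)]) auto
    moreover have "L2 (\<lambda>\<xi>. dirac_exp (- s) \<xi> (\<psi> \<xi>))" "integrable lborel (\<lambda>\<xi>. dirac_exp (- s) \<xi> (\<psi> \<xi>))"
      using L2_dirac_exp[OF \<psi>, of "- s"] s by simp_all
    ultimately show ?thesis
      using is_fourier_L2_adjoint[OF _ k] by (simp add: cauchy_ext_slice c_def)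
  qed
  obtain N where G: "left_monogenic (slab {-a<..<a}) (cauchy_ext \<psi>)" "L2_slices {-a<..<a} (cauchy_ext \<psi>) N"
    using cauchy_ext_H2[OF \<psi>] unfolding strip_slab H2_slab_iff by blast
  have "c * (\<integral>\<xi>. h \<xi> \<bullet> dirac_exp (- t) \<xi> (\<psi> \<xi>) \<partial>lborel) = c * (\<integral>\<xi>. g \<xi> \<bullet> \<psi> \<xi> \<partial>lborel)"
    using monogenic_pairing_conserved[OF F G t] pairing[OF t h] pairing[OF _ g] t by simp
  then show ?thesis by (simp add: c_def)
qed

lemma L2_trunc_dirac_exp:
  fixes h :: "(real, 'm::{finite,linorder}) vec \<Rightarrow> 'm clif"
  assumes "L2 h" shows "L2 (trunc R (\<lambda>\<xi>. dirac_exp t \<xi> (h \<xi>)))"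
proof (rule L2_dominated(1)[OF assms trunc_measurable[OF dirac_exp_measurable[OF L2_measurable[OF assms]]]])
  have "norm (trunc R (\<lambda>\<xi>. dirac_exp t \<xi> (h \<xi>)) \<xi>) \<le> 2 * exp (\<bar>t\<bar> * R) * norm (h \<xi>)" for \<xi>
  proof (cases "norm \<xi> \<le> R")
    case True
    then have "2 * exp (\<bar>t\<bar> * norm \<xi>) * norm (h \<xi>) \<le> 2 * exp (\<bar>t\<bar> * R) * norm (h \<xi>)"
      by (intro mult_right_mono) (auto intro: mult_left_mono)
    then show ?thesis using norm_dirac_exp_le[of t \<xi> "h \<xi>"] True by (simp add: trunc_inside)
  qed (simp add: trunc_outside)
  then show "AE \<xi> in lborel. norm (trunc R (\<lambda>\<xi>. dirac_exp t \<xi> (h \<xi>)) \<xi>) \<le> 2 * exp (\<bar>t\<bar> * R) * norm (h \<xi>)"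
    by simp
qed simp

lemma fourier_slice_evolution:
  fixes F :: "real \<times> (real, 'm::{finite,linorder}) vec \<Rightarrow> 'm clif"
  assumes F: "left_monogenic (slab {-a<..<a}) F" "L2_slices {-a<..<a} F M" and t: "\<bar>t\<bar> < a"
    and g: "is_fourier_L2 (\<lambda>x. F (0, x)) g" and h: "is_fourier_L2 (\<lambda>x. F (t, x)) h"
  shows "AE \<xi> in lborel. h \<xi> = dirac_exp t \<xi> (g \<xi>)"
proof -
  have L2_g: "L2 g" and L2_h: "L2 h" using g h by (simp_all add: is_fourier_L2_def L2fun_iff_L2)
  define w where "w \<xi> = dirac_exp (- t) \<xi> (h \<xi>) - g \<xi>" for \<xi>
  have "AE \<xi> in lborel. trunc R w \<xi> = 0" if R: "0 \<le> R" for R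
  proof -
    define \<psi> where "\<psi> = trunc R w"
    from L2_diff[OF L2_trunc_dirac_exp[OF L2_h] L2_trunc[OF L2_g]]
    have \<psi>: "L2 \<psi>" by (simp add: \<psi>_def trunc_def[abs_def] w_def scaleR_right_diff_distrib)
    have \<psi>_weighted: "L2 (exp_weight a \<psi>)"
      using t by (intro L2_exp_weight_bounded_support[OF \<psi>, of R]) (simp_all add: \<psi>_def trunc_outside)
    have "L2 (\<lambda>\<xi>. dirac_exp (- t) \<xi> (\<psi> \<xi>))" using L2_dirac_exp(1)[OF \<psi>_weighted, of "- t"] t by simp
    then have "(\<integral>\<xi>. h \<xi> \<bullet> dirac_exp (- t) \<xi> (\<psi> \<xi>) - g \<xi> \<bullet> \<psi> \<xi> \<partial>lborel) = 0"
      using L2_inner(1)[OF L2_h] L2_inner(1)[OF L2_g \<psi>] fourier_slice_pairing[OF F t g h \<psi>_weighted] by simp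
    moreover have "h \<xi> \<bullet> dirac_exp (- t) \<xi> (\<psi> \<xi>) - g \<xi> \<bullet> \<psi> \<xi> = (norm (\<psi> \<xi>))\<^sup>2" for \<xi>
    proof -
      have "h \<xi> \<bullet> dirac_exp (- t) \<xi> (\<psi> \<xi>) - g \<xi> \<bullet> \<psi> \<xi> = w \<xi> \<bullet> \<psi> \<xi>"
        by (simp add: w_def inner_diff_left dirac_exp_selfadjoint)
      then show ?thesis by (simp add: \<psi>_def trunc_def power2_norm_eq_inner indicator_def)
    qed
    ultimately have "(l2 \<psi>)\<^sup>2 = 0" by (simp add: l2_power2)
    then show ?thesis using l2_le_0_imp_AE_eq_0[OF \<psi>] by (simp add: \<psi>_def)
  qed
  then have "AE \<xi> in lborel. w \<xi> = 0" by (rule AE_eq_0_if_trunc_AE_eq_0) simp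
  then show ?thesis
  proof eventually_elim
    fix \<xi> assume "w \<xi> = 0"
    then have "dirac_exp t \<xi> (dirac_exp (- t) \<xi> (h \<xi>)) = dirac_exp t \<xi> (g \<xi>)" by (simp add: w_def)
    then show "h \<xi> = dirac_exp t \<xi> (g \<xi>)" by (simp add: dirac_exp_add)
  qed
qed

lemma is_fourier_L2_slice:
  fixes F :: "real \<times> (real, 'm::{finite,linorder}) vec \<Rightarrow> 'm clif"
  assumes F: "left_monogenic (slab {-a<..<a}) F" "L2_slices {-a<..<a} F M" and t: "\<bar>t\<bar> < a"
    and g: "is_fourier_L2 (\<lambda>x. F (0, x)) g"
  shows "is_fourier_L2 (\<lambda>x. F (t, x)) (\<lambda>\<xi>. dirac_exp t \<xi> (g \<xi>))"
proof -
  have slice: "L2 (\<lambda>x. F (t, x))" using t by (intro L2_slicesD(1)[OF F(2)]) auto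
  then obtain h where h: "is_fourier_L2 (\<lambda>x. F (t, x)) h" by (rule is_fourier_L2_exists)
  have "L2 g" using g by (simp add: is_fourier_L2_def L2fun_iff_L2)
  then show ?thesis
    by (intro is_fourier_L2_cong_AE[OF h slice AE_I2[OF refl] L2_measurable[OF slice]
        fourier_slice_evolution[OF F t g h]]
        dirac_exp_measurable L2_measurable)
qed

lemma L2_exp_weight_if_L2_dirac_exp:
  fixes g :: "(real, 'm::{finite,linorder}) vec \<Rightarrow> 'm clif"
  assumes g: "g \<in> borel_measurable borel"
    and plus: "L2 (\<lambda>\<xi>. dirac_exp t \<xi> (g \<xi>))" "l2 (\<lambda>\<xi>. dirac_exp t \<xi> (g \<xi>)) \<le> B"
    and minus: "L2 (\<lambda>\<xi>. dirac_exp (- t) \<xi> (g \<xi>))" "l2 (\<lambda>\<xi>. dirac_exp (- t) \<xi> (g \<xi>)) \<le> B"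
  shows "L2 (exp_weight t g)" "l2 (exp_weight t g) \<le> sqrt 2 * B"
proof -
  let ?E = "\<lambda>\<xi>. (norm (dirac_exp t \<xi> (g \<xi>)))\<^sup>2 + (norm (dirac_exp (- t) \<xi> (g \<xi>)))\<^sup>2"
  have E_integrable: "integrable lborel ?E" by (intro Bochner_Integration.integrable_add L2_integrable plus minus)
  have exp_weight_le: "(norm (exp_weight t g \<xi>))\<^sup>2 \<le> ?E \<xi>" for \<xi>
    using dirac_exp_norm_lower[of t \<xi> "g \<xi>"] by (simp add: exp_weight_def)
  have "integrable lborel (\<lambda>\<xi>. (norm (exp_weight t g \<xi>))\<^sup>2)"
    using g exp_weight_le by (intro Bochner_Integration.integrable_bound[OF E_integrable]) auto
  then show weighted: "L2 (exp_weight t g)" using g by (simp add: L2_def)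
  have "(l2 (exp_weight t g))\<^sup>2 \<le> (\<integral>\<xi>. ?E \<xi> \<partial>lborel)"
    unfolding l2_power2 by (rule integral_mono[OF L2_integrable[OF weighted] E_integrable exp_weight_le])
  also have "\<dots> = (l2 (\<lambda>\<xi>. dirac_exp t \<xi> (g \<xi>)))\<^sup>2 + (l2 (\<lambda>\<xi>. dirac_exp (- t) \<xi> (g \<xi>)))\<^sup>2"
    unfolding l2_power2 by (intro Bochner_Integration.integral_add L2_integrable plus minus)
  also have "\<dots> \<le> B\<^sup>2 + B\<^sup>2" by (intro add_mono power_mono plus minus l2_nonneg)
  also have "\<dots> = (sqrt 2 * B)\<^sup>2" by (simp add: power_mult_distrib)
  finally show "l2 (exp_weight t g) \<le> sqrt 2 * B"
    by (rule power2_le_imp_le) (use order_trans[OF l2_nonneg plus(2)] in simp)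
qed

lemma L2_exp_weight_limit:
  fixes g :: "'a::euclidean_space \<Rightarrow> 'b::euclidean_space"
  assumes g: "g \<in> borel_measurable borel" and a: "0 < a"
    and weighted: "\<And>t. 0 \<le> t \<Longrightarrow> t < a \<Longrightarrow> L2 (exp_weight t g)" "\<And>t. 0 \<le> t \<Longrightarrow> t < a \<Longrightarrow> l2 (exp_weight t g) \<le> C"
  shows "L2 (exp_weight a g)" "l2 (exp_weight a g) \<le> C"
proof -
  define t where "t n = a * (1 - 1 / real (Suc n))" for n
  have t: "0 \<le> t n" "t n < a" for n
    using a by (simp_all add: t_def field_simps)
  have "t \<longlonglongrightarrow> a * (1 - 0)"
    unfolding t_def by (intro tendsto_intros LIMSEQ_Suc[OF lim_inverse_n'])
  then have "AE \<xi> in lborel. (\<lambda>n. exp_weight (t n) g \<xi>) \<longlonglongrightarrow> exp_weight a g \<xi>"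
    unfolding exp_weight_def by (intro AE_I2 tendsto_intros) simp
  from L2_Fatou[OF weighted(1)[OF t] weighted(2)[OF t] this exp_weight_measurable[OF g]]
  show "L2 (exp_weight a g)" "l2 (exp_weight a g) \<le> C" .
qed

lemma cauchy_representation:
  fixes F :: "real \<times> (real, 'm::{finite,linorder}) vec \<Rightarrow> 'm clif"
  assumes a: "a > 0" and F: "left_monogenic (slab {-a<..<a}) F" "L2_slices {-a<..<a} F M"
    and g: "is_fourier_L2 (\<lambda>x. F (0, x)) g"
  shows "L2 (exp_weight a g)" "l2 (exp_weight a g) \<le> sqrt 2 * (sqrt ((2 * pi) ^ CARD('m)) * M)"
    "\<And>x. x \<in> strip a \<Longrightarrow> F x = cauchy_ext g x"
proof -
  have g_measurable: "g \<in> borel_measurable borel"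
    using g by (auto simp: is_fourier_L2_def L2fun_iff_L2 dest: L2_measurable)
  have slice: "L2 (\<lambda>x. F (t, x))" "l2 (\<lambda>x. F (t, x)) \<le> M" if "\<bar>t\<bar> < a" for t
    using L2_slicesD[OF F(2), of t] that by (simp_all add: abs_less_iff)
  note transform = is_fourier_L2_slice[OF F _ g]
  have dirac_exp_le: "L2 (\<lambda>\<xi>. dirac_exp t \<xi> (g \<xi>))" "l2 (\<lambda>\<xi>. dirac_exp t \<xi> (g \<xi>)) \<le> sqrt ((2 * pi) ^ CARD('m)) * M"
    if t: "\<bar>t\<bar> < a" for t
  proof -
    show "L2 (\<lambda>\<xi>. dirac_exp t \<xi> (g \<xi>))" using transform[OF t] by (simp add: is_fourier_L2_def L2fun_iff_L2)
    show "l2 (\<lambda>\<xi>. dirac_exp t \<xi> (g \<xi>)) \<le> sqrt ((2 * pi) ^ CARD('m)) * M"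
      by (rule order_trans[OF is_fourier_L2_l2_le[OF slice(1)[OF t] transform[OF t]]
          mult_left_mono[OF slice(2)[OF t]]]) simp
  qed
  have exp_weight_le: "L2 (exp_weight t g)" "l2 (exp_weight t g) \<le> sqrt 2 * (sqrt ((2 * pi) ^ CARD('m)) * M)"
    if "0 \<le> t" "t < a" for t
    using L2_exp_weight_if_L2_dirac_exp[OF g_measurable dirac_exp_le[of t] dirac_exp_le[of "- t"]] that by simp_all
  show weighted: "L2 (exp_weight a g)"
    by (rule L2_exp_weight_limit(1)[OF g_measurable a exp_weight_le])
  show "l2 (exp_weight a g) \<le> sqrt 2 * (sqrt ((2 * pi) ^ CARD('m)) * M)"
    by (rule L2_exp_weight_limit(2)[OF g_measurable a exp_weight_le])
  show "F x = cauchy_ext g x" if "x \<in> strip a" for x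
  proof (cases x)
    case (Pair t y)
    then have t: "\<bar>t\<bar> < a" using that by (simp add: strip_def)
    have "continuous_on UNIV (\<lambda>y. F (t, y))"
      using t by (intro continuous_on_slice[OF left_monogenic_continuous[OF F(1)]]) auto
    then have "isCont (\<lambda>y. F (t, y)) y" by (simp add: continuous_on_eq_continuous_at)
    from fourier_inversion[OF slice(1)[OF t] this transform[OF t] L2_dirac_exp(2)[OF weighted t]]
    show ?thesis by (simp add: Pair cauchy_ext_slice)
  qed
qed

lemma H2_strip_imp_cauchy_ext:
  fixes F :: "real \<times> (real, 'm::{finite,linorder}) vec \<Rightarrow> 'm clif"
  assumes a: "a > 0" and F: "H2 (strip a) F"
  shows "\<exists>g. is_fourier_L2 (\<lambda>x. F (0, x)) g \<and> L2 (exp_weight a g) \<and> (\<forall>x\<in>strip a. F x = cauchy_ext g x)"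
proof -
  from F obtain M where F: "left_monogenic (slab {-a<..<a}) F" "L2_slices {-a<..<a} F M"
    unfolding strip_slab H2_slab_iff by blast
  have "L2 (\<lambda>x. F (0, x))" using a by (intro L2_slicesD(1)[OF F(2)]) simp
  then obtain g where g: "is_fourier_L2 (\<lambda>x. F (0, x)) g" by (rule is_fourier_L2_exists)
  then show ?thesis using cauchy_representation(1,3)[OF a F g] by blast
qed

lemma exp_weight_bounded_imp_AE_eq_0:
  fixes g :: "'a::euclidean_space \<Rightarrow> 'b::euclidean_space"
  assumes L2: "\<And>b. b > 0 \<Longrightarrow> L2 (exp_weight b g)" and l2_le: "\<And>b. b > 0 \<Longrightarrow> l2 (exp_weight b g) \<le> C"
  shows "AE \<xi> in lborel. g \<xi> = 0"
proof -
  have g_measurable: "g \<in> borel_measurable borel" by (rule L2_exp_weight_measurable[OF L2[of 1]]) simp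
  have norm_le: "norm (norm \<xi> *\<^sub>R g \<xi>) \<le> 1 / b * norm (exp_weight b g \<xi>)" if b: "b > 0" for b \<xi>
  proof -
    have "b * norm \<xi> \<le> exp (b * norm \<xi>)" using exp_ge_add_one_self[of "b * norm \<xi>"] by linarith
    then have "b * norm \<xi> * norm (g \<xi>) \<le> exp (b * norm \<xi>) * norm (g \<xi>)" by (rule mult_right_mono) simp
    then show ?thesis using b by (simp add: exp_weight_def field_simps)
  qed
  have dominated: "L2 (\<lambda>\<xi>. norm \<xi> *\<^sub>R g \<xi>)" "l2 (\<lambda>\<xi>. norm \<xi> *\<^sub>R g \<xi>) \<le> 1 / b * l2 (exp_weight b g)" if "b > 0" for b
    using L2_dominated[OF L2[OF that], of "\<lambda>\<xi>. norm \<xi> *\<^sub>R g \<xi>" "1 / b"] norm_le[OF that] g_measurable that by simp_all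
  have "l2 (\<lambda>\<xi>. norm \<xi> *\<^sub>R g \<xi>) \<le> C / real (Suc n)" for n
    using dominated(2)[of "real (Suc n)"] l2_le[of "real (Suc n)"] by (simp add: field_simps)
  moreover have "(\<lambda>n. C / real (Suc n)) \<longlonglongrightarrow> 0"
    by (rule LIMSEQ_Suc[OF lim_const_over_n])
  ultimately have "l2 (\<lambda>\<xi>. norm \<xi> *\<^sub>R g \<xi>) \<le> 0"
    by (intro LIMSEQ_le_const) auto
  from l2_le_0_imp_AE_eq_0[OF dominated(1)[OF zero_less_one] this]
  have "AE \<xi> in lborel. norm \<xi> *\<^sub>R g \<xi> = 0" .
  with AE_lborel_singleton[of "0 :: 'a"] show ?thesis by eventually_elim simp
qed

text \<open>A Liouville-type theorem; it makes the two summands of the decomposition independent.\<close>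
lemma entire_H2_eq_0:
  fixes G :: "real \<times> (real, 'm::{finite,linorder}) vec \<Rightarrow> 'm clif"
  assumes "H2 (slab UNIV) G" shows "G x = 0"
proof -
  from assms obtain M where G: "left_monogenic (slab UNIV) G" "L2_slices UNIV G M"
    unfolding H2_slab_iff by blast
  have G_strip: "left_monogenic (slab {-b<..<b}) G" "L2_slices {-b<..<b} G M" for b
    by (rule left_monogenic_subset[OF G(1) open_slab] L2_slices_subset[OF G(2)]; auto)+
  have "L2 (\<lambda>x. G (0, x))" by (rule L2_slicesD(1)[OF G(2)]) simp
  then obtain g where g: "is_fourier_L2 (\<lambda>x. G (0, x)) g" by (rule is_fourier_L2_exists)
  note representation = cauchy_representation[OF _ G_strip g]
  have g_eq_0: "AE \<xi> in lborel. g \<xi> = 0"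
    by (rule exp_weight_bounded_imp_AE_eq_0[OF representation(1,2)])
  have "G x = cauchy_ext g x"
    by (rule representation(3)[of "\<bar>fst x\<bar> + 1"]) (auto simp: strip_def)
  also have "(\<integral>\<xi>. clif_mult (ekern x \<xi>) (g \<xi>) \<partial>lborel) = 0"
    using g_eq_0 by (intro integral_eq_zero_AE) (auto elim!: eventually_mono simp: linear_0[OF linear_clif_mult_right])
  then have "cauchy_ext g x = 0" by (simp add: cauchy_ext_def)
  finally show ?thesis .
qed

lemma H2_halfplus_eq_halfminus_imp_0:
  fixes p q :: "real \<times> (real, 'm::{finite,linorder}) vec \<Rightarrow> 'm clif"
  assumes a: "a > 0" and p: "H2 (halfplus a) p" and q: "H2 (halfminus a) q"
    and p_eq_q: "\<And>x. x \<in> strip a \<Longrightarrow> p x = q x"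
  shows "x \<in> halfplus a \<Longrightarrow> p x = 0" "x \<in> halfminus a \<Longrightarrow> q x = 0"
proof -
  define G where "G x = (if x \<in> halfplus a then p x else q x)" for x
  have G_q: "G x = q x" if "x \<in> halfminus a" for x
    using that p_eq_q[of x] by (auto simp: G_def halfplus_def halfminus_def strip_def)
  have G_plus: "H2 (slab {-a<..}) G" and G_minus: "H2 (slab {..<a}) G"
    using H2_slab_cong[of "{-a<..}" p G] H2_slab_cong[of "{..<a}" q G] p q G_q
    by (simp_all add: G_def halfplus_slab halfminus_slab)
  from G_plus obtain M where M: "left_monogenic (slab {-a<..}) G" "L2_slices {-a<..} G M"
    unfolding H2_slab_iff by blast
  from G_minus obtain N where N: "left_monogenic (slab {..<a}) G" "L2_slices {..<a} G N"
    unfolding H2_slab_iff by blast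
  have "left_monogenic (slab UNIV) G"
  proof -
    have "slab {-a<..} \<union> slab {..<a} = (slab UNIV :: (real \<times> (real, 'm) vec) set)"
      using a by (auto simp: slab_def)
    then show ?thesis using left_monogenic_Un[OF M(1) N(1)] by simp
  qed
  moreover have "L2 (\<lambda>y. G (t, y)) \<and> l2 (\<lambda>y. G (t, y)) \<le> max M N" for t
    using L2_slicesD[OF M(2), of t] L2_slicesD[OF N(2), of t] a by (cases "- a < t") auto
  then have "L2_slices UNIV G (max M N)" by (simp add: L2_slices_def)
  ultimately have "G x = 0" for x by (intro entire_H2_eq_0) (auto simp: H2_slab_iff)
  then show "x \<in> halfplus a \<Longrightarrow> p x = 0" "x \<in> halfminus a \<Longrightarrow> q x = 0"
    using G_q by (metis G_def)+
qed

lemma H2_decomposition_unique: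
  fixes F p p' q q' :: "real \<times> (real, 'm::{finite,linorder}) vec \<Rightarrow> 'm clif"
  assumes a: "a > 0"
    and "H2 (halfplus a) p" "H2 (halfminus a) q" "\<forall>x\<in>strip a. F x = p x + q x"
    and "H2 (halfplus a) p'" "H2 (halfminus a) q'" "\<forall>x\<in>strip a. F x = p' x + q' x"
  shows "x \<in> halfplus a \<Longrightarrow> p x = p' x" "x \<in> halfminus a \<Longrightarrow> q x = q' x"
proof -
  have differences: "H2 (halfplus a) (\<lambda>x. p x - p' x)" "H2 (halfminus a) (\<lambda>x. q' x - q x)"
    using assms unfolding halfplus_slab halfminus_slab by (simp_all add: H2_slab_diff)
  have "p x - p' x = q' x - q x" if "x \<in> strip a" for x
  proof -
    have "p x + q x = p' x + q' x" using assms(4,7) that by auto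
    then show ?thesis by (simp add: algebra_simps)
  qed
  from H2_halfplus_eq_halfminus_imp_0[OF a differences this]
  show "x \<in> halfplus a \<Longrightarrow> p x = p' x" "x \<in> halfminus a \<Longrightarrow> q x = q' x" by simp_all
qed

lemma H2_strip_decomposition:
  fixes F :: "real \<times> (real, 'm::{finite,linorder}) vec \<Rightarrow> 'm clif"
  assumes "a > 0" "H2 (strip a) F"
  shows "\<exists>p q. H2 (halfplus a) p \<and> H2 (halfminus a) q \<and> (\<forall>x\<in>strip a. F x = p x + q x)"
proof -
  obtain g where g: "L2 (exp_weight a g)" "\<forall>x\<in>strip a. F x = cauchy_ext g x"
    using H2_strip_imp_cauchy_ext[OF assms] by blast
  then have "\<forall>x\<in>strip a. F x = spectral_part 1 g x + spectral_part (-1) g x"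
    by (simp add: cauchy_ext_eq_spectral_parts)
  then show ?thesis
    using spectral_part_H2_halfplus[OF g(1)] spectral_part_H2_halfminus[OF g(1)] by blast
qed

lemma is_fourier_L2_cauchy_ext:
  fixes f :: "(real, 'm::{finite,linorder}) vec \<Rightarrow> 'm clif"
  assumes a: "a > 0" and f: "f \<in> borel_measurable borel" and g: "L2 (exp_weight a g)"
    and f_eq: "AE x in lborel. f x = cauchy_ext g (0, x)"
  shows "is_fourier_L2 f g"
proof -
  obtain h where h: "is_fourier_L2 (\<lambda>x. cauchy_ext g (0, x)) h" "L2 (exp_weight a h)"
    "\<forall>x\<in>strip a. cauchy_ext g x = cauchy_ext h x"
    using H2_strip_imp_cauchy_ext[OF a cauchy_ext_H2[OF g]] by blast
  have integrable: "integrable lborel g" "integrable lborel h"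
    using exp_weight_integrable[OF g a] exp_weight_integrable[OF h(2) a] by simp_all
  have "fourier 1 (\<lambda>\<xi>. h \<xi> - g \<xi>) y = 0" for y
    using bspec[OF h(3), of "(0, y)"] a by (simp add: strip_def cauchy_ext_slice fourier_diff integrable)
  from fourier_unique[OF _ Bochner_Integration.integrable_diff[OF integrable(2,1)] this]
  have "AE \<xi> in lborel. h \<xi> = g \<xi>" by simp
  moreover have "L2 (\<lambda>x. cauchy_ext g (0, x))"
    using cauchy_ext_H2[OF g] a by (auto simp: strip_slab H2_slab_iff dest: L2_slicesD(1)[where t=0])
  moreover have "AE x in lborel. cauchy_ext g (0, x) = f x" using f_eq by eventually_elim simp
  ultimately show ?thesis
    using is_fourier_L2_cong_AE[OF h(1)] f L2_exp_weight_measurable[OF g] by blast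
qed

lemma H2_strip_trace_iff:
  fixes f :: "(real, 'm::{finite,linorder}) vec \<Rightarrow> 'm clif"
  assumes a: "a > 0"
  shows "(\<exists>F. H2 (strip a) F \<and> (AE x in lborel. f x = F (0, x))) \<longleftrightarrow>
    (\<exists>g. L2 (exp_weight a g) \<and> (AE x in lborel. f x = cauchy_ext g (0, x)))"
proof
  assume "\<exists>F. H2 (strip a) F \<and> (AE x in lborel. f x = F (0, x))"
  then obtain F where F: "H2 (strip a) F" "AE x in lborel. f x = F (0, x)" by blast
  obtain g where "L2 (exp_weight a g)" "\<forall>x\<in>strip a. F x = cauchy_ext g x"
    using H2_strip_imp_cauchy_ext[OF a F(1)] by blast
  then show "\<exists>g. L2 (exp_weight a g) \<and> (AE x in lborel. f x = cauchy_ext g (0, x))"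
    using F(2) a by (auto simp: strip_def)
qed (use cauchy_ext_H2 in blast)

theorem theorem3p2:
  fixes f :: "(real, 'm::{finite,linorder}) vec \<Rightarrow> 'm clif" and a :: real
  assumes "a > 0" and "L2fun f"
  shows "((\<exists>F. H2 (strip a) F \<and> (AE x in lborel. f x = F (0, x))) \<longleftrightarrow>
           (\<exists>g. g \<in> borel_measurable lborel \<and> L2fun (\<lambda>\<xi>. exp (a * norm \<xi>) *\<^sub>R g \<xi>) \<and>
                (AE x in lborel. f x = cauchy_ext g (0, x))))
       \<and> (\<forall>F. H2 (strip a) F \<and> (AE x in lborel. f x = F (0, x)) \<longrightarrow>
           (\<exists>g. g \<in> borel_measurable lborel \<and> L2fun (\<lambda>\<xi>. exp (a * norm \<xi>) *\<^sub>R g \<xi>) \<and>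
                (\<forall>x\<in>strip a. F x = cauchy_ext g x)))
       \<and> (\<forall>g. g \<in> borel_measurable lborel \<and> L2fun (\<lambda>\<xi>. exp (a * norm \<xi>) *\<^sub>R g \<xi>) \<and>
                (AE x in lborel. f x = cauchy_ext g (0, x)) \<longrightarrow> is_fourier_L2 f g)
       \<and> (\<forall>F::real \<times> (real, 'm) vec \<Rightarrow> 'm clif. H2 (strip a) F \<longrightarrow>
           (\<exists>fp fm. H2 (halfplus a) fp \<and> H2 (halfminus a) fm \<and>
                    (\<forall>x\<in>strip a. F x = fp x + fm x)))
       \<and> (\<forall>(F::real \<times> (real, 'm) vec \<Rightarrow> 'm clif) fp fm fp' fm'. H2 (strip a) F \<and>
             H2 (halfplus a) fp \<and> H2 (halfminus a) fm \<and> (\<forall>x\<in>strip a. F x = fp x + fm x) \<and>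
             H2 (halfplus a) fp' \<and> H2 (halfminus a) fm' \<and> (\<forall>x\<in>strip a. F x = fp' x + fm' x) \<longrightarrow>
             (\<forall>x\<in>halfplus a. fp x = fp' x) \<and> (\<forall>x\<in>halfminus a. fm x = fm' x))
       \<and> (\<forall>(fp::real \<times> (real, 'm) vec \<Rightarrow> 'm clif) fm. H2 (halfplus a) fp \<and> H2 (halfminus a) fm \<longrightarrow>
             H2 (strip a) (\<lambda>x. fp x + fm x))"
proof -
  have weighted_iff: "g \<in> borel_measurable lborel \<and> L2fun (\<lambda>\<xi>. exp (a * norm \<xi>) *\<^sub>R g \<xi>) \<and> P \<longleftrightarrow> L2 (exp_weight a g) \<and> P"
    for g :: "(real, 'm) vec \<Rightarrow> 'm clif" and P
    using L2_exp_weight_measurable[of a g] by (auto simp: L2fun_iff_L2 exp_weight_def[abs_def])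
  show ?thesis
    unfolding weighted_iff
  proof (intro conjI allI impI)
    show "(\<exists>F. H2 (strip a) F \<and> (AE x in lborel. f x = F (0, x))) \<longleftrightarrow>
        (\<exists>g. L2 (exp_weight a g) \<and> (AE x in lborel. f x = cauchy_ext g (0, x)))"
      by (rule H2_strip_trace_iff[OF assms(1)])
    show "\<exists>g. L2 (exp_weight a g) \<and> (\<forall>x\<in>strip a. F x = cauchy_ext g x)"
      if "H2 (strip a) F \<and> (AE x in lborel. f x = F (0, x))" for F
      using that H2_strip_imp_cauchy_ext[OF assms(1)] by blast
    show "is_fourier_L2 f g" if "L2 (exp_weight a g) \<and> (AE x in lborel. f x = cauchy_ext g (0, x))" for g
      using that assms by (intro is_fourier_L2_cauchy_ext[of a]) (auto simp: L2fun_def)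
  qed (blast intro: H2_strip_decomposition[OF assms(1)] H2_decomposition_unique[OF assms(1)] H2_strip_add)+
qed

end
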